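(* Let $N^5$ be an (oriented) totally geodesic hypersurface of a nearly Kähler $6$-manifold $M^6$. Then $N^5$ admits a Sasaki-Einstein hypo structure, that is, an $SU(2)$-structure $(\eta,\omega_1,\omega_2,\omega_3)$ satisfying $d\eta=-2\omega_3$, $d\omega_1=3\eta\wedge\omega_2$, $d\omega_2=-3\eta\wedge\omega_1$, for which the relabelled $SU(2)$-structure $(\eta,\omega_3,\omega_1,\omega_2)$ is hypo; and consequently the Conti–Salamon evolution equations $$\partial_t\omega_1=-d\eta,\qquad \partial_t(\eta\wedge\omega_3)=d\omega_2,\qquad \partial_t(\eta\wedge\omega_2)=-d\omega_3$$ can be solved for $N^5\times\mathbb{R}$: there is a one-parameter family of hypo structures $(\eta(t),\omega_1(t),\omega_2(t),\omega_3(t))$ on $N^5$, with $t\in(0,\infty)\cong\mathbb{R}$, containing the hypo structure $(\eta,\omega_3,\omega_1,\omega_2)$ and satisfying these equations.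
   Context: An $SU(3)$-structure on a $6$-manifold is a triple $(F,\Psi_+,\Psi_-)$ of a $2$-form and two $3$-forms such that locally there is a coframe $e^1,\dots,e^6$ with $F=e^{12}+e^{34}+e^{56}$ and $\Psi_++i\Psi_-=(e^1+ie^2)\wedge(e^3+ie^4)\wedge(e^5+ie^6)$; its metric makes this coframe orthonormal. It is nearly Kähler if $dF=3\Psi_+$ and $d\Psi_-=-2F\wedge F$. "Totally geodesic" refers to this metric. An $SU(2)$-structure on a $5$-manifold is a quadruplet $(\eta,\omega_1,\omega_2,\omega_3)$ of a $1$-form $\eta$ and $2$-forms $\omega_i$ with $\omega_i\wedge\omega_j=\delta_{ij}v$ for some $4$-form $v$ with $v\wedge\eta$ nowhere zero, and such that $X\lrcorner\omega_1=Y\lrcorner\omega_2$ implies $\omega_3(X,Y)\ge 0$. It is hypo if $d\omega_1=0$, $d(\eta\wedge\omega_2)=0$, $d(\eta\wedge\omega_3)=0$. In the evolution equations $d$ is the exterior derivative on $N^5$ and the unknowns are the $t$-dependent forms $\eta(t),\omega_i(t)$. *)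

theory Defs
  imports "HOL-Analysis.Analysis"
begin

section \<open>Smooth maps between open subsets of Euclidean spaces\<close>

primrec Ck_on :: "nat \<Rightarrow> 'a::real_normed_vector set \<Rightarrow> ('a \<Rightarrow> 'b::real_normed_vector) \<Rightarrow> bool" where
  "Ck_on 0 S f \<longleftrightarrow> continuous_on S f"
| "Ck_on (Suc k) S f \<longleftrightarrow>
     (\<forall>x\<in>S. f differentiable (at x)) \<and> (\<forall>v. Ck_on k S (\<lambda>x. frechet_derivative f (at x) v))"

text \<open>Only meaningful for open \<open>S\<close>.\<close>
definition smooth_on :: "'a::real_normed_vector set \<Rightarrow> ('a \<Rightarrow> 'b::real_normed_vector) \<Rightarrow> bool" where
  "smooth_on S f \<longleftrightarrow> (\<forall>k. Ck_on k S f)"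


section \<open>Exterior algebra at a point\<close>

text \<open>
  A \<open>k\<close>-covector on \<open>'v\<close> is an alternating multilinear function on lists of length \<open>k\<close>. It is
  required to vanish on lists of any other length, so its degree need not be passed to the
  operations below.
\<close>
type_synonym ('v, 'f) covector = "'v list \<Rightarrow> 'f"

definition alternating :: "nat \<Rightarrow> ('v::real_vector, real) covector \<Rightarrow> bool" where
  "alternating k a \<longleftrightarrow>
     (\<forall>vs. length vs \<noteq> k \<longrightarrow> a vs = 0) \<and>
     (\<forall>vs i. length vs = k \<and> i < k \<longrightarrow> linear (\<lambda>u. a (vs[i := u]))) \<and>
     (\<forall>vs. length vs = k \<and> \<not> distinct vs \<longrightarrow> a vs = 0)"

definition shuffle_sign :: "nat \<Rightarrow> nat set \<Rightarrow> int" where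
  "shuffle_sign n S = (-1) ^ card {(i, j). i \<in> S \<and> j \<in> {..<n} - S \<and> j < i}"

text \<open>
  The wedge product as a sum over shuffles: \<open>S\<close> is the set of positions fed to the first factor.
  No factorials occur, i.e. \<open>(a \<and> b)(u, v) = a(u) b(v) - a(v) b(u)\<close> for 1-forms. The values may be
  real or complex.
\<close>
definition wedge :: "('v, 'f) covector \<Rightarrow> ('v, 'f) covector \<Rightarrow> ('v, 'f::comm_ring_1) covector" where
  "wedge a b vs = (\<Sum>S\<in>Pow {..<length vs}.
     of_int (shuffle_sign (length vs) S) * a (nths vs S) * b (nths vs ({..<length vs} - S)))"

definition interior :: "'v \<Rightarrow> ('v, 'f) covector \<Rightarrow> ('v, 'f) covector" where
  "interior X a vs = a (X # vs)"

definition complex_covector :: "('v, real) covector \<Rightarrow> ('v, real) covector \<Rightarrow> ('v, complex) covector" where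
  "complex_covector a b vs = Complex (a vs) (b vs)"


section \<open>Smooth manifolds\<close>

text \<open>A chart is a coordinate neighbourhood together with its coordinate map.\<close>
type_synonym ('a, 'v) chart = "'a set \<times> ('a \<Rightarrow> 'v)"

abbreviation cdom :: "('a, 'v) chart \<Rightarrow> 'a set" where "cdom c \<equiv> fst c"
abbreviation cmap :: "('a, 'v) chart \<Rightarrow> 'a \<Rightarrow> 'v" where "cmap c \<equiv> snd c"
abbreviation cimg :: "('a, 'v) chart \<Rightarrow> 'v set" where "cimg c \<equiv> cmap c ` cdom c"
abbreviation cinv :: "('a, 'v) chart \<Rightarrow> 'v \<Rightarrow> 'a" where "cinv c \<equiv> inv_into (cdom c) (cmap c)"

text \<open>The atlas is not required to be maximal.\<close>
record ('a, 'v) manifold =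
  mtop :: "'a topology"
  atlas :: "('a, 'v) chart set"

definition smooth_manifold :: "('a, 'v::euclidean_space) manifold \<Rightarrow> bool" where
  "smooth_manifold M \<longleftrightarrow>
     Hausdorff_space (mtop M) \<and> second_countable (mtop M) \<and>
     (\<forall>c\<in>atlas M. openin (mtop M) (cdom c) \<and> open (cimg c) \<and>
        homeomorphic_map (subtopology (mtop M) (cdom c)) (top_of_set (cimg c)) (cmap c)) \<and>
     (\<Union>c\<in>atlas M. cdom c) = topspace (mtop M) \<and>
     (\<forall>c\<in>atlas M. \<forall>c'\<in>atlas M. smooth_on (cmap c ` (cdom c \<inter> cdom c')) (cmap c' \<circ> cinv c))"


section \<open>Differential forms\<close>

text \<open>A form on an open subset of the vector space \<open>'v\<close>.\<close>
type_synonym 'v lform = "'v \<Rightarrow> ('v, real) covector"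

text \<open>
  A form on a manifold is the family of its coordinate representations: \<open>\<alpha> c\<close> is a form on
  the open set \<open>cimg c\<close>, and the representations are related by pullback along the transition maps.
\<close>
type_synonym ('a, 'v) mform = "('a, 'v) chart \<Rightarrow> 'v lform"

definition smooth_lform_on :: "nat \<Rightarrow> 'v::euclidean_space set \<Rightarrow> 'v lform \<Rightarrow> bool" where
  "smooth_lform_on k V a \<longleftrightarrow>
     (\<forall>x\<in>V. alternating k (a x)) \<and> (\<forall>vs. smooth_on V (\<lambda>x. a x vs))"

definition kform :: "('a, 'v::euclidean_space) manifold \<Rightarrow> nat \<Rightarrow> ('a, 'v) mform \<Rightarrow> bool" where
  "kform M k \<alpha> \<longleftrightarrow>
     (\<forall>c\<in>atlas M. smooth_lform_on k (cimg c) (\<alpha> c)) \<and>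
     (\<forall>c\<in>atlas M. \<forall>c'\<in>atlas M. \<forall>p\<in>cdom c \<inter> cdom c'. \<forall>vs.
        \<alpha> c (cmap c p) vs =
        \<alpha> c' (cmap c' p) (map (frechet_derivative (cmap c' \<circ> cinv c) (at (cmap c p))) vs))"

definition form_eq :: "('a, 'v) mform \<Rightarrow> ('a, 'v) manifold \<Rightarrow> ('a, 'v) mform \<Rightarrow> bool"
    ("(_/ \<approx>\<^bsub>_\<^esub> _)" [51, 0, 51] 50) where
  "\<alpha> \<approx>\<^bsub>M\<^esub> \<beta> \<longleftrightarrow> (\<forall>c\<in>atlas M. \<forall>x\<in>cimg c. \<alpha> c x = \<beta> c x)"

definition zero_form :: "('a, 'v) mform" ("\<zero>\<^sub>f") where
  "zero_form c x vs = 0"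

definition scale_form :: "real \<Rightarrow> ('a, 'v) mform \<Rightarrow> ('a, 'v) mform" (infixr "\<odot>" 75) where
  "(r \<odot> \<alpha>) c x vs = r * \<alpha> c x vs"

definition wedge_form :: "('a, 'v) mform \<Rightarrow> ('a, 'v) mform \<Rightarrow> ('a, 'v) mform" (infixr "\<triangle>" 80) where
  "(\<alpha> \<triangle> \<beta>) c x = wedge (\<alpha> c x) (\<beta> c x)"

text \<open>
  \<open>(da)(v\<^sub>0, \<dots>, v\<^sub>k) = \<Sum>\<^sub>i (-1)\<^sup>i (D a(v\<^sub>i))(v\<^sub>0, \<dots>, omit v\<^sub>i, \<dots>, v\<^sub>k)\<close> in coordinates; this is the
  normalisation matching that of \<open>wedge\<close>.
\<close>
definition ext_deriv :: "('a, 'v::euclidean_space) mform \<Rightarrow> ('a, 'v) mform" where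
  "ext_deriv \<alpha> c x vs = (\<Sum>i<length vs.
     (-1) ^ i * frechet_derivative (\<lambda>y. \<alpha> c y (take i vs @ drop (Suc i) vs)) (at x) (vs ! i))"

definition nowhere_zero :: "('a, 'v) manifold \<Rightarrow> ('a, 'v) mform \<Rightarrow> bool" where
  "nowhere_zero M \<alpha> \<longleftrightarrow> (\<forall>c\<in>atlas M. \<forall>x\<in>cimg c. \<exists>vs. \<alpha> c x vs \<noteq> 0)"

definition orientation_form :: "('a, 'v::euclidean_space) manifold \<Rightarrow> ('a, 'v) mform \<Rightarrow> bool" where
  "orientation_form M \<mu> \<longleftrightarrow> kform M DIM('v) \<mu> \<and> nowhere_zero M \<mu>"


section \<open>Riemannian metrics and the Levi-Civita connection\<close>

type_synonym ('a, 'v) mmetric = "('a, 'v) chart \<Rightarrow> 'v \<Rightarrow> 'v \<Rightarrow> 'v \<Rightarrow> real"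

definition riemannian_metric :: "('a, 'v::euclidean_space) manifold \<Rightarrow> ('a, 'v) mmetric \<Rightarrow> bool" where
  "riemannian_metric M g \<longleftrightarrow>
     (\<forall>c\<in>atlas M.
        (\<forall>x\<in>cimg c. bilinear (g c x) \<and> (\<forall>u v. g c x u v = g c x v u) \<and>
           (\<forall>u. u \<noteq> 0 \<longrightarrow> 0 < g c x u u)) \<and>
        (\<forall>u v. smooth_on (cimg c) (\<lambda>x. g c x u v))) \<and>
     (\<forall>c\<in>atlas M. \<forall>c'\<in>atlas M. \<forall>p\<in>cdom c \<inter> cdom c'. \<forall>u v.
        g c (cmap c p) u v =
        g c' (cmap c' p) (frechet_derivative (cmap c' \<circ> cinv c) (at (cmap c p)) u)
                         (frechet_derivative (cmap c' \<circ> cinv c) (at (cmap c p)) v))"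

text \<open>
  The Christoffel symbols \<open>\<Gamma>(u, v) = \<nabla>\<^sub>u v\<close> (for constant coordinate fields \<open>u, v\<close>) of the Levi-Civita
  connection of a metric \<open>g\<close> on an open set, given by the Koszul formula.
\<close>
definition christoffel :: "('v::euclidean_space \<Rightarrow> 'v \<Rightarrow> 'v \<Rightarrow> real) \<Rightarrow> 'v \<Rightarrow> 'v \<Rightarrow> 'v \<Rightarrow> 'v" where
  "christoffel g x u v = (THE w. \<forall>z. 2 * g x w z =
       frechet_derivative (\<lambda>y. g y v z) (at x) u
     + frechet_derivative (\<lambda>y. g y u z) (at x) v
     - frechet_derivative (\<lambda>y. g y u v) (at x) z)"


section \<open>Hypersurfaces\<close>

definition local_rep ::
    "('b \<Rightarrow> 'a) \<Rightarrow> ('b, 'w) chart \<Rightarrow> ('a, 'v) chart \<Rightarrow> 'w \<Rightarrow> 'v" where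
  "local_rep f c c' = cmap c' \<circ> f \<circ> cinv c"

definition local_rep_dom ::
    "('b \<Rightarrow> 'a) \<Rightarrow> ('b, 'w) chart \<Rightarrow> ('a, 'v) chart \<Rightarrow> 'w set" where
  "local_rep_dom f c c' = {x \<in> cimg c. f (cinv c x) \<in> cdom c'}"

definition immersion ::
    "('b, 'w::euclidean_space) manifold \<Rightarrow> ('a, 'v::euclidean_space) manifold \<Rightarrow> ('b \<Rightarrow> 'a) \<Rightarrow> bool" where
  "immersion N M f \<longleftrightarrow>
     continuous_map (mtop N) (mtop M) f \<and>
     (\<forall>c\<in>atlas N. \<forall>c'\<in>atlas M.
        smooth_on (local_rep_dom f c c') (local_rep f c c') \<and>
        (\<forall>x\<in>local_rep_dom f c c'. inj (frechet_derivative (local_rep f c c') (at x))))"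

text \<open>
  \<open>\<nabla>\<^sub>X (h\<^sub>* Y)\<close> at \<open>x\<close>, for a map \<open>h\<close> between open sets of vector spaces and \<open>Y\<close> constant in
  coordinates.
\<close>
definition cov_deriv_along ::
    "('v::euclidean_space \<Rightarrow> 'v \<Rightarrow> 'v \<Rightarrow> real) \<Rightarrow> ('w::euclidean_space \<Rightarrow> 'v) \<Rightarrow> 'w \<Rightarrow> 'w \<Rightarrow> 'w \<Rightarrow> 'v" where
  "cov_deriv_along g h x X Y =
     frechet_derivative (\<lambda>y. frechet_derivative h (at y) Y) (at x) X
   + christoffel g (h x) (frechet_derivative h (at x) X) (frechet_derivative h (at x) Y)"

definition normal_part :: "('v::euclidean_space \<Rightarrow> 'v \<Rightarrow> real) \<Rightarrow> 'v set \<Rightarrow> 'v \<Rightarrow> 'v" where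
  "normal_part b W u = (THE n. u - n \<in> W \<and> (\<forall>z\<in>W. b n z = 0))"

definition second_fundamental_form ::
    "('v::euclidean_space \<Rightarrow> 'v \<Rightarrow> 'v \<Rightarrow> real) \<Rightarrow> ('w::euclidean_space \<Rightarrow> 'v) \<Rightarrow> 'w \<Rightarrow> 'w \<Rightarrow> 'w \<Rightarrow> 'v" where
  "second_fundamental_form g h x X Y =
     normal_part (g (h x)) (range (frechet_derivative h (at x))) (cov_deriv_along g h x X Y)"

definition totally_geodesic ::
    "('b, 'w::euclidean_space) manifold \<Rightarrow> ('a, 'v::euclidean_space) manifold \<Rightarrow> ('a, 'v) mmetric \<Rightarrow>
     ('b \<Rightarrow> 'a) \<Rightarrow> bool" where
  "totally_geodesic N M g f \<longleftrightarrow>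
     (\<forall>c\<in>atlas N. \<forall>c'\<in>atlas M. \<forall>x\<in>local_rep_dom f c c'. \<forall>X Y.
        second_fundamental_form (g c') (local_rep f c c') x X Y = 0)"


section \<open>SU(3)-structures and nearly Kaehler manifolds\<close>

text \<open>
  \<open>e 1, \<dots>, e 6\<close> is a coframe on the open set \<open>V\<close> in which \<open>F\<close>, \<open>\<Psi>p = \<Psi>\<^sub>+\<close> and \<open>\<Psi>m = \<Psi>\<^sub>-\<close> have
  the standard form.
\<close>
definition adapted_coframe ::
    "(real^6) set \<Rightarrow> (real^6) lform \<Rightarrow> (real^6) lform \<Rightarrow> (real^6) lform \<Rightarrow>
     (nat \<Rightarrow> (real^6) lform) \<Rightarrow> bool" where
  "adapted_coframe V F \<Psi>p \<Psi>m e \<longleftrightarrow>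
     (\<forall>i\<in>{1..6}. smooth_lform_on 1 V (e i)) \<and>
     (\<forall>x\<in>V.
        (\<forall>a. (\<forall>u. (\<Sum>i=1..6. a i * e i x [u]) = 0) \<longrightarrow> (\<forall>i\<in>{1..6}. a i = (0::real))) \<and>
        (\<forall>vs. F x vs = wedge (e 1 x) (e 2 x) vs + wedge (e 3 x) (e 4 x) vs + wedge (e 5 x) (e 6 x) vs) \<and>
        complex_covector (\<Psi>p x) (\<Psi>m x) =
          wedge (complex_covector (e 1 x) (e 2 x))
            (wedge (complex_covector (e 3 x) (e 4 x)) (complex_covector (e 5 x) (e 6 x))))"

definition su3_structure ::
    "('a, real^6) manifold \<Rightarrow> ('a, real^6) mform \<Rightarrow> ('a, real^6) mform \<Rightarrow> ('a, real^6) mform \<Rightarrow> bool" where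
  "su3_structure M F \<Psi>p \<Psi>m \<longleftrightarrow>
     kform M 2 F \<and> kform M 3 \<Psi>p \<and> kform M 3 \<Psi>m \<and>
     (\<forall>c\<in>atlas M. \<forall>x\<in>cimg c. \<exists>V e. open V \<and> x \<in> V \<and> V \<subseteq> cimg c \<and>
        adapted_coframe V (F c) (\<Psi>p c) (\<Psi>m c) e)"

text \<open>\<open>g\<close> is the metric of the SU(3)-structure: adapted coframes are orthonormal.\<close>
definition su3_metric ::
    "('a, real^6) manifold \<Rightarrow> ('a, real^6) mform \<Rightarrow> ('a, real^6) mform \<Rightarrow> ('a, real^6) mform \<Rightarrow>
     ('a, real^6) mmetric \<Rightarrow> bool" where
  "su3_metric M F \<Psi>p \<Psi>m g \<longleftrightarrow>
     riemannian_metric M g \<and>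
     (\<forall>c\<in>atlas M. \<forall>x\<in>cimg c. \<exists>V e. open V \<and> x \<in> V \<and> V \<subseteq> cimg c \<and>
        adapted_coframe V (F c) (\<Psi>p c) (\<Psi>m c) e \<and>
        (\<forall>y\<in>V. \<forall>u v. g c y u v = (\<Sum>i=1..6. e i y [u] * e i y [v])))"

definition nearly_kaehler ::
    "('a, real^6) manifold \<Rightarrow> ('a, real^6) mform \<Rightarrow> ('a, real^6) mform \<Rightarrow> ('a, real^6) mform \<Rightarrow> bool" where
  "nearly_kaehler M F \<Psi>p \<Psi>m \<longleftrightarrow>
     su3_structure M F \<Psi>p \<Psi>m \<and>
     ext_deriv F \<approx>\<^bsub>M\<^esub> 3 \<odot> \<Psi>p \<and>
     ext_deriv \<Psi>m \<approx>\<^bsub>M\<^esub> (-2) \<odot> (F \<triangle> F)"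


section \<open>SU(2)-structures on 5-manifolds\<close>

definition su2_structure ::
    "('b, real^5) manifold \<Rightarrow> ('b, real^5) mform \<Rightarrow> ('b, real^5) mform \<Rightarrow> ('b, real^5) mform \<Rightarrow>
     ('b, real^5) mform \<Rightarrow> bool" where
  "su2_structure N \<eta> \<omega>1 \<omega>2 \<omega>3 \<longleftrightarrow>
     kform N 1 \<eta> \<and> kform N 2 \<omega>1 \<and> kform N 2 \<omega>2 \<and> kform N 2 \<omega>3 \<and>
     (\<exists>v. kform N 4 v \<and> nowhere_zero N (v \<triangle> \<eta>) \<and>
        \<omega>1 \<triangle> \<omega>1 \<approx>\<^bsub>N\<^esub> v \<and> \<omega>2 \<triangle> \<omega>2 \<approx>\<^bsub>N\<^esub> v \<and> \<omega>3 \<triangle> \<omega>3 \<approx>\<^bsub>N\<^esub> v \<and>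
        \<omega>1 \<triangle> \<omega>2 \<approx>\<^bsub>N\<^esub> \<zero>\<^sub>f \<and> \<omega>1 \<triangle> \<omega>3 \<approx>\<^bsub>N\<^esub> \<zero>\<^sub>f \<and> \<omega>2 \<triangle> \<omega>3 \<approx>\<^bsub>N\<^esub> \<zero>\<^sub>f) \<and>
     (\<forall>c\<in>atlas N. \<forall>x\<in>cimg c. \<forall>X Y.
        interior X (\<omega>1 c x) = interior Y (\<omega>2 c x) \<longrightarrow> 0 \<le> \<omega>3 c x [X, Y])"

definition hypo ::
    "('b, real^5) manifold \<Rightarrow> ('b, real^5) mform \<Rightarrow> ('b, real^5) mform \<Rightarrow> ('b, real^5) mform \<Rightarrow>
     ('b, real^5) mform \<Rightarrow> bool" where
  "hypo N \<eta> \<omega>1 \<omega>2 \<omega>3 \<longleftrightarrow>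
     su2_structure N \<eta> \<omega>1 \<omega>2 \<omega>3 \<and>
     ext_deriv \<omega>1 \<approx>\<^bsub>N\<^esub> \<zero>\<^sub>f \<and>
     ext_deriv (\<eta> \<triangle> \<omega>2) \<approx>\<^bsub>N\<^esub> \<zero>\<^sub>f \<and>
     ext_deriv (\<eta> \<triangle> \<omega>3) \<approx>\<^bsub>N\<^esub> \<zero>\<^sub>f"

definition sasaki_einstein_hypo ::
    "('b, real^5) manifold \<Rightarrow> ('b, real^5) mform \<Rightarrow> ('b, real^5) mform \<Rightarrow> ('b, real^5) mform \<Rightarrow>
     ('b, real^5) mform \<Rightarrow> bool" where
  "sasaki_einstein_hypo N \<eta> \<omega>1 \<omega>2 \<omega>3 \<longleftrightarrow>
     su2_structure N \<eta> \<omega>1 \<omega>2 \<omega>3 \<and>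
     ext_deriv \<eta> \<approx>\<^bsub>N\<^esub> (-2) \<odot> \<omega>3 \<and>
     ext_deriv \<omega>1 \<approx>\<^bsub>N\<^esub> 3 \<odot> (\<eta> \<triangle> \<omega>2) \<and>
     ext_deriv \<omega>2 \<approx>\<^bsub>N\<^esub> (-3) \<odot> (\<eta> \<triangle> \<omega>1)"


section \<open>The evolution equations\<close>

text \<open>Coefficients in charts are smooth in the parameter and the point jointly.\<close>
definition smooth_family ::
    "('b, 'w::euclidean_space) manifold \<Rightarrow> real set \<Rightarrow> (real \<Rightarrow> ('b, 'w) mform) \<Rightarrow> bool" where
  "smooth_family N I \<alpha> \<longleftrightarrow>
     (\<forall>c\<in>atlas N. \<forall>vs. smooth_on (I \<times> cimg c) (\<lambda>(t, x). \<alpha> t c x vs))"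

text \<open>\<open>\<partial>\<^sub>t \<alpha> = \<beta>\<close> on \<open>I\<close>.\<close>
definition has_time_deriv ::
    "('b, 'w) manifold \<Rightarrow> real set \<Rightarrow> (real \<Rightarrow> ('b, 'w) mform) \<Rightarrow> (real \<Rightarrow> ('b, 'w) mform) \<Rightarrow> bool" where
  "has_time_deriv N I \<alpha> \<beta> \<longleftrightarrow>
     (\<forall>t\<in>I. \<forall>c\<in>atlas N. \<forall>x\<in>cimg c. \<forall>vs.
        ((\<lambda>s. \<alpha> s c x vs) has_real_derivative \<beta> t c x vs) (at t))"

definition conti_salamon_evolution ::
    "('b, real^5) manifold \<Rightarrow> real set \<Rightarrow> (real \<Rightarrow> ('b, real^5) mform) \<Rightarrow> (real \<Rightarrow> ('b, real^5) mform) \<Rightarrow>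
     (real \<Rightarrow> ('b, real^5) mform) \<Rightarrow> (real \<Rightarrow> ('b, real^5) mform) \<Rightarrow> bool" where
  "conti_salamon_evolution N I \<eta> \<omega>1 \<omega>2 \<omega>3 \<longleftrightarrow>
     has_time_deriv N I \<omega>1 (\<lambda>t. (-1) \<odot> ext_deriv (\<eta> t)) \<and>
     has_time_deriv N I (\<lambda>t. \<eta> t \<triangle> \<omega>3 t) (\<lambda>t. ext_deriv (\<omega>2 t)) \<and>
     has_time_deriv N I (\<lambda>t. \<eta> t \<triangle> \<omega>2 t) (\<lambda>t. (-1) \<odot> ext_deriv (\<omega>3 t))"

end

theory Submission
  imports Defs
begin

text \<open>
  Let \<open>\<nu>\<close> be a unit normal of the hypersurface and \<open>\<xi>\<close> the tangent vector with \<open>\<nu> = J\<xi>\<close>. The structure sought is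
  \<open>\<eta> = g(\<xi>, \<cdot>)\<close>, \<open>\<omega>\<^sub>1 = F\<close>, \<open>\<omega>\<^sub>2 = \<xi> \<lrcorner> \<Psi>\<^sub>+\<close>, \<open>\<omega>\<^sub>3 = \<xi> \<lrcorner> \<Psi>\<^sub>-\<close>, restricted to the hypersurface; equivalently
  \<open>\<eta> = -\<nu> \<lrcorner> F\<close>, \<open>\<omega>\<^sub>2 = \<nu> \<lrcorner> \<Psi>\<^sub>-\<close>, \<open>\<omega>\<^sub>3 = -\<nu> \<lrcorner> \<Psi>\<^sub>+\<close>. The orientation fixes the sign of \<open>\<xi>\<close>: it is
  the positive multiple of the vector \<open>\<zeta>\<close> with \<open>\<zeta> \<lrcorner> \<mu> = \<omega>\<^sub>1 \<and> \<omega>\<^sub>1\<close>.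

  The equations \<open>dF = 3\<Psi>\<^sub>+\<close>, \<open>d\<Psi>\<^sub>- = -2F \<and> F\<close> and \<open>d\<Psi>\<^sub>+ = 0\<close> determine the intrinsic torsion: for
  the Levi-Civita connection, \<open>\<nabla>\<^sub>X F = X \<lrcorner> \<Psi>\<^sub>+\<close> and \<open>\<nabla>\<^sub>X \<Psi>\<^sub>- = -(X \<lrcorner> F) \<and> F\<close>. As \<open>\<nu>\<close> is parallel along a
  totally geodesic hypersurface, differentiating the second set of formulas gives
  \<open>d\<eta> = -2\<omega>\<^sub>3\<close>, \<open>d\<omega>\<^sub>1 = 3\<eta> \<and> \<omega>\<^sub>2\<close> and \<open>d\<omega>\<^sub>2 = -3\<eta> \<and> \<omega>\<^sub>1\<close>. The evolution equations are then solved by the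
  conical family \<open>(t\<eta>, t\<^sup>2\<omega>\<^sub>3, t\<^sup>2\<omega>\<^sub>1, t\<^sup>2\<omega>\<^sub>2)\<close>.
\<close>

section \<open>Calculus of smooth maps\<close>

text \<open>The proof is linear algebra at a point, in an adapted coframe: there the structures have
  constant coefficients and a covariant derivative becomes a skew 6 by 6 matrix acting on
  components. Modulo su(3), which annihilates the standard forms, seven linear combinations of its
  entries remain. In six directions these are 42 numbers, and the components of the three
  differential equations are a linear system for them. Contributions symmetric in two directions
  (Christoffel symbols, second derivatives of the immersion) cancel in exterior derivatives.

  A normal field is not part of the data, so \<xi> is built on the hypersurface itself:
  \<open>F\<close> restricted to five dimensions must have a kernel, which is a line, and the
  equation \<zeta> \<lrcorner> \<mu> = \<omega>1 \<and> \<omega>1 singles out a generator that is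
  found by division, hence depends smoothly on the point and not on the chart.

  The constants fit the cone by homogeneity: \<open>t^2\<close> has derivative \<open>2 t\<close>,
  matching the 2 in d\<eta>, and \<eta> \<and> \<omega>i scales like \<open>t^3\<close>, whose
  derivative supplies the 3.\<close>

lemma Ck_on_cong:
  assumes "open S" "\<And>x. x \<in> S \<Longrightarrow> f x = g x" "Ck_on k S f"
  shows "Ck_on k S g"
  using assms(2,3)
proof (induction k arbitrary: f g)
  case 0
  then show ?case by (simp cong: continuous_on_cong)
next
  case (Suc k)
  have d: "(g has_derivative frechet_derivative f (at x)) (at x)" if "x \<in> S" for x
    using has_derivative_transform_within_open[OF _ assms(1) that, of f _ UNIV g] Suc.prems that
    by (simp add: frechet_derivative_works)
  have fd: "frechet_derivative g (at x) = frechet_derivative f (at x)" if "x \<in> S" for x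
    using frechet_derivative_at[OF d[OF that]] by simp
  have "Ck_on k S (\<lambda>x. frechet_derivative g (at x) v)" for v
    using Suc.IH[of "\<lambda>x. frechet_derivative f (at x) v" "\<lambda>x. frechet_derivative g (at x) v"] fd Suc.prems
    by simp
  then show ?case using d by (auto simp: differentiable_def)
qed

lemma Ck_on_SucD: "Ck_on (Suc k) S f \<Longrightarrow> Ck_on k S f"
proof (induction k arbitrary: f)
  case 0
  then show ?case
    by (auto intro!: differentiable_imp_continuous_on simp: differentiable_on_def
        differentiable_at_withinI)
next
  case (Suc k)
  then show ?case by simp
qed

lemma Ck_on_subset: "Ck_on k S f \<Longrightarrow> T \<subseteq> S \<Longrightarrow> Ck_on k T f"
  by (induction k arbitrary: f) (auto intro: continuous_on_subset)

lemma Ck_on_const: "Ck_on k S (\<lambda>x. c)"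
  by (induction k arbitrary: c) auto

text \<open>Together with \<open>Ck_on_SucE\<close> this trades the chosen
  \<open>frechet_derivative\<close> for any formula for the derivative, so that the inductions below
  can use the product and chain rules in closed form.\<close>

lemma Ck_on_SucI:
  assumes "open S" "\<And>x. x \<in> S \<Longrightarrow> (f has_derivative f' x) (at x)" "\<And>v. Ck_on k S (\<lambda>x. f' x v)"
  shows "Ck_on (Suc k) S f"
proof -
  have "frechet_derivative f (at x) = f' x" if "x \<in> S" for x
    using frechet_derivative_at[OF assms(2)[OF that]] by simp
  then have "Ck_on k S (\<lambda>x. frechet_derivative f (at x) v)" for v
    using Ck_on_cong[OF assms(1) _ assms(3)[of v], of "\<lambda>x. frechet_derivative f (at x) v"] by simp
  then show ?thesis using assms(2) by (auto simp: differentiable_def)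
qed

lemma Ck_on_SucE:
  assumes "Ck_on (Suc k) S f"
  obtains f' where "\<And>x. x \<in> S \<Longrightarrow> (f has_derivative f' x) (at x)" "\<And>v. Ck_on k S (\<lambda>x. f' x v)"
  using that[of "\<lambda>x. frechet_derivative f (at x)"] assms by (simp add: frechet_derivative_works)

lemma Ck_on_linear:
  assumes "open S" "bounded_linear L" "Ck_on k S f"
  shows "Ck_on k S (\<lambda>x. L (f x))"
  using assms(3)
proof (induction k arbitrary: f)
  case 0
  then show ?case by (simp add: assms(2) bounded_linear.continuous_on)
next
  case (Suc k)
  from Suc.prems obtain f' where f': "\<And>x. x \<in> S \<Longrightarrow> (f has_derivative f' x) (at x)"
    "\<And>v. Ck_on k S (\<lambda>x. f' x v)" by (rule Ck_on_SucE) (rule that)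
  show ?case
    by (rule Ck_on_SucI[OF assms(1) bounded_linear.has_derivative[OF assms(2) f'(1)]])
       (auto intro: Suc.IH f')
qed

lemma Ck_on_add:
  assumes "open S" "Ck_on k S f" "Ck_on k S g"
  shows "Ck_on k S (\<lambda>x. f x + g x)"
  using assms(2,3)
proof (induction k arbitrary: f g)
  case 0
  then show ?case by (simp add: continuous_on_add)
next
  case (Suc k)
  from Suc.prems(1) obtain f' where f': "\<And>x. x \<in> S \<Longrightarrow> (f has_derivative f' x) (at x)"
    "\<And>v. Ck_on k S (\<lambda>x. f' x v)" by (rule Ck_on_SucE) (rule that)
  from Suc.prems(2) obtain g' where g': "\<And>x. x \<in> S \<Longrightarrow> (g has_derivative g' x) (at x)"
    "\<And>v. Ck_on k S (\<lambda>x. g' x v)" by (rule Ck_on_SucE) (rule that)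
  show ?case
    by (rule Ck_on_SucI[OF assms(1) has_derivative_add[OF f'(1) g'(1)]]) (auto intro: Suc.IH f' g')
qed

text \<open>The Leibniz formula pairs f with g' and f' with g. The undifferentiated factor is one
  order smoother than the other and is lowered by \<open>Ck_on_SucD\<close> before the induction
  hypothesis applies.\<close>

lemma Ck_on_bilinear:
  assumes "open S" "bounded_bilinear B" "Ck_on k S f" "Ck_on k S g"
  shows "Ck_on k S (\<lambda>x. B (f x) (g x))"
  using assms(3,4)
proof (induction k arbitrary: f g)
  case 0
  then show ?case by (simp add: assms(2) bounded_bilinear.continuous_on)
next
  case (Suc k)
  from Suc.prems(1) obtain f' where f': "\<And>x. x \<in> S \<Longrightarrow> (f has_derivative f' x) (at x)"
    "\<And>v. Ck_on k S (\<lambda>x. f' x v)" by (rule Ck_on_SucE) (rule that)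
  from Suc.prems(2) obtain g' where g': "\<And>x. x \<in> S \<Longrightarrow> (g has_derivative g' x) (at x)"
    "\<And>v. Ck_on k S (\<lambda>x. g' x v)" by (rule Ck_on_SucE) (rule that)
  have c: "Ck_on k S (\<lambda>x. B (f x) (g' x v) + B (f' x v) (g x))" for v
    using Suc.IH[OF Ck_on_SucD[OF Suc.prems(1)] g'(2)] Suc.IH[OF f'(2) Ck_on_SucD[OF Suc.prems(2)]]
    by (rule Ck_on_add[OF assms(1)])
  have "((\<lambda>x. B (f x) (g x)) has_derivative (\<lambda>v. B (f x) (g' x v) + B (f' x v) (g x))) (at x)"
    if "x \<in> S" for x
    by (rule bounded_bilinear.FDERIV[OF assms(2) f'(1)[OF that] g'(1)[OF that]])
  from Ck_on_SucI[OF assms(1) this c] show ?case .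
qed

lemma Ck_on_sum:
  assumes "open S" "\<And>i. i \<in> I \<Longrightarrow> Ck_on k S (f i)"
  shows "Ck_on k S (\<lambda>x. \<Sum>i\<in>I. f i x)"
  using assms(2)
  by (induction I rule: infinite_finite_induct) (auto intro: Ck_on_const Ck_on_add[OF assms(1)])

lemma linear_expand:
  fixes w :: "'a::euclidean_space"
  assumes "linear L"
  shows "L w = (\<Sum>b\<in>Basis. (w \<bullet> b) *\<^sub>R L b)"
proof -
  have "L w = L (\<Sum>b\<in>Basis. (w \<bullet> b) *\<^sub>R b)" by (simp add: euclidean_representation)
  also have "\<dots> = (\<Sum>b\<in>Basis. (w \<bullet> b) *\<^sub>R L b)"
    using assms by (simp add: linear_sum linear_scale)
  finally show ?thesis .
qed

text \<open>In g'(f x)(f' x v) both the linear map and its argument vary with x. Expanding the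
  argument in \<open>Basis\<close> separates them into scalar components of f' and maps sending x to
  g'(f x) b; the latter are compositions with the same f, which is why the induction generalises
  over g only.\<close>

lemma Ck_on_compose:
  fixes f :: "'a::real_normed_vector \<Rightarrow> 'b::euclidean_space" and g :: "'b \<Rightarrow> 'c::real_normed_vector"
  assumes "open S" "open T" "f ` S \<subseteq> T" "Ck_on k S f" "Ck_on k T g"
  shows "Ck_on k S (\<lambda>x. g (f x))"
  using assms(4,5)
proof (induction k arbitrary: g)
  case 0
  then show ?case using assms(3) by (auto intro: continuous_on_compose2)
next
  case (Suc k)
  from Suc.prems(1) obtain f' where f': "\<And>x. x \<in> S \<Longrightarrow> (f has_derivative f' x) (at x)"
    "\<And>v. Ck_on k S (\<lambda>x. f' x v)" by (rule Ck_on_SucE) (rule that)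
  from Suc.prems(2) obtain g' where g': "\<And>x. x \<in> T \<Longrightarrow> (g has_derivative g' x) (at x)"
    "\<And>v. Ck_on k T (\<lambda>x. g' x v)" by (rule Ck_on_SucE) (rule that)
  have d: "((\<lambda>x. g (f x)) has_derivative (\<lambda>v. \<Sum>b\<in>Basis. (f' x v \<bullet> b) *\<^sub>R g' (f x) b)) (at x)"
    if "x \<in> S" for x
  proof -
    have gx: "(g has_derivative g' (f x)) (at (f x))" by (rule g'(1)) (use that assms(3) in auto)
    have "(g' (f x) \<circ> f' x) = (\<lambda>v. \<Sum>b\<in>Basis. (f' x v \<bullet> b) *\<^sub>R g' (f x) b)"
      unfolding o_def by (rule ext) (rule linear_expand[OF has_derivative_linear[OF gx]])
    then show ?thesis
      using diff_chain_at[OF f'(1)[OF that] gx] by (simp add: o_def)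
  qed
  have c: "Ck_on k S (\<lambda>x. \<Sum>b\<in>Basis. (f' x v \<bullet> b) *\<^sub>R g' (f x) b)" for v
  proof (rule Ck_on_sum[OF assms(1)])
    fix b :: 'b
    have "Ck_on k S (\<lambda>x. g' (f x) b)"
      by (rule Suc.IH[OF Ck_on_SucD[OF Suc.prems(1)] g'(2)])
    with Ck_on_linear[OF assms(1) bounded_linear_inner_left f'(2)]
    show "Ck_on k S (\<lambda>x. (f' x v \<bullet> b) *\<^sub>R g' (f x) b)"
      by (rule Ck_on_bilinear[OF assms(1) bounded_bilinear_scaleR])
  qed
  from Ck_on_SucI[OF assms(1) d c] show ?case .
qed

text \<open>Differentiation lowers the exponent, hence the generalisation over \<open>a\<close>.
  Later the exponent -1 provides division and -1/2 the normalisation of a vector field.\<close>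

lemma Ck_on_powr: "Ck_on k {0<..} (\<lambda>x::real. x powr a)"
proof (induction k arbitrary: a)
  case 0
  then show ?case by (auto intro!: continuous_intros)
next
  case (Suc k)
  have d: "((\<lambda>x. x powr a) has_derivative (\<lambda>v. v * (a * x powr (a - 1)))) (at x)"
    if "x \<in> {0<..}" for x :: real
  proof -
    have "(*) (a * x powr (a - 1)) = (\<lambda>v. v * (a * x powr (a - 1)))"
      by (simp add: fun_eq_iff)
    then show ?thesis
      using has_real_derivative_powr[of x a] that unfolding has_field_derivative_def by simp
  qed
  have "Ck_on k {0<..} (\<lambda>x. v * (a * x powr (a - 1)))" for v
    using Ck_on_linear[OF _ bounded_linear_mult_right[of "v * a"] Suc[of "a - 1"]]
    by (simp add: mult.assoc)
  from Ck_on_SucI[OF open_greaterThan d this] show ?case .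
qed

text \<open>This makes it possible to check the smoothness of a pullback near each point in a chart
  selected for that point.\<close>

lemma Ck_on_local:
  assumes "open S" "\<And>x. x \<in> S \<Longrightarrow> \<exists>V. open V \<and> x \<in> V \<and> Ck_on k V f"
  shows "Ck_on k S f"
  using assms(2)
proof (induction k arbitrary: f)
  case 0
  show ?case unfolding Ck_on.simps
  proof (rule continuous_at_imp_continuous_on, rule ballI)
    fix x assume "x \<in> S"
    then show "isCont f x" using 0 continuous_on_eq_continuous_at by fastforce
  qed
next
  case (Suc k)
  have "f differentiable (at x)" if "x \<in> S" for x
    using Suc.prems[OF that] by auto
  moreover have "Ck_on k S (\<lambda>x. frechet_derivative f (at x) v)" for v
  proof (rule Suc.IH)
    fix x assume "x \<in> S"
    then obtain V where "open V" "x \<in> V" "Ck_on (Suc k) V f" using Suc.prems by blast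
    then show "\<exists>V. open V \<and> x \<in> V \<and> Ck_on k V (\<lambda>x. frechet_derivative f (at x) v)"
      by (intro exI[of _ V]) simp
  qed
  ultimately show ?case by simp
qed

section \<open>Closure properties of smooth maps\<close>

lemma smooth_onD_Ck: "smooth_on S f \<Longrightarrow> Ck_on k S f"
  by (simp add: smooth_on_def)

lemma smooth_on_const [simp]: "smooth_on S (\<lambda>x. c)"
  by (simp add: smooth_on_def Ck_on_const)

lemma smooth_on_cong:
  assumes "open S" "\<And>x. x \<in> S \<Longrightarrow> f x = g x" "smooth_on S f"
  shows "smooth_on S g"
  using Ck_on_cong[OF assms(1,2)] assms(3) by (simp add: smooth_on_def)

lemma smooth_on_subset: "smooth_on S f \<Longrightarrow> T \<subseteq> S \<Longrightarrow> smooth_on T f"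
  by (auto simp: smooth_on_def intro: Ck_on_subset)

lemma smooth_on_linear: "open S \<Longrightarrow> bounded_linear L \<Longrightarrow> smooth_on S f \<Longrightarrow> smooth_on S (\<lambda>x. L (f x))"
  unfolding smooth_on_def by (rule allI, rule Ck_on_linear) auto

lemma smooth_on_sum:
  "open S \<Longrightarrow> (\<And>i. i \<in> I \<Longrightarrow> smooth_on S (f i)) \<Longrightarrow> smooth_on S (\<lambda>x. \<Sum>i\<in>I. f i x)"
  unfolding smooth_on_def by (rule allI, rule Ck_on_sum) auto

lemma smooth_on_bilinear:
  "open S \<Longrightarrow> bounded_bilinear B \<Longrightarrow> smooth_on S f \<Longrightarrow> smooth_on S g \<Longrightarrow> smooth_on S (\<lambda>x. B (f x) (g x))"
  unfolding smooth_on_def by (rule allI, rule Ck_on_bilinear) auto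

lemmas smooth_on_mult = smooth_on_bilinear[OF _ bounded_bilinear_mult]
lemmas smooth_on_scaleR = smooth_on_bilinear[OF _ bounded_bilinear_scaleR]
lemmas smooth_on_inner = smooth_on_bilinear[OF _ bounded_bilinear_inner]

lemma smooth_on_compose:
  fixes f :: "'a::real_normed_vector \<Rightarrow> 'b::euclidean_space"
  shows "open S \<Longrightarrow> open T \<Longrightarrow> f ` S \<subseteq> T \<Longrightarrow> smooth_on S f \<Longrightarrow> smooth_on T g \<Longrightarrow> smooth_on S (\<lambda>x. g (f x))"
  unfolding smooth_on_def by (rule allI, rule Ck_on_compose) auto

lemma smooth_on_powr:
  "open S \<Longrightarrow> smooth_on S f \<Longrightarrow> (\<And>x. x \<in> S \<Longrightarrow> f x > 0) \<Longrightarrow> smooth_on S (\<lambda>x. f x powr (a::real))"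
  by (rule smooth_on_compose[where T = "{0<..}" and g = "\<lambda>x. x powr a"])
     (auto simp: smooth_on_def Ck_on_powr)

lemma smooth_on_ident: 
  assumes "open S" shows "smooth_on S (\<lambda>x. x)"
proof -
  have "Ck_on k S (\<lambda>x. x)" for k
  proof (cases k)
    case (Suc m)
    then show ?thesis using Ck_on_SucI[OF assms, of "\<lambda>x. x" "\<lambda>x v. v"] 
      by (simp add: Ck_on_const)
  qed simp
  then show ?thesis by (simp add: smooth_on_def)
qed

lemma smooth_on_local:
  assumes "open S" "\<And>x. x \<in> S \<Longrightarrow> \<exists>V. open V \<and> x \<in> V \<and> smooth_on V f"
  shows "smooth_on S f"
  unfolding smooth_on_def
proof (intro allI Ck_on_local assms(1))
  fix k x assume "x \<in> S"
  then obtain V where "open V" "x \<in> V" "smooth_on V f" using assms(2) by blast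
  then show "\<exists>V. open V \<and> x \<in> V \<and> Ck_on k V f" by (intro exI[of _ V]) (simp add: smooth_on_def)
qed

lemma smooth_on_has_derivative:
  "smooth_on S f \<Longrightarrow> x \<in> S \<Longrightarrow> (f has_derivative frechet_derivative f (at x)) (at x)"
  using smooth_onD_Ck[of S f "Suc 0"] by (simp add: frechet_derivative_works)

lemma smooth_on_imp_continuous: "smooth_on S f \<Longrightarrow> continuous_on S f"
  using smooth_onD_Ck[of S f 0] by simp

lemma smooth_on_linear_frechet:
  "smooth_on S f \<Longrightarrow> x \<in> S \<Longrightarrow> linear (frechet_derivative f (at x))"
  by (rule has_derivative_linear[OF smooth_on_has_derivative])

lemma smooth_on_frechet:
  assumes "smooth_on S f"
  shows "smooth_on S (\<lambda>x. frechet_derivative f (at x) v)"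
proof -
  have "Ck_on k S (\<lambda>x. frechet_derivative f (at x) v)" for k
    using smooth_onD_Ck[OF assms, of "Suc k"] by simp
  then show ?thesis by (simp add: smooth_on_def)
qed

lemma smooth_on_frechet_apply:
  fixes f :: "'a::euclidean_space \<Rightarrow> 'b::real_normed_vector"
  assumes "open S" "smooth_on S f" "smooth_on S w"
  shows "smooth_on S (\<lambda>x. frechet_derivative f (at x) (w x))"
proof -
  have "smooth_on S (\<lambda>x. \<Sum>b\<in>Basis. (w x \<bullet> b) *\<^sub>R frechet_derivative f (at x) b)"
    by (intro smooth_on_sum[OF assms(1)] smooth_on_scaleR[OF assms(1)] smooth_on_inner[OF assms(1,3)]
        smooth_on_frechet[OF assms(2)] smooth_on_const)
  moreover have "(\<Sum>b\<in>Basis. (w x \<bullet> b) *\<^sub>R frechet_derivative f (at x) b) = frechet_derivative f (at x) (w x)"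
    if "x \<in> S" for x
    by (rule linear_expand[OF smooth_on_linear_frechet[OF assms(2) that], symmetric])
  ultimately show ?thesis
    by (rule smooth_on_cong[OF assms(1), rotated])
qed

lemma frechet_chain:
  assumes "f differentiable (at x)" "g differentiable (at (f x))"
  shows "frechet_derivative (\<lambda>x. g (f x)) (at x) v = frechet_derivative g (at (f x)) (frechet_derivative f (at x) v)"
  using frechet_derivative_compose[OF assms] by (simp add: o_def fun_eq_iff)

text \<open>The mean value theorem is used twice: along u for the difference between f shifted by
  \<open>r *\<^sub>R v\<close> and f itself, then along v for the derivative of f along u. The
  intermediate point stays in the parallelogram spanned by the two increments.\<close>

lemma second_difference_mvt:
  fixes f :: "'a::real_normed_vector \<Rightarrow> real"
  assumes f: "Ck_on 2 (ball x e) f" and r: "0 < r" "r * (norm u + norm v) < e"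
  shows "\<exists>p. norm (p - x) \<le> r * (norm u + norm v) \<and>
    f (x + r *\<^sub>R u + r *\<^sub>R v) - f (x + r *\<^sub>R u) - f (x + r *\<^sub>R v) + f x =
    r * (r * frechet_derivative (\<lambda>y. frechet_derivative f (at y) u) (at p) v)"
proof -
  let ?D = "\<lambda>y. frechet_derivative f (at y) u"
  have nb: "norm (a *\<^sub>R u + b *\<^sub>R v) \<le> r * (norm u + norm v)" if "0 \<le> a" "a \<le> r" "0 \<le> b" "b \<le> r" for a b
  proof -
    have "norm (a *\<^sub>R u + b *\<^sub>R v) \<le> a * norm u + b * norm v"
      using norm_triangle_ineq[of "a *\<^sub>R u" "b *\<^sub>R v"] that by simp
    also have "\<dots> \<le> r * norm u + r * norm v" using that by (intro add_mono mult_right_mono) auto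
    finally show ?thesis by (simp add: algebra_simps)
  qed
  have inb: "x + a *\<^sub>R u + b *\<^sub>R v \<in> ball x e" if "0 \<le> a" "a \<le> r" "0 \<le> b" "b \<le> r" for a b
    using nb[OF that] r(2) by (simp add: dist_norm algebra_simps)
      (metis add_uminus_conv_diff minus_add_distrib norm_minus_cancel order_le_less_trans nb[OF that])
  have fd: "(f has_derivative frechet_derivative f (at y)) (at y)" if "y \<in> ball x e" for y
    using f that by (simp add: numeral_2_eq_2 frechet_derivative_works)
  have Dd: "(?D has_derivative frechet_derivative ?D (at y)) (at y)" if "y \<in> ball x e" for y
    using f that by (simp add: numeral_2_eq_2 frechet_derivative_works)
  have A: "((\<lambda>s. f (x + s *\<^sub>R u + b *\<^sub>R v)) has_real_derivative ?D (x + s *\<^sub>R u + b *\<^sub>R v)) (at s)"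
    if "0 \<le> s" "s \<le> r" "0 \<le> b" "b \<le> r" for s b
  proof -
    have "((\<lambda>s. x + s *\<^sub>R u + b *\<^sub>R v) has_derivative (\<lambda>h. h *\<^sub>R u)) (at s)"
      by (auto intro!: derivative_eq_intros)
    from diff_chain_at[OF this fd[OF inb[OF that]]]
    show ?thesis
      using linear_scale[OF has_derivative_linear[OF fd[OF inb[OF that]]]]
      by (simp add: has_field_derivative_def o_def mult.commute[of _ "?D _"])
  qed
  have "\<exists>z>0. z < r \<and> (\<lambda>s. f (x + s *\<^sub>R u + r *\<^sub>R v) - f (x + s *\<^sub>R u + 0 *\<^sub>R v)) r -
      (\<lambda>s. f (x + s *\<^sub>R u + r *\<^sub>R v) - f (x + s *\<^sub>R u + 0 *\<^sub>R v)) 0 =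
      (r - 0) * (?D (x + z *\<^sub>R u + r *\<^sub>R v) - ?D (x + z *\<^sub>R u + 0 *\<^sub>R v))"
    by (rule MVT2[OF r(1)], rule DERIV_diff; rule A) (use r in auto)
  then obtain s where s: "0 < s" "s < r"
    "f (x + r *\<^sub>R u + r *\<^sub>R v) - f (x + r *\<^sub>R u) - f (x + r *\<^sub>R v) + f x =
      r * (?D (x + s *\<^sub>R u + r *\<^sub>R v) - ?D (x + s *\<^sub>R u + 0 *\<^sub>R v))"
    by auto
  have B: "((\<lambda>t. ?D (x + s *\<^sub>R u + t *\<^sub>R v)) has_real_derivative
      frechet_derivative ?D (at (x + s *\<^sub>R u + t *\<^sub>R v)) v) (at t)" if "0 \<le> t" "t \<le> r" for t
  proof -
    have i: "x + s *\<^sub>R u + t *\<^sub>R v \<in> ball x e" using inb s that by simp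
    have "((\<lambda>t. x + s *\<^sub>R u + t *\<^sub>R v) has_derivative (\<lambda>h. h *\<^sub>R v)) (at t)"
      by (auto intro!: derivative_eq_intros)
    from diff_chain_at[OF this Dd[OF i]]
    show ?thesis
      using linear_scale[OF has_derivative_linear[OF Dd[OF i]]]
      by (simp add: has_field_derivative_def o_def mult.commute[of _ "frechet_derivative ?D _ _"])
  qed
  have "\<exists>z>0. z < r \<and> ?D (x + s *\<^sub>R u + r *\<^sub>R v) - ?D (x + s *\<^sub>R u + 0 *\<^sub>R v) =
      (r - 0) * frechet_derivative ?D (at (x + s *\<^sub>R u + z *\<^sub>R v)) v"
    by (rule MVT2[OF r(1)]) (use B in auto)
  then obtain t where t: "0 < t" "t < r" "?D (x + s *\<^sub>R u + r *\<^sub>R v) - ?D (x + s *\<^sub>R u + 0 *\<^sub>R v) =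
      r * frechet_derivative ?D (at (x + s *\<^sub>R u + t *\<^sub>R v)) v"
    by auto
  show ?thesis
    using nb[of s t] s t by (intro exI[of _ "x + s *\<^sub>R u + t *\<^sub>R v"]) (simp add: add.assoc)
qed

lemma second_difference_limit:
  fixes f :: "'a::real_normed_vector \<Rightarrow> real"
  assumes "open S" "Ck_on 2 S f" "x \<in> S"
  shows "((\<lambda>r. (f (x + r *\<^sub>R u + r *\<^sub>R v) - f (x + r *\<^sub>R u) - f (x + r *\<^sub>R v) + f x) / (r * r)) \<longlongrightarrow>
     frechet_derivative (\<lambda>y. frechet_derivative f (at y) u) (at x) v) (at_right 0)"
proof (rule tendstoI)
  fix \<epsilon> :: real assume "0 < \<epsilon>"
  let ?H = "\<lambda>p. frechet_derivative (\<lambda>y. frechet_derivative f (at y) u) (at p) v"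
  have "isCont ?H x"
    using assms by (simp add: numeral_2_eq_2 continuous_on_eq_continuous_at)
  then obtain d where d: "d > 0" "\<And>p. norm (p - x) < d \<Longrightarrow> dist (?H p) (?H x) < \<epsilon>"
    using \<open>0 < \<epsilon>\<close> unfolding continuous_at_eps_delta by (metis dist_norm)
  obtain e where e: "e > 0" "ball x e \<subseteq> S" using assms by (auto simp: open_contains_ball)
  \<comment> \<open>The summand 1 keeps the denominator positive when u and v both vanish.\<close>
  define m where "m = min d e / (norm u + norm v + 1)"
  have m: "m > 0" using d e by (simp add: m_def add_nonneg_pos)
  have "dist ((f (x + r *\<^sub>R u + r *\<^sub>R v) - f (x + r *\<^sub>R u) - f (x + r *\<^sub>R v) + f x) / (r * r)) (?H x) < \<epsilon>"
    if r: "0 < r" "r < m" for r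
  proof -
    have "r * (norm u + norm v) \<le> r * (norm u + norm v + 1)" using r by simp
    also have "\<dots> < min d e" using r by (simp add: m_def pos_less_divide_eq add_nonneg_pos)
    finally have lt: "r * (norm u + norm v) < d" "r * (norm u + norm v) < e" by auto
    from second_difference_mvt[OF Ck_on_subset[OF assms(2) e(2)] r(1) lt(2)]
    obtain p where p: "norm (p - x) \<le> r * (norm u + norm v)"
      "f (x + r *\<^sub>R u + r *\<^sub>R v) - f (x + r *\<^sub>R u) - f (x + r *\<^sub>R v) + f x = r * (r * ?H p)" by blast
    have "dist (?H p) (?H x) < \<epsilon>" using d(2) p(1) lt(1) by simp
    then show ?thesis using p(2) r by simp
  qed
  then show "\<forall>\<^sub>F r in at_right 0.
    dist ((f (x + r *\<^sub>R u + r *\<^sub>R v) - f (x + r *\<^sub>R u) - f (x + r *\<^sub>R v) + f x) / (r * r)) (?H x) < \<epsilon>"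
    using m by (auto simp: eventually_at_right_field)
qed

text \<open>The second difference quotient is symmetric in u and v, and its limit is unique.\<close>

lemma symmetric_second_derivative_real:
  fixes f :: "'a::real_normed_vector \<Rightarrow> real"
  assumes "open S" "smooth_on S f" "x \<in> S"
  shows "frechet_derivative (\<lambda>y. frechet_derivative f (at y) u) (at x) v =
         frechet_derivative (\<lambda>y. frechet_derivative f (at y) v) (at x) u"
proof -
  note L = second_difference_limit[OF assms(1) smooth_onD_Ck[OF assms(2)] assms(3)]
  show ?thesis
    by (rule tendsto_unique[OF _ L[of u v]]) (use L[of v u] in \<open>simp_all add: algebra_simps\<close>)
qed

lemma frechet_derivative_inner:
  assumes "f differentiable (at x)"
  shows "frechet_derivative (\<lambda>y. f y \<bullet> b) (at x) v = frechet_derivative f (at x) v \<bullet> b"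
  using frechet_derivative_at[OF has_derivative_inner_left[OF iffD1[OF frechet_derivative_works assms], of b]]
  by (simp add: fun_eq_iff)

lemma smooth_on_differentiable: "smooth_on S f \<Longrightarrow> x \<in> S \<Longrightarrow> f differentiable (at x)"
  unfolding differentiable_def by (rule exI, rule smooth_on_has_derivative)

lemma symmetric_second_derivative:
  fixes f :: "'a::real_normed_vector \<Rightarrow> 'b::euclidean_space"
  assumes "open S" "smooth_on S f" "x \<in> S"
  shows "frechet_derivative (\<lambda>y. frechet_derivative f (at y) u) (at x) v =
         frechet_derivative (\<lambda>y. frechet_derivative f (at y) v) (at x) u"
proof (rule euclidean_eqI)
  fix b :: 'b assume "b \<in> Basis"
  have s: "smooth_on S (\<lambda>y. f y \<bullet> b)" by (intro smooth_on_inner assms smooth_on_const)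
  have "frechet_derivative (\<lambda>y. frechet_derivative f (at y) u) (at x) v \<bullet> b =
      frechet_derivative (\<lambda>y. frechet_derivative (\<lambda>y. f y \<bullet> b) (at y) u) (at x) v" for u v
  proof -
    have d: "(\<lambda>y. frechet_derivative f (at y) u \<bullet> b) differentiable (at x)"
      by (rule smooth_on_differentiable[OF _ assms(3)]) (intro smooth_on_inner smooth_on_frechet assms smooth_on_const)
    have "frechet_derivative (\<lambda>y. frechet_derivative f (at y) u) (at x) v \<bullet> b =
        frechet_derivative (\<lambda>y. frechet_derivative f (at y) u \<bullet> b) (at x) v"
      using frechet_derivative_inner smooth_on_differentiable[OF smooth_on_frechet[OF assms(2)] assms(3)] by metis
    also have "\<dots> = frechet_derivative (\<lambda>y. frechet_derivative (\<lambda>y. f y \<bullet> b) (at y) u) (at x) v"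
      using frechet_derivative_transform_within_open[OF d assms(1,3), of "\<lambda>y. frechet_derivative (\<lambda>y. f y \<bullet> b) (at y) u"]
        frechet_derivative_inner smooth_on_differentiable[OF assms(2)] by metis
    finally show ?thesis .
  qed
  then show "frechet_derivative (\<lambda>y. frechet_derivative f (at y) u) (at x) v \<bullet> b =
         frechet_derivative (\<lambda>y. frechet_derivative f (at y) v) (at x) u \<bullet> b"
    using symmetric_second_derivative_real[OF assms(1) s assms(3)] by simp
qed

section \<open>Exterior algebra\<close>

text \<open>Isolates the degree clause of \<open>alternating\<close> over an arbitrary value type,
  so that shuffle sums can be reduced for complex covectors too.\<close>

definition homogeneous :: "nat \<Rightarrow> ('v, 'f::zero) covector \<Rightarrow> bool" where
  "homogeneous k a \<longleftrightarrow> (\<forall>vs. length vs \<noteq> k \<longrightarrow> a vs = 0)"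

lemma sum_Pow_lessThan_Suc:
  "(\<Sum>S\<in>Pow {..<Suc n}. \<phi> S) = (\<Sum>S\<in>Pow {..<n}. \<phi> S + \<phi> (insert n S))"
proof -
  have "inj_on (insert n) (Pow {..<n})"
    by (rule inj_onI) (metis Diff_insert_absorb PowD lessThan_iff less_irrefl subsetD)
  moreover have "Pow {..<n} \<inter> insert n ` Pow {..<n} = {}" by auto
  ultimately have "sum \<phi> (Pow {..<n} \<union> insert n ` Pow {..<n}) = sum \<phi> (Pow {..<n}) + (\<Sum>S\<in>Pow {..<n}. \<phi> (insert n S))"
    by (subst sum.union_disjoint) (simp_all add: sum.reindex)
  then show ?thesis by (simp add: lessThan_Suc Pow_insert sum.distrib)
qed

text \<open>Listing the inversions, instead of taking the cardinality of a set, makes the sign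
  computable for arguments of known number. The closed wedge formulas below rest on this.\<close>

lemma shuffle_sign_code:
  assumes "S \<subseteq> {..<n}"
  shows "shuffle_sign n S =
    (-1) ^ length (filter (\<lambda>(i, j). i \<in> S \<and> j \<notin> S \<and> j < i) (List.product [0..<n] [0..<n]))"
proof -
  let ?l = "filter (\<lambda>(i, j). i \<in> S \<and> j \<notin> S \<and> j < i) (List.product [0..<n] [0..<n])"
  have "distinct ?l" by (intro distinct_filter distinct_product distinct_upt)
  moreover have "set ?l = {(i, j). i \<in> S \<and> j \<in> {..<n} - S \<and> j < i}"
    using assms by auto
  ultimately have "card {(i, j). i \<in> S \<and> j \<in> {..<n} - S \<and> j < i} = length ?l"
    using distinct_card[of ?l] by simp
  then show ?thesis unfolding shuffle_sign_def by simp
qed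

lemma nths_Diff_lessThan: "nths xs ({..<length xs} - S) = nths xs (- S)"
proof -
  have "snd p \<in> {..<length xs} - S \<longleftrightarrow> snd p \<in> - S" if "p \<in> set (zip xs [0..<length xs])" for p
    using that set_zip_rightD[of "fst p" "snd p" xs "[0..<length xs]"] by simp
  then show ?thesis unfolding nths_def by (simp cong: filter_cong)
qed

lemma wedge_code:
  "wedge a b vs = (\<Sum>S\<in>Pow {..<length vs}.
     of_int ((-1) ^ length (filter (\<lambda>(i, j). i \<in> S \<and> j \<notin> S \<and> j < i)
       (List.product [0..<length vs] [0..<length vs]))) * a (nths vs S) * b (nths vs (- S)))"
  unfolding wedge_def by (rule sum.cong) (simp_all add: nths_Diff_lessThan shuffle_sign_code)

text \<open>Each shuffle distributes all positions over the two factors, so at least one factor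
  receives a list of the wrong length.\<close>

lemma wedge_degree:
  assumes "homogeneous k a" "homogeneous l b" "length vs \<noteq> k + l"
  shows "wedge a b vs = 0"
  unfolding wedge_def
proof (rule sum.neutral, rule ballI)
  fix S assume "S \<in> Pow {..<length vs}"
  then have "S = {i. i < length vs \<and> i \<in> S}" "{..<length vs} - S = {i. i < length vs \<and> i \<in> {..<length vs} - S}" by auto
  then have "length (nths vs S) = card S" "length (nths vs ({..<length vs} - S)) = card ({..<length vs} - S)"
    unfolding length_nths by metis+
  moreover have "card S + card ({..<length vs} - S) = length vs"
    using \<open>S \<in> _\<close> by (metis Pow_iff card_lessThan card_Diff_subset card_mono finite_lessThan finite_subset le_add_diff_inverse)
  ultimately have "length (nths vs S) \<noteq> k \<or> length (nths vs ({..<length vs} - S)) \<noteq> l" using assms(3) by auto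
  then show "of_int (shuffle_sign (length vs) S) * a (nths vs S) * b (nths vs ({..<length vs} - S)) = 0"
    using assms(1,2) by (auto simp: homogeneous_def)
qed

section \<open>Closed formulas for wedge products of low degree\<close>

lemma covector_vanish_1:
  assumes "homogeneous 1 a"
  shows "a [] = 0" "\<And>u0 u1 us. a (u0 # u1 # us) = 0"
  using assms by (simp_all add: homogeneous_def)

lemma covector_vanish_2:
  assumes "homogeneous 2 a"
  shows "a [] = 0" "\<And>u0. a [u0] = 0" "\<And>u0 u1 u2 us. a (u0 # u1 # u2 # us) = 0"
  using assms by (simp_all add: homogeneous_def)

lemma covector_vanish_4:
  assumes "homogeneous 4 a"
  shows "a [] = 0" "\<And>u0. a [u0] = 0" "\<And>u0 u1. a [u0, u1] = 0" "\<And>u0 u1 u2. a [u0, u1, u2] = 0" "\<And>u0 u1 u2 u3 u4 us. a (u0 # u1 # u2 # u3 # u4 # us) = 0"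
  using assms by (simp_all add: homogeneous_def)

lemma wedge_1_1:
  assumes a: "homogeneous 1 a" and b: "homogeneous 1 b"
  shows "wedge a b [x, y] = a [x] * b [y] - a [y] * b [x]"
proof -
  note vanish = covector_vanish_1[OF a] covector_vanish_1[OF b]
  show ?thesis
    unfolding wedge_code
    by (simp only: sum_Pow_lessThan_Suc list.size add_Suc_right add_0_right lessThan_0 Pow_empty
        upt_Suc upt_0 List.product.simps) (simp add: nths_Cons vanish)
qed

lemma wedge_1_2:
  assumes a: "homogeneous 1 a" and b: "homogeneous 2 b"
  shows "wedge a b [x, y, z] = a [x] * b [y, z] - a [y] * b [x, z] + a [z] * b [x, y]"
proof -
  note vanish = covector_vanish_1[OF a] covector_vanish_2[OF b]
  show ?thesis
    unfolding wedge_code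
    by (simp only: sum_Pow_lessThan_Suc list.size add_Suc_right add_0_right lessThan_0 Pow_empty
        upt_Suc upt_0 List.product.simps) (simp add: nths_Cons vanish)
qed

lemma wedge_2_2:
  assumes a: "homogeneous 2 a" and b: "homogeneous 2 b"
  shows "wedge a b [x, y, z, w] = a [x, y] * b [z, w] - a [x, z] * b [y, w] + a [x, w] * b [y, z]
    + a [y, z] * b [x, w] - a [y, w] * b [x, z] + a [z, w] * b [x, y]"
proof -
  note vanish = covector_vanish_2[OF a] covector_vanish_2[OF b]
  show ?thesis
    unfolding wedge_code
    by (simp only: sum_Pow_lessThan_Suc list.size add_Suc_right add_0_right lessThan_0 Pow_empty
        upt_Suc upt_0 List.product.simps) (simp add: nths_Cons vanish)
qed

lemma wedge_4_1:
  assumes a: "homogeneous 4 a" and b: "homogeneous 1 b"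
  shows "wedge a b [v, x, y, z, w] = a [v, x, y, z] * b [w] - a [v, x, y, w] * b [z]
    + a [v, x, z, w] * b [y] - a [v, y, z, w] * b [x] + a [x, y, z, w] * b [v]"
proof -
  note vanish = covector_vanish_4[OF a] covector_vanish_1[OF b]
  show ?thesis
    unfolding wedge_code
    by (simp only: sum_Pow_lessThan_Suc list.size add_Suc_right add_0_right lessThan_0 Pow_empty
        upt_Suc upt_0 List.product.simps) (simp add: nths_Cons vanish)
qed

section \<open>Alternating forms, permutations and bases\<close>

lemma alternating_length: "alternating k a \<Longrightarrow> length vs \<noteq> k \<Longrightarrow> a vs = 0"
  by (simp add: alternating_def)

lemma alternating_homogeneous: "alternating k a \<Longrightarrow> homogeneous k a"
  by (simp add: alternating_def homogeneous_def)

lemma alternating_not_distinct: "alternating k a \<Longrightarrow> \<not> distinct vs \<Longrightarrow> a vs = 0"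
  by (cases "length vs = k") (simp_all add: alternating_def)

definition multilin :: "nat \<Rightarrow> ('v::real_vector, real) covector \<Rightarrow> bool" where
  "multilin k a \<longleftrightarrow> (\<forall>vs i. length vs = k \<and> i < k \<longrightarrow> linear (\<lambda>u. a (vs[i := u])))"

lemma multilinD: "multilin k a \<Longrightarrow> length vs = k \<Longrightarrow> i < k \<Longrightarrow> linear (\<lambda>u. a (vs[i := u]))"
  by (simp add: multilin_def)

lemma alternating_imp_multilin: "alternating k a \<Longrightarrow> multilin k a"
  by (simp add: alternating_def multilin_def)

lemma multilin_append:
  assumes "multilin k a" "Suc (length xs + length ys) = k"
  shows "linear (\<lambda>u. a (xs @ u # ys))"
  using multilinD[OF assms(1), of "xs @ 0 # ys" "length xs"] assms(2) by simp

lemma alternating_1: "linear f \<Longrightarrow> alternating 1 (\<lambda>vs. if length vs = 1 then f (hd vs) else 0)"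
  by (auto simp: alternating_def length_Suc_conv)

lemma alternating_pull:
  fixes L :: "'v::real_vector \<Rightarrow> 'w::real_vector"
  assumes "linear L" "alternating k a"
  shows "alternating k (\<lambda>vs. a (map L vs))"
  unfolding alternating_def
proof (intro conjI allI impI)
  fix vs :: "'v list" and i assume *: "length vs = k \<and> i < k"
  have "linear (\<lambda>u. a ((map L vs)[i := u]))" using assms(2) * by (simp add: alternating_def)
  from linear_compose[OF assms(1) this] show "linear (\<lambda>u. a (map L (vs[i := u])))"
    by (simp add: o_def map_update)
qed (use assms(2) in \<open>auto simp: alternating_def distinct_map\<close>)

lemma alternating_interior:
  fixes X :: "'v::real_vector"
  assumes "alternating (Suc k) a"
  shows "alternating k (interior X a)"
  unfolding alternating_def interior_def
proof (intro conjI allI impI)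
  fix vs :: "'v list" and i assume *: "length vs = k \<and> i < k"
  then have "linear (\<lambda>u. a ((X # vs)[Suc i := u]))"
    using multilinD[OF alternating_imp_multilin[OF assms], of "X # vs" "Suc i"] by simp
  then show "linear (\<lambda>u. a (X # vs[i := u]))" by simp
qed (use assms in \<open>auto simp: alternating_length alternating_not_distinct\<close>)

text \<open>Polarisation: as a function of the two slots the form is bilinear and zero on the
  diagonal, in particular at u + w.\<close>

lemma alternating_swap:
  assumes a: "alternating k a" and l: "length vs = k" and ij: "i < k" "j < k" "i \<noteq> j"
  shows "a (vs[i := vs ! j, j := vs ! i]) = - a vs"
proof -
  define f where "f u w = a (vs[i := u, j := w])" for u w
  have lin1: "linear (\<lambda>u. f u w)" for w
    using multilinD[OF alternating_imp_multilin[OF a], of "vs[j := w]" i] l ij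
    by (simp add: f_def list_update_swap)
  have lin2: "linear (f u)" for u
    using multilinD[OF alternating_imp_multilin[OF a], of "vs[i := u]" j] l ij
    by (simp add: f_def[abs_def])
  have "\<not> distinct (vs[i := u, j := u])" for u
  proof
    assume "distinct (vs[i := u, j := u])"
    moreover have "vs[i := u, j := u] ! i = vs[i := u, j := u] ! j" using l ij by simp
    ultimately show False using l ij by (subst (asm) nth_eq_iff_index_eq) simp_all
  qed
  then have ff: "f u u = 0" for u unfolding f_def by (rule alternating_not_distinct[OF a])
  have exp: "f (u + w) (u + w) = f u u + f u w + f w u + f w w" for u w
    by (simp add: linear_add[OF lin1] linear_add[OF lin2])
  have "f u w = - f w u" for u w using exp[of u w] ff[of u] ff[of w] ff[of "u + w"] by linarith
  then have "f (vs ! j) (vs ! i) = - f (vs ! i) (vs ! j)" .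
  then show ?thesis by (simp add: f_def)
qed

text \<open>Selection sort: m counts the leading entries that already agree with \<open>bs\<close>.
  Every exchange changes only the sign, so vanishing is carried back from \<open>bs\<close> to
  \<open>vs\<close>.\<close>

lemma alternating_perm:
  assumes a: "alternating k a" and bs: "length bs = k" "distinct bs" "a bs = 0"
    and vs: "length vs = k" "set vs = set bs"
  shows "a vs = 0"
proof -
  have dvs: "distinct vs"
    by (rule card_distinct) (use distinct_card[OF bs(2)] bs(1) vs in simp)
  have "a vs = 0" if "m \<le> k" "take m vs = take m bs" "length vs = k" "set vs = set bs" "distinct vs" for m vs
    using that
  proof (induction "k - m" arbitrary: m vs)
    case 0
    then have "m = k" by simp
    then have "vs = bs" using 0(3,4) bs(1) by simp
    then show ?case using bs(3) by simp
  next
    case (Suc d)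
    have m: "m < k" using Suc.hyps(2) by simp
    have "bs ! m \<in> set vs" unfolding Suc.prems(4) by (rule nth_mem) (use m bs(1) in simp)
    then obtain j where j: "j < k" "vs ! j = bs ! m" using Suc.prems(3) by (auto simp: in_set_conv_nth)
    have same: "vs ! i = bs ! i" if "i < m" for i using arg_cong[OF Suc.prems(2), of "\<lambda>l. l ! i"] that by simp
    \<comment> \<open>Distinctness of \<open>bs\<close> puts the wanted entry outside the part
      already sorted, so the exchange leaves that part intact.\<close>
    have jm: "j \<ge> m"
    proof (rule ccontr)
      assume "\<not> j \<ge> m"
      then have "j < m" "bs ! j = bs ! m" using same[of j] j(2) by simp_all
      then show False using bs(1,2) m j(1) nth_eq_iff_index_eq[of bs j m] by simp
    qed
    define ws where "ws = vs[m := vs ! j, j := vs ! m]"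
    have "take (Suc m) ws = take (Suc m) bs"
    proof (rule nth_equalityI)
      fix i assume "i < length (take (Suc m) ws)"
      then have "i \<le> m" by simp
      then show "take (Suc m) ws ! i = take (Suc m) bs ! i"
        using same[of i] j m jm Suc.prems(3)
        by (cases "i = m"; cases "j = m") (simp_all add: ws_def)
    qed (use bs Suc.prems in \<open>simp add: ws_def\<close>)
    moreover have "length ws = k" using Suc.prems by (simp add: ws_def)
    moreover have "set ws = set bs"
      unfolding ws_def using Suc.prems j(1) m by (subst set_swap) simp_all
    moreover have "distinct ws"
      unfolding ws_def using Suc.prems j(1) m by (subst distinct_swap) simp_all
    moreover have "d = k - Suc m" "Suc m \<le> k" using Suc.hyps(2) by simp_all
    ultimately have "a ws = 0" by (intro Suc.hyps(1)[of "Suc m" ws])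
    moreover have "a ws = - a vs" if "j \<noteq> m"
      unfolding ws_def by (rule alternating_swap[OF a]) (use Suc.prems m j that in auto)
    moreover have "ws = vs" if "j = m" using that by (simp add: ws_def)
    ultimately show ?case by fastforce
  qed
  from this[of 0 vs, OF _ _ vs dvs] show ?thesis by simp
qed

text \<open>The induction is on the number m of leading entries only known to lie in the span; all
  later entries lie in S itself. Linearity in the last of these leading slots converts one entry at
  a time.\<close>

lemma multilin_eq_0_span:
  assumes a: "multilin k a" and S: "\<And>vs. length vs = k \<Longrightarrow> set vs \<subseteq> S \<Longrightarrow> a vs = 0"
    and vs: "length vs = k" "set vs \<subseteq> span S"
  shows "a vs = 0"
proof -
  have "a vs = 0" if "m \<le> k" "length vs = k" "set vs \<subseteq> span S" "set (drop m vs) \<subseteq> S" for m vs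
    using that
  proof (induction m arbitrary: vs)
    case 0
    then show ?case using S by simp
  next
    case (Suc m)
    have m: "m < k" using Suc.prems(1) by simp
    let ?f = "\<lambda>u. a (vs[m := u])"
    have lin: "linear ?f" using multilinD[OF a] Suc.prems m by simp
    have "?f u = 0" if "u \<in> S" for u
    proof (rule Suc.IH)
      show "set (vs[m := u]) \<subseteq> span S"
        using set_update_subset_insert[of vs m u] Suc.prems that span_base by blast
      show "set (drop m (vs[m := u])) \<subseteq> S"
        using Suc.prems m that by (simp add: Cons_nth_drop_Suc[symmetric] drop_update_cancel)
    qed (use Suc.prems in simp_all)
    moreover have "vs ! m \<in> span S" using Suc.prems(2,3) nth_mem[of m vs] m by auto
    ultimately have "?f (vs ! m) = 0" using linear_eq_0_on_span[OF lin] by blast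
    then show ?case by simp
  qed
  from this[of k vs] vs show ?thesis by simp
qed

text \<open>A list of this length drawn from a basis either repeats a vector or permutes the
  basis.\<close>

lemma alternating_eq_0_basis:
  assumes a: "alternating k a" and bs: "length bs = k" "span (set bs) = UNIV" "distinct bs" "a bs = 0"
  shows "a vs = 0"
proof (cases "length vs = k")
  case True
  show ?thesis
  proof (rule multilin_eq_0_span[OF alternating_imp_multilin[OF a] _ True])
    fix ws assume ws: "length ws = k" "set ws \<subseteq> set bs"
    show "a ws = 0"
    proof (cases "distinct ws")
      case True
      then have "set ws = set bs" using ws bs by (metis card_subset_eq distinct_card List.finite_set)
      then show ?thesis using alternating_perm[OF a] bs ws by metis
    qed (use a alternating_not_distinct in blast)
  qed (use bs in simp)
qed (use alternating_length[OF a] in simp)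

lemma alternating_wedge_2_2:
  assumes a: "alternating 2 a" and b: "alternating 2 (b :: ('v::real_vector, real) covector)"
  shows "alternating 4 (wedge a b)"
proof -
  note len = alternating_homogeneous[OF a] alternating_homogeneous[OF b]
  note eq = wedge_2_2[OF len]
  have lin1: "linear (\<lambda>u. c [u, y])" and lin2: "linear (\<lambda>u. c [y, u])" if "alternating 2 c"
    for y and c :: "('v, real) covector"
    using multilin_append[OF alternating_imp_multilin[OF that], of "[]" "[y]"]
      multilin_append[OF alternating_imp_multilin[OF that], of "[y]" "[]"] by simp_all
  have rep: "c [u, u] = 0" if "alternating 2 c" for u and c :: "('v, real) covector"
    using alternating_not_distinct[OF that, of "[u, u]"] by simp
  have skew: "c [u, w] = - c [w, u]" if "alternating 2 c" for u w and c :: "('v, real) covector"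
    using alternating_swap[OF that, of "[w, u]" 0 1] by simp
  note lins = lin1[OF a] lin1[OF b] lin2[OF a] lin2[OF b]
  note mul = linear_compose[OF _ linear_times, unfolded o_def]
  show ?thesis unfolding alternating_def
  proof (intro conjI allI impI)
    fix vs :: "'v list" and i :: nat assume "length vs = 4 \<and> i < 4"
    then obtain x y z w where vs: "vs = [x, y, z, w]" and i: "i = 0 \<or> i = 1 \<or> i = 2 \<or> i = 3"
      by (auto simp: numeral_eq_Suc length_Suc_conv less_Suc_eq)
    show "linear (\<lambda>u. wedge a b (vs[i := u]))"
      using i unfolding vs
      by (elim disjE)
        (simp_all add: eq linear_iff linear_add[OF lins(1)] linear_add[OF lins(2)] linear_add[OF lins(3)] linear_add[OF lins(4)]
          linear_scale[OF lins(1)] linear_scale[OF lins(2)] linear_scale[OF lins(3)] linear_scale[OF lins(4)] algebra_simps)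
  next
    fix vs :: "'v list" assume *: "length vs = 4 \<and> \<not> distinct vs"
    then obtain x y z w where vs: "vs = [x, y, z, w]"
      by (auto simp: numeral_eq_Suc length_Suc_conv)
    have "x = y \<or> x = z \<or> x = w \<or> y = z \<or> y = w \<or> z = w" using * vs by auto
    then show "wedge a b vs = 0"
      unfolding vs eq
      using skew[OF a, of x y] skew[OF b, of x y] skew[OF a, of x z] skew[OF b, of x z] skew[OF a, of x w] skew[OF b, of x w]
        skew[OF a, of y z] skew[OF b, of y z] skew[OF a, of y w] skew[OF b, of y w] skew[OF a, of z w] skew[OF b, of z w]
      by (elim disjE) (simp_all add: rep[OF a] rep[OF b])
  qed (use wedge_degree[OF len] in simp)
qed

section \<open>The standard SU(3)-structure\<close>

text \<open>A vector of \<open>\<real>\<^sup>6\<close> is given by its coordinates \<open>x 1, \<dots>, x 6\<close>.\<close>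

definition std_F :: "(nat \<Rightarrow> real) \<Rightarrow> (nat \<Rightarrow> real) \<Rightarrow> real" where
  "std_F x y = x 1 * y 2 - x 2 * y 1 + x 3 * y 4 - x 4 * y 3 + x 5 * y 6 - x 6 * y 5"

text \<open>The complex 3 by 3 determinant of the vectors in the coordinates x1 + i x2, x3 + i x4,
  x5 + i x6, expanded along the first coordinate; that is, the complex volume form evaluated on
  them.\<close>

definition std_Psi :: "(nat \<Rightarrow> real) \<Rightarrow> (nat \<Rightarrow> real) \<Rightarrow> (nat \<Rightarrow> real) \<Rightarrow> complex" where
  "std_Psi x y z =
     Complex (x 1) (x 2) * (Complex (y 3) (y 4) * Complex (z 5) (z 6) - Complex (z 3) (z 4) * Complex (y 5) (y 6))
   - Complex (y 1) (y 2) * (Complex (x 3) (x 4) * Complex (z 5) (z 6) - Complex (z 3) (z 4) * Complex (x 5) (x 6))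
   + Complex (z 1) (z 2) * (Complex (x 3) (x 4) * Complex (y 5) (y 6) - Complex (y 3) (y 4) * Complex (x 5) (x 6))"

definition std_Psip :: "(nat \<Rightarrow> real) \<Rightarrow> (nat \<Rightarrow> real) \<Rightarrow> (nat \<Rightarrow> real) \<Rightarrow> real" where
  "std_Psip x y z = Re (std_Psi x y z)"

definition std_Psim :: "(nat \<Rightarrow> real) \<Rightarrow> (nat \<Rightarrow> real) \<Rightarrow> (nat \<Rightarrow> real) \<Rightarrow> real" where
  "std_Psim x y z = Im (std_Psi x y z)"

lemma std_Psip_expand:
  "std_Psip x y z =
     x 1 * (y 3 * z 5 - y 4 * z 6 - z 3 * y 5 + z 4 * y 6) - x 2 * (y 3 * z 6 + y 4 * z 5 - z 3 * y 6 - z 4 * y 5)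
   - y 1 * (x 3 * z 5 - x 4 * z 6 - z 3 * x 5 + z 4 * x 6) + y 2 * (x 3 * z 6 + x 4 * z 5 - z 3 * x 6 - z 4 * x 5)
   + z 1 * (x 3 * y 5 - x 4 * y 6 - y 3 * x 5 + y 4 * x 6) - z 2 * (x 3 * y 6 + x 4 * y 5 - y 3 * x 6 - y 4 * x 5)"
  by (simp add: std_Psip_def std_Psi_def algebra_simps)

lemma std_Psim_expand:
  "std_Psim x y z =
     x 1 * (y 3 * z 6 + y 4 * z 5 - z 3 * y 6 - z 4 * y 5) + x 2 * (y 3 * z 5 - y 4 * z 6 - z 3 * y 5 + z 4 * y 6)
   - y 1 * (x 3 * z 6 + x 4 * z 5 - z 3 * x 6 - z 4 * x 5) - y 2 * (x 3 * z 5 - x 4 * z 6 - z 3 * x 5 + z 4 * x 6)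
   + z 1 * (x 3 * y 6 + x 4 * y 5 - y 3 * x 6 - y 4 * x 5) + z 2 * (x 3 * y 5 - x 4 * y 6 - y 3 * x 5 + y 4 * x 6)"
  by (simp add: std_Psim_def std_Psi_def algebra_simps)

lemmas std_expand = std_F_def std_Psip_expand std_Psim_expand

definition unit_coord :: "nat \<Rightarrow> nat \<Rightarrow> real" where
  "unit_coord k i = (if i = k then 1 else 0)"

definition act :: "(nat \<Rightarrow> nat \<Rightarrow> real) \<Rightarrow> (nat \<Rightarrow> real) \<Rightarrow> nat \<Rightarrow> real" where
  "act A y a = (\<Sum>b=1..6. A a b * y b)"

lemma sum_1_6: "(\<Sum>i=1..6. f i) = f 1 + f 2 + f 3 + f 4 + f 5 + (f (6::nat) :: 'a::comm_monoid_add)"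
  by (simp add: eval_nat_numeral add.assoc)

lemma ball_1_6: "(\<forall>i\<in>{1..6::nat}. P i) \<longleftrightarrow> P 1 \<and> P 2 \<and> P 3 \<and> P 4 \<and> P 5 \<and> P 6"
proof -
  have "{1..6::nat} = {1, 2, 3, 4, 5, 6}" by auto
  then show ?thesis by simp
qed

text \<open>The connection matrix in the direction \<open>x\<close>, modulo its \<open>su(3)\<close>-component.\<close>
definition nearly_kaehler_torsion :: "(nat \<Rightarrow> nat \<Rightarrow> real) \<Rightarrow> (nat \<Rightarrow> real) \<Rightarrow> bool" where
  "nearly_kaehler_torsion A x \<longleftrightarrow>
     A 1 4 + A 2 3 = x 5 \<and> A 2 4 - A 1 3 = - x 6 \<and>
     A 1 6 + A 2 5 = - x 3 \<and> A 2 6 - A 1 5 = x 4 \<and>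
     A 3 6 + A 4 5 = x 1 \<and> A 4 6 - A 3 5 = - x 2 \<and>
     A 1 2 + A 3 4 + A 5 6 = 0"

definition skew6 :: "(nat \<Rightarrow> nat \<Rightarrow> real) \<Rightarrow> bool" where
  "skew6 A \<longleftrightarrow> (\<forall>a\<in>{1..6}. \<forall>b\<in>{1..6}. A a b = - A b a)"

lemma skew6_rules:
  assumes "skew6 A"
  shows "A 1 1 = 0" "A 2 2 = 0" "A 3 3 = 0" "A 4 4 = 0" "A 5 5 = 0" "A 6 6 = 0"
    "A 2 1 = - A 1 2" "A 3 1 = - A 1 3" "A 4 1 = - A 1 4" "A 5 1 = - A 1 5" "A 6 1 = - A 1 6"
    "A 3 2 = - A 2 3" "A 4 2 = - A 2 4" "A 5 2 = - A 2 5" "A 6 2 = - A 2 6"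
    "A 4 3 = - A 3 4" "A 5 3 = - A 3 5" "A 6 3 = - A 3 6"
    "A 5 4 = - A 4 5" "A 6 4 = - A 4 6" "A 6 5 = - A 5 6"
  using assms unfolding skew6_def ball_1_6 by linarith+

text \<open>so(6) has dimension 15 and su(3) dimension 8. The seven complementary conditions express
  seven entries above the diagonal by the other eight and by x; those eight then cancel in
  \<open>std_F_act\<close> and \<open>std_Psim_act\<close>.\<close>

lemma nearly_kaehler_torsion_solve:
  assumes "nearly_kaehler_torsion A x"
  shows "A 2 3 = x 5 - A 1 4" "A 2 4 = A 1 3 - x 6" "A 2 5 = - x 3 - A 1 6" "A 2 6 = A 1 5 + x 4"
    "A 4 5 = x 1 - A 3 6" "A 4 6 = A 3 5 - x 2" "A 5 6 = - A 1 2 - A 3 4"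
  using assms unfolding nearly_kaehler_torsion_def by linarith+

text \<open>Pointwise content of the formula for the covariant derivative of F: su(3) stabilises F,
  so the derivation depends only on the part of A fixed by the torsion condition.\<close>

lemma std_F_act:
  assumes "skew6 A" "nearly_kaehler_torsion A x"
  shows "std_F (act A y) z + std_F y (act A z) = std_Psip x y z"
  by (simp add: std_expand act_def sum_1_6 skew6_rules[OF assms(1)]
      nearly_kaehler_torsion_solve[OF assms(2)] algebra_simps del: One_nat_def)

text \<open>The same principle for the imaginary part of the volume form. The bracket on the right
  is the 3-form (x \<lrcorner> F) \<and> F evaluated on y, z, w.\<close>

lemma std_Psim_act:
  assumes "skew6 A" "nearly_kaehler_torsion A x"
  shows "std_Psim (act A y) z w + std_Psim y (act A z) w + std_Psim y z (act A w) =
    - (std_F x y * std_F z w - std_F x z * std_F y w + std_F x w * std_F y z)"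
  unfolding std_Psim_expand std_F_def act_def sum_1_6 skew6_rules[OF assms(1)]
    nearly_kaehler_torsion_solve[OF assms(2)]
  by algebra

text \<open>
  \<open>t a b k\<close> is the \<open>b\<close>-th component of \<open>\<nabla>e\<^sup>a\<close> in the \<open>k\<close>-th frame direction, and the three identities
  are the components of \<open>dF = 3\<Psi>\<^sub>+\<close>, \<open>d\<Psi>\<^sub>+ = 0\<close> and \<open>d\<Psi>\<^sub>- = -2F\<and>F\<close>.
\<close>
lemma nearly_kaehler_torsion_frame:
  fixes t :: "nat \<Rightarrow> nat \<Rightarrow> nat \<Rightarrow> real"
  defines "T \<equiv> \<lambda>k i a. t a i k"
  assumes skew: "\<And>k. k \<in> {1..6} \<Longrightarrow> skew6 (\<lambda>a b. t a b k)"
    and dF: "\<And>i j k. i \<in> {1..6} \<Longrightarrow> j \<in> {1..6} \<Longrightarrow> k \<in> {1..6} \<Longrightarrow>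
      (std_F (T i j) (unit_coord k) + std_F (unit_coord j) (T i k))
      - (std_F (T j i) (unit_coord k) + std_F (unit_coord i) (T j k))
      + (std_F (T k i) (unit_coord j) + std_F (unit_coord i) (T k j))
      = 3 * std_Psip (unit_coord i) (unit_coord j) (unit_coord k)"
    and dP: "\<And>i j k l. i \<in> {1..6} \<Longrightarrow> j \<in> {1..6} \<Longrightarrow> k \<in> {1..6} \<Longrightarrow> l \<in> {1..6} \<Longrightarrow>
      (std_Psip (T i j) (unit_coord k) (unit_coord l) + std_Psip (unit_coord j) (T i k) (unit_coord l)
        + std_Psip (unit_coord j) (unit_coord k) (T i l))
      - (std_Psip (T j i) (unit_coord k) (unit_coord l) + std_Psip (unit_coord i) (T j k) (unit_coord l)
        + std_Psip (unit_coord i) (unit_coord k) (T j l))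
      + (std_Psip (T k i) (unit_coord j) (unit_coord l) + std_Psip (unit_coord i) (T k j) (unit_coord l)
        + std_Psip (unit_coord i) (unit_coord j) (T k l))
      - (std_Psip (T l i) (unit_coord j) (unit_coord k) + std_Psip (unit_coord i) (T l j) (unit_coord k)
        + std_Psip (unit_coord i) (unit_coord j) (T l k)) = 0"
    and dM: "\<And>i j k l. i \<in> {1..6} \<Longrightarrow> j \<in> {1..6} \<Longrightarrow> k \<in> {1..6} \<Longrightarrow> l \<in> {1..6} \<Longrightarrow>
      (std_Psim (T i j) (unit_coord k) (unit_coord l) + std_Psim (unit_coord j) (T i k) (unit_coord l)
        + std_Psim (unit_coord j) (unit_coord k) (T i l))
      - (std_Psim (T j i) (unit_coord k) (unit_coord l) + std_Psim (unit_coord i) (T j k) (unit_coord l)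
        + std_Psim (unit_coord i) (unit_coord k) (T j l))
      + (std_Psim (T k i) (unit_coord j) (unit_coord l) + std_Psim (unit_coord i) (T k j) (unit_coord l)
        + std_Psim (unit_coord i) (unit_coord j) (T k l))
      - (std_Psim (T l i) (unit_coord j) (unit_coord k) + std_Psim (unit_coord i) (T l j) (unit_coord k)
        + std_Psim (unit_coord i) (unit_coord j) (T l k))
      = - 4 * (std_F (unit_coord i) (unit_coord j) * std_F (unit_coord k) (unit_coord l)
        - std_F (unit_coord i) (unit_coord k) * std_F (unit_coord j) (unit_coord l)
        + std_F (unit_coord i) (unit_coord l) * std_F (unit_coord j) (unit_coord k))"
    and k: "k \<in> {1..6}"
  shows "nearly_kaehler_torsion (\<lambda>a b. t a b k) (unit_coord k)"
proof -
  note ev = std_expand unit_coord_def T_def skew6_rules[OF skew[of 1]] skew6_rules[OF skew[of 2]]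
    skew6_rules[OF skew[of 3]] skew6_rules[OF skew[of 4]] skew6_rules[OF skew[of 5]] skew6_rules[OF skew[of 6]]
  \<comment> \<open>Each name records the form (F, P or M for the three identities) and the frame
    indices inserted. There are 20 + 14 + 8 = 42 such equations, matching the 6 times 7 components
    to be determined.\<close>
  have F123: "- t 1 3 1 - t 1 4 2 - t 2 3 2 + t 2 4 1 = 0"
    using dF[of 1 2 3] by (simp add: ev del: One_nat_def)
  have F124: "t 1 3 2 - t 1 4 1 - t 2 3 1 - t 2 4 2 = 0"
    using dF[of 1 2 4] by (simp add: ev del: One_nat_def)
  have F125: "- t 1 5 1 - t 1 6 2 - t 2 5 2 + t 2 6 1 = 0"
    using dF[of 1 2 5] by (simp add: ev del: One_nat_def)
  have F126: "t 1 5 2 - t 1 6 1 - t 2 5 1 - t 2 6 2 = 0"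
    using dF[of 1 2 6] by (simp add: ev del: One_nat_def)
  have F134: "t 1 3 3 + t 1 4 4 + t 2 3 4 - t 2 4 3 = 0"
    using dF[of 1 3 4] by (simp add: ev del: One_nat_def)
  have F135: "t 1 4 5 - t 1 6 3 + t 2 3 5 - t 2 5 3 + t 3 6 1 + t 4 5 1 = 3"
    using dF[of 1 3 5] by (simp add: ev del: One_nat_def)
  have F136: "t 1 4 6 + t 1 5 3 + t 2 3 6 - t 2 6 3 - t 3 5 1 + t 4 6 1 = 0"
    using dF[of 1 3 6] by (simp add: ev del: One_nat_def)
  have F145: "- t 1 3 5 - t 1 6 4 + t 2 4 5 - t 2 5 4 - t 3 5 1 + t 4 6 1 = 0"
    using dF[of 1 4 5] by (simp add: ev del: One_nat_def)
  have F146: "- t 1 3 6 + t 1 5 4 + t 2 4 6 - t 2 6 4 - t 3 6 1 - t 4 5 1 = -3"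
    using dF[of 1 4 6] by (simp add: ev del: One_nat_def)
  have F156: "t 1 5 5 + t 1 6 6 + t 2 5 6 - t 2 6 5 = 0"
    using dF[of 1 5 6] by (simp add: ev del: One_nat_def)
  have F234: "- t 1 3 4 + t 1 4 3 + t 2 3 3 + t 2 4 4 = 0"
    using dF[of 2 3 4] by (simp add: ev del: One_nat_def)
  have F235: "- t 1 3 5 + t 1 5 3 + t 2 4 5 - t 2 6 3 + t 3 6 2 + t 4 5 2 = 0"
    using dF[of 2 3 5] by (simp add: ev del: One_nat_def)
  have F236: "- t 1 3 6 + t 1 6 3 + t 2 4 6 + t 2 5 3 - t 3 5 2 + t 4 6 2 = -3"
    using dF[of 2 3 6] by (simp add: ev del: One_nat_def)
  have F245: "- t 1 4 5 + t 1 5 4 - t 2 3 5 - t 2 6 4 - t 3 5 2 + t 4 6 2 = -3"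
    using dF[of 2 4 5] by (simp add: ev del: One_nat_def)
  have F246: "- t 1 4 6 + t 1 6 4 - t 2 3 6 + t 2 5 4 - t 3 6 2 - t 4 5 2 = 0"
    using dF[of 2 4 6] by (simp add: ev del: One_nat_def)
  have F256: "- t 1 5 6 + t 1 6 5 + t 2 5 5 + t 2 6 6 = 0"
    using dF[of 2 5 6] by (simp add: ev del: One_nat_def)
  have F345: "- t 3 5 3 - t 3 6 4 - t 4 5 4 + t 4 6 3 = 0"
    using dF[of 3 4 5] by (simp add: ev del: One_nat_def)
  have F346: "t 3 5 4 - t 3 6 3 - t 4 5 3 - t 4 6 4 = 0"
    using dF[of 3 4 6] by (simp add: ev del: One_nat_def)
  have F356: "t 3 5 5 + t 3 6 6 + t 4 5 6 - t 4 6 5 = 0"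
    using dF[of 3 5 6] by (simp add: ev del: One_nat_def)
  have F456: "- t 3 5 6 + t 3 6 5 + t 4 5 5 + t 4 6 6 = 0"
    using dF[of 4 5 6] by (simp add: ev del: One_nat_def)
  have P1234: "t 1 5 3 - t 1 6 4 - t 2 5 4 - t 2 6 3 - t 3 5 1 + t 3 6 2 + t 4 5 2 + t 4 6 1 = 0"
    using dP[of 1 2 3 4] by (simp add: ev del: One_nat_def)
  have P1235: "t 1 2 1 - t 1 4 3 - t 1 6 5 - t 2 3 3 - t 2 5 5 + t 3 4 1 + t 5 6 1 = 0"
    using dP[of 1 2 3 5] by (simp add: ev del: One_nat_def)
  have P1236: "- t 1 2 2 - t 1 3 3 - t 1 6 6 + t 2 4 3 - t 2 5 6 - t 3 4 2 - t 5 6 2 = 0"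
    using dP[of 1 2 3 6] by (simp add: ev del: One_nat_def)
  have P1245: "- t 1 2 2 - t 1 4 4 - t 1 5 5 - t 2 3 4 + t 2 6 5 - t 3 4 2 - t 5 6 2 = 0"
    using dP[of 1 2 4 5] by (simp add: ev del: One_nat_def)
  have P1246: "- t 1 2 1 - t 1 3 4 - t 1 5 6 + t 2 4 4 + t 2 6 6 - t 3 4 1 - t 5 6 1 = 0"
    using dP[of 1 2 4 6] by (simp add: ev del: One_nat_def)
  have P1256: "- t 1 3 5 + t 1 4 6 + t 2 3 6 + t 2 4 5 - t 3 5 1 + t 3 6 2 + t 4 5 2 + t 4 6 1 = 0"
    using dP[of 1 2 5 6] by (simp add: ev del: One_nat_def)
  have P1345: "- t 1 2 3 - t 1 4 1 - t 2 3 1 - t 3 4 3 + t 3 6 5 + t 4 5 5 - t 5 6 3 = 0"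
    using dP[of 1 3 4 5] by (simp add: ev del: One_nat_def)
  have P1346: "t 1 2 4 - t 1 3 1 + t 2 4 1 + t 3 4 4 + t 3 6 6 + t 4 5 6 + t 5 6 4 = 0"
    using dP[of 1 3 4 6] by (simp add: ev del: One_nat_def)
  have P1356: "t 1 2 5 + t 1 6 1 + t 2 5 1 + t 3 4 5 + t 3 6 3 + t 4 5 3 + t 5 6 5 = 0"
    using dP[of 1 3 5 6] by (simp add: ev del: One_nat_def)
  have P1456: "- t 1 2 6 + t 1 5 1 - t 2 6 1 - t 3 4 6 + t 3 6 4 + t 4 5 4 - t 5 6 6 = 0"
    using dP[of 1 4 5 6] by (simp add: ev del: One_nat_def)
  have P2345: "t 1 2 4 - t 1 4 2 - t 2 3 2 + t 3 4 4 + t 3 5 5 - t 4 6 5 + t 5 6 4 = 0"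
    using dP[of 2 3 4 5] by (simp add: ev del: One_nat_def)
  have P2346: "t 1 2 3 - t 1 3 2 + t 2 4 2 + t 3 4 3 + t 3 5 6 - t 4 6 6 + t 5 6 3 = 0"
    using dP[of 2 3 4 6] by (simp add: ev del: One_nat_def)
  have P2356: "- t 1 2 6 + t 1 6 2 + t 2 5 2 - t 3 4 6 + t 3 5 3 - t 4 6 3 - t 5 6 6 = 0"
    using dP[of 2 3 5 6] by (simp add: ev del: One_nat_def)
  have P2456: "- t 1 2 5 + t 1 5 2 - t 2 6 2 - t 3 4 5 + t 3 5 4 - t 4 6 4 - t 5 6 5 = 0"
    using dP[of 2 4 5 6] by (simp add: ev del: One_nat_def)
  have M1234: "t 1 5 4 + t 1 6 3 + t 2 5 3 - t 2 6 4 - t 3 5 2 - t 3 6 1 - t 4 5 1 + t 4 6 2 = -4"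
    using dM[of 1 2 3 4] by (simp add: ev del: One_nat_def)
  have M1235: "t 1 2 2 + t 1 3 3 + t 1 5 5 - t 2 4 3 - t 2 6 5 + t 3 4 2 + t 5 6 2 = 0"
    using dM[of 1 2 3 5] by (simp add: ev del: One_nat_def)
  have M1236: "t 1 2 1 - t 1 4 3 + t 1 5 6 - t 2 3 3 - t 2 6 6 + t 3 4 1 + t 5 6 1 = 0"
    using dM[of 1 2 3 6] by (simp add: ev del: One_nat_def)
  have M1256: "- t 1 3 6 - t 1 4 5 - t 2 3 5 + t 2 4 6 - t 3 5 2 - t 3 6 1 - t 4 5 1 + t 4 6 2 = -4"
    using dM[of 1 2 5 6] by (simp add: ev del: One_nat_def)
  have M1345: "- t 1 2 4 + t 1 3 1 - t 2 4 1 - t 3 4 4 - t 3 5 5 + t 4 6 5 - t 5 6 4 = 0"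
    using dM[of 1 3 4 5] by (simp add: ev del: One_nat_def)
  have M1346: "- t 1 2 3 - t 1 4 1 - t 2 3 1 - t 3 4 3 - t 3 5 6 + t 4 6 6 - t 5 6 3 = 0"
    using dM[of 1 3 4 6] by (simp add: ev del: One_nat_def)
  have M1356: "t 1 2 6 - t 1 5 1 + t 2 6 1 + t 3 4 6 - t 3 5 3 + t 4 6 3 + t 5 6 6 = 0"
    using dM[of 1 3 5 6] by (simp add: ev del: One_nat_def)
  have M1456: "t 1 2 5 + t 1 6 1 + t 2 5 1 + t 3 4 5 - t 3 5 4 + t 4 6 4 + t 5 6 5 = 0"
    using dM[of 1 4 5 6] by (simp add: ev del: One_nat_def)
  \<comment> \<open>The system nearly decouples: every torsion component, here and for the other
    five directions, is a linear combination of only three or four equations.\<close>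
  have "nearly_kaehler_torsion (\<lambda>a b. t a b 1) (unit_coord 1)"
  proof -
    have "t 1 4 1 + t 2 3 1 = 0" using F124 P2346 M1346 by linarith
    moreover have "t 2 4 1 - t 1 3 1 = 0" using F123 P2345 M1345 by linarith
    moreover have "t 1 6 1 + t 2 5 1 = 0" using F126 P2456 M1456 by linarith
    moreover have "t 2 6 1 - t 1 5 1 = 0" using F125 M1356 P2356 by linarith
    moreover have "t 3 6 1 + t 4 5 1 = 1" using F245 M1234 M1256 F236 by linarith
    moreover have "t 4 6 1 - t 3 5 1 = 0" using F246 P1234 P1256 F235 by linarith
    moreover have "t 1 2 1 + t 3 4 1 + t 5 6 1 = 0" using P1235 F234 F256 P1246 by linarith
    ultimately show ?thesis by (simp add: nearly_kaehler_torsion_def unit_coord_def del: One_nat_def)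
  qed
  moreover have "nearly_kaehler_torsion (\<lambda>a b. t a b 2) (unit_coord 2)"
  proof -
    have "t 1 4 2 + t 2 3 2 = 0" using P2345 F123 M1345 by linarith
    moreover have "t 2 4 2 - t 1 3 2 = 0" using P2346 F124 M1346 by linarith
    moreover have "t 1 6 2 + t 2 5 2 = 0" using M1356 F125 P2356 by linarith
    moreover have "t 2 6 2 - t 1 5 2 = 0" using P2456 F126 M1456 by linarith
    moreover have "t 3 6 2 + t 4 5 2 = 0" using P1234 F145 P1256 F136 by linarith
    moreover have "t 4 6 2 - t 3 5 2 = - 1" using M1234 F146 M1256 F135 by linarith
    moreover have "t 1 2 2 + t 3 4 2 + t 5 6 2 = 0" using P1236 F134 P1245 F156 by linarith
    ultimately show ?thesis by (simp add: nearly_kaehler_torsion_def unit_coord_def del: One_nat_def)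
  qed
  moreover have "nearly_kaehler_torsion (\<lambda>a b. t a b 3) (unit_coord 3)"
  proof -
    have "t 1 4 3 + t 2 3 3 = 0" using F234 P1246 M1236 by linarith
    moreover have "t 2 4 3 - t 1 3 3 = 0" using F134 P1245 M1235 by linarith
    moreover have "t 1 6 3 + t 2 5 3 = - 1" using M1256 F135 F236 by linarith
    moreover have "t 2 6 3 - t 1 5 3 = 0" using P1256 F136 F235 by linarith
    moreover have "t 3 6 3 + t 4 5 3 = 0" using F346 M1456 P1356 by linarith
    moreover have "t 4 6 3 - t 3 5 3 = 0" using F345 P1456 M1356 by linarith
    moreover have "t 1 2 3 + t 3 4 3 + t 5 6 3 = 0" using P1345 F124 F456 P2346 by linarith
    ultimately show ?thesis by (simp add: nearly_kaehler_torsion_def unit_coord_def del: One_nat_def)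
  qed
  moreover have "nearly_kaehler_torsion (\<lambda>a b. t a b 4) (unit_coord 4)"
  proof -
    have "t 1 4 4 + t 2 3 4 = 0" using P1245 F134 M1235 by linarith
    moreover have "t 2 4 4 - t 1 3 4 = 0" using P1246 F234 M1236 by linarith
    moreover have "t 1 6 4 + t 2 5 4 = 0" using F145 F246 P1256 by linarith
    moreover have "t 2 6 4 - t 1 5 4 = 1" using F146 F245 M1256 by linarith
    moreover have "t 3 6 4 + t 4 5 4 = 0" using P1456 F345 M1356 by linarith
    moreover have "t 4 6 4 - t 3 5 4 = 0" using M1456 P1356 F346 by linarith
    moreover have "t 1 2 4 + t 3 4 4 + t 5 6 4 = 0" using P1346 F123 P2345 F356 by linarith
    ultimately show ?thesis by (simp add: nearly_kaehler_torsion_def unit_coord_def del: One_nat_def)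
  qed
  moreover have "nearly_kaehler_torsion (\<lambda>a b. t a b 5) (unit_coord 5)"
  proof -
    have "t 1 4 5 + t 2 3 5 = 1" using F245 F135 M1234 by linarith
    moreover have "t 2 4 5 - t 1 3 5 = 0" using P1234 F145 F235 by linarith
    moreover have "t 1 6 5 + t 2 5 5 = 0" using F256 M1236 P1235 by linarith
    moreover have "t 2 6 5 - t 1 5 5 = 0" using F156 M1235 P1236 by linarith
    moreover have "t 3 6 5 + t 4 5 5 = 0" using F456 M1346 P1345 by linarith
    moreover have "t 4 6 5 - t 3 5 5 = 0" using F356 M1345 P1346 by linarith
    moreover have "t 1 2 5 + t 3 4 5 + t 5 6 5 = 0" using P1356 F126 F346 P2456 by linarith
    ultimately show ?thesis by (simp add: nearly_kaehler_torsion_def unit_coord_def del: One_nat_def)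
  qed
  moreover have "nearly_kaehler_torsion (\<lambda>a b. t a b 6) (unit_coord 6)"
  proof -
    have "t 1 4 6 + t 2 3 6 = 0" using F246 F136 P1234 by linarith
    moreover have "t 2 4 6 - t 1 3 6 = - 1" using M1234 F146 F236 by linarith
    moreover have "t 1 6 6 + t 2 5 6 = 0" using M1235 F156 P1236 by linarith
    moreover have "t 2 6 6 - t 1 5 6 = 0" using M1236 P1235 F256 by linarith
    moreover have "t 3 6 6 + t 4 5 6 = 0" using M1345 F356 P1346 by linarith
    moreover have "t 4 6 6 - t 3 5 6 = 0" using M1346 P1345 F456 by linarith
    moreover have "t 1 2 6 + t 3 4 6 + t 5 6 6 = 0" using P2356 F345 P1456 F125 by linarith
    ultimately show ?thesis by (simp add: nearly_kaehler_torsion_def unit_coord_def del: One_nat_def)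
  qed
  ultimately show ?thesis using k
    by (auto simp: numeral_eq_Suc atLeastAtMostSuc_conv)
qed

text \<open>The torsion condition is linear in the matrix and the direction jointly, so the six
  frame directions determine it for all.\<close>

lemma nearly_kaehler_torsion_combine:
  assumes "\<And>k. k \<in> {1..6} \<Longrightarrow> nearly_kaehler_torsion (\<lambda>a b. t a b k) (unit_coord k)"
  shows "nearly_kaehler_torsion (\<lambda>a b. \<Sum>k=1..6. x k * t a b k) x"
proof -
  have "t 1 4 k + t 2 3 k = unit_coord k 5" "t 2 4 k - t 1 3 k = - unit_coord k 6"
    "t 1 6 k + t 2 5 k = - unit_coord k 3" "t 2 6 k - t 1 5 k = unit_coord k 4"
    "t 3 6 k + t 4 5 k = unit_coord k 1" "t 4 6 k - t 3 5 k = - unit_coord k 2"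
    "t 1 2 k + t 3 4 k + t 5 6 k = 0" if "k \<in> {1..6}" for k
    using assms[OF that] by (simp_all add: nearly_kaehler_torsion_def del: One_nat_def)
  then show ?thesis
    unfolding nearly_kaehler_torsion_def sum_subtractf[symmetric] sum.distrib[symmetric]
      right_diff_distrib[symmetric] distrib_left[symmetric]
    by (simp add: unit_coord_def sum_1_6 del: One_nat_def)
qed

section \<open>Skewness, additivity and the complex structure of the standard forms\<close>

lemma std_F_swap: "std_F x y = - std_F y x"
  by (simp add: std_F_def)

lemma std_Psim_swap: "std_Psim x y z = - std_Psim x z y" "std_Psim x y z = - std_Psim y x z"
  by (simp_all add: std_expand algebra_simps)

lemma std_F_add: "std_F (\<lambda>a. x a + x' a) y = std_F x y + std_F x' y"
  "std_F y (\<lambda>a. x a + x' a) = std_F y x + std_F y x'"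
  by (simp_all add: std_expand algebra_simps)

lemma std_Psim_add: "std_Psim (\<lambda>a. x a + x' a) y z = std_Psim x y z + std_Psim x' y z"
  "std_Psim y (\<lambda>a. x a + x' a) z = std_Psim y x z + std_Psim y x' z"
  "std_Psim y z (\<lambda>a. x a + x' a) = std_Psim y z x + std_Psim y z x'"
  by (simp_all add: std_expand algebra_simps)

text \<open>Multiplication by the imaginary unit in the coordinates x1 + i x2, x3 + i x4, x5 + i x6.
  With this sign the inner product of Jx and y equals F(x, y), so that J applied to the kernel
  direction of a hyperplane is normal to it.\<close>

definition std_J :: "(nat \<Rightarrow> real) \<Rightarrow> nat \<Rightarrow> real" where
  "std_J x a = (if even a then x (a - 1) else - x (a + 1))"

lemma std_J_simps [simp]: "std_J x 1 = - x 2" "std_J x (Suc 0) = - x 2" "std_J x 2 = x 1" "std_J x 3 = - x 4"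
  "std_J x 4 = x 3" "std_J x 5 = - x 6" "std_J x 6 = x 5"
  by (simp_all add: std_J_def flip: numeral_2_eq_2)

lemma std_Psi_J: "std_Psi (std_J x) y z = \<i> * std_Psi x y z"
  by (simp add: std_Psi_def complex_eq_iff algebra_simps)

lemma std_Psim_J: "std_Psim (std_J x) y z = std_Psip x y z"
  by (simp add: std_Psim_def std_Psip_def std_Psi_J)

lemma std_Psip_J: "std_Psip (std_J x) y z = - std_Psim x y z"
  by (simp add: std_Psim_def std_Psip_def std_Psi_J)

lemma std_F_J: "std_F (std_J x) y = - (\<Sum>a=1..6. x a * y a)"
  by (simp add: std_F_def sum_1_6 algebra_simps del: One_nat_def)

lemma std_J_orthogonal: "(\<Sum>a=1..6. std_J x a * y a) = std_F x y"
  by (simp add: std_F_def sum_1_6 algebra_simps del: One_nat_def)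

lemma std_J_norm: "(\<Sum>a=1..6. std_J x a * std_J x a) = (\<Sum>a=1..6. x a * x a)"
  by (simp add: sum_1_6 del: One_nat_def)

section \<open>SU(2)-structures on hyperplanes\<close>

text \<open>With a = z1 \<xi>, b = z2 \<xi> and r the length of (a, b), the matrix with rows (b, -a)
  and (cnj a, cnj b), divided by r, lies in SU(2) and sends (a, b) to (0, r). Being unitary it keeps
  the Hermitian form; having determinant 1 it keeps the product of the two complex coordinates as a
  2-form.\<close>

lemma su2_rotation:
  fixes z1 z2 :: "'v::real_vector \<Rightarrow> complex"
  assumes "linear z1" "linear z2"
  obtains w1 w2 where "linear w1" "linear w2"
    "\<And>X Y. cnj (w1 X) * w1 Y + cnj (w2 X) * w2 Y = cnj (z1 X) * z1 Y + cnj (z2 X) * z2 Y"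
    "\<And>X Y. w1 X * w2 Y - w1 Y * w2 X = z1 X * z2 Y - z1 Y * z2 X"
    "w1 \<xi> = 0" "Im (w2 \<xi>) = 0" "Re (w2 \<xi>) \<ge> 0"
proof (cases "z1 \<xi> = 0 \<and> z2 \<xi> = 0")
  case True
  then show ?thesis using that[of z1 z2] assms by simp
next
  case False
  define a b where "a = z1 \<xi>" and "b = z2 \<xi>"
  define r where "r = sqrt ((cmod a)\<^sup>2 + (cmod b)\<^sup>2)"
  have r: "r > 0" using False by (auto simp: r_def a_def b_def sum_power2_gt_zero_iff)
  have r2: "complex_of_real r * complex_of_real r = a * cnj a + b * cnj b"
  proof -
    have "complex_of_real (r * r) = complex_of_real ((cmod a)\<^sup>2 + (cmod b)\<^sup>2)"
      by (simp add: r_def flip: power2_eq_square)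
    then show ?thesis by (simp add: complex_norm_square del: of_real_power flip: of_real_mult)
  qed
  define R where "R = complex_of_real r"
  have R: "R \<noteq> 0" "cnj R = R" "R * R = a * cnj a + b * cnj b" using r r2 by (simp_all add: R_def)
  define w1 where "w1 X = (b * z1 X - a * z2 X) / R" for X
  define w2 where "w2 X = (cnj a * z1 X + cnj b * z2 X) / R" for X
  have lin: "linear w1" "linear w2"
    using assms by (simp_all add: linear_iff w1_def w2_def divide_simps R(1) scaleR_conv_of_real algebra_simps)
  have "cnj (w1 X) * w1 Y + cnj (w2 X) * w2 Y =
      (a * cnj a + b * cnj b) * (cnj (z1 X) * z1 Y + cnj (z2 X) * z2 Y) / (R * R)" for X Y
    using R(1) by (simp add: w1_def w2_def R(2) field_simps)
  then have 1: "cnj (w1 X) * w1 Y + cnj (w2 X) * w2 Y = cnj (z1 X) * z1 Y + cnj (z2 X) * z2 Y" for X Y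
    using R(1) by (simp flip: R(3))
  have "w1 X * w2 Y - w1 Y * w2 X = (a * cnj a + b * cnj b) * (z1 X * z2 Y - z1 Y * z2 X) / (R * R)" for X Y
    using R(1) by (simp add: w1_def w2_def field_simps)
  then have 2: "w1 X * w2 Y - w1 Y * w2 X = z1 X * z2 Y - z1 Y * z2 X" for X Y
    using R(1) by (simp flip: R(3))
  have 3: "w1 \<xi> = 0" by (simp add: w1_def a_def b_def)
  have "w2 \<xi> = R"
    using R(1,3) by (simp add: w2_def flip: a_def b_def) (simp add: field_simps)
  then have "Im (w2 \<xi>) = 0" "Re (w2 \<xi>) \<ge> 0" using r by (simp_all add: R_def)
  with that[OF lin 1 2 3] show ?thesis by blast
qed

lemma linear_Complex: "linear f \<Longrightarrow> linear g \<Longrightarrow> linear (\<lambda>x. Complex (f x) (g x))"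
  by (simp add: linear_iff complex_eq_iff)

text \<open>Associativity of the triple wedge product: grouped from the left it contains only the
  2-form of the first rotation, regrouped from the right only that of the second. The two rotations
  can therefore be inserted one after the other.\<close>

lemma std_Psi_rotate:
  assumes "\<And>X Y. w1 X * w2 Y - w1 Y * w2 X = Complex (e 1 X) (e 2 X) * Complex (e 3 Y) (e 4 Y) - Complex (e 1 Y) (e 2 Y) * Complex (e 3 X) (e 4 X)"
    and "\<And>X Y. u2 X * u3 Y - u2 Y * u3 X = w2 X * Complex (e 5 Y) (e 6 Y) - w2 Y * Complex (e 5 X) (e 6 X)"
  shows "std_Psi (\<lambda>a. e a X) (\<lambda>a. e a Y) (\<lambda>a. e a Z) =
    w1 X * (u2 Y * u3 Z - u2 Z * u3 Y) - w1 Y * (u2 X * u3 Z - u2 Z * u3 X) + w1 Z * (u2 X * u3 Y - u2 Y * u3 X)"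
proof -
  let ?z1 = "\<lambda>X. Complex (e 1 X) (e 2 X)" and ?z2 = "\<lambda>X. Complex (e 3 X) (e 4 X)" and ?z3 = "\<lambda>X. Complex (e 5 X) (e 6 X)"
  have "std_Psi (\<lambda>a. e a X) (\<lambda>a. e a Y) (\<lambda>a. e a Z) =
      (?z1 X * ?z2 Y - ?z1 Y * ?z2 X) * ?z3 Z - (?z1 X * ?z2 Z - ?z1 Z * ?z2 X) * ?z3 Y + (?z1 Y * ?z2 Z - ?z1 Z * ?z2 Y) * ?z3 X"
    unfolding std_Psi_def by algebra
  also have "\<dots> = (w1 X * w2 Y - w1 Y * w2 X) * ?z3 Z - (w1 X * w2 Z - w1 Z * w2 X) * ?z3 Y + (w1 Y * w2 Z - w1 Z * w2 Y) * ?z3 X"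
    by (simp only: assms(1))
  also have "\<dots> = w1 X * (w2 Y * ?z3 Z - w2 Z * ?z3 Y) - w1 Y * (w2 X * ?z3 Z - w2 Z * ?z3 X) + w1 Z * (w2 X * ?z3 Y - w2 Y * ?z3 X)"
    by algebra
  finally show ?thesis by (simp only: assms(2))
qed

text \<open>Two SU(2)-rotations suffice, the first in \<open>(z\<^sub>1, z\<^sub>2)\<close> and the second in \<open>(z\<^sub>2, z\<^sub>3)\<close>.\<close>
lemma hyperplane_coframe:
  fixes \<epsilon> :: "nat \<Rightarrow> 'v::real_vector \<Rightarrow> real"
  assumes lin: "\<And>a. a \<in> {1..6} \<Longrightarrow> linear (\<epsilon> a)"
    and unit: "(\<Sum>a=1..6. \<epsilon> a \<xi> * \<epsilon> a \<xi>) = 1"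
    and ker: "\<And>Y. std_F (\<lambda>a. \<epsilon> a \<xi>) (\<lambda>a. \<epsilon> a Y) = 0"
  obtains p :: "nat \<Rightarrow> 'v \<Rightarrow> real" where "\<And>i. linear (p i)" "p 1 \<xi> = 0" "p 2 \<xi> = 0" "p 3 \<xi> = 0" "p 4 \<xi> = 0" "p 5 \<xi> = 1"
    "\<And>X Y. std_F (\<lambda>a. \<epsilon> a X) (\<lambda>a. \<epsilon> a Y) = p 1 X * p 2 Y - p 2 X * p 1 Y + p 3 X * p 4 Y - p 4 X * p 3 Y"
    "\<And>X Y. (\<Sum>a=1..6. \<epsilon> a X * \<epsilon> a Y) = (\<Sum>i=1..5. p i X * p i Y)"
    "\<And>X Y Z. std_Psi (\<lambda>a. \<epsilon> a X) (\<lambda>a. \<epsilon> a Y) (\<lambda>a. \<epsilon> a Z) = std_Psi (\<lambda>a. if a = 6 then 0 else p a X) (\<lambda>a. if a = 6 then 0 else p a Y) (\<lambda>a. if a = 6 then 0 else p a Z)"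
proof -
  let ?z1 = "\<lambda>X. Complex (\<epsilon> 1 X) (\<epsilon> 2 X)" and ?z2 = "\<lambda>X. Complex (\<epsilon> 3 X) (\<epsilon> 4 X)" and ?z3 = "\<lambda>X. Complex (\<epsilon> 5 X) (\<epsilon> 6 X)"
  have l: "linear ?z1" "linear ?z2" "linear ?z3" by (intro linear_Complex lin; simp)+
  obtain w1 w2 where w: "linear w1" "linear w2"
    "\<And>X Y. cnj (w1 X) * w1 Y + cnj (w2 X) * w2 Y = cnj (?z1 X) * ?z1 Y + cnj (?z2 X) * ?z2 Y"
    "\<And>X Y. w1 X * w2 Y - w1 Y * w2 X = ?z1 X * ?z2 Y - ?z1 Y * ?z2 X"
    "w1 \<xi> = 0" by (rule su2_rotation[OF l(1,2), of \<xi>]) (rule that)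
  obtain u2 u3 where u: "linear u2" "linear u3"
    "\<And>X Y. cnj (u2 X) * u2 Y + cnj (u3 X) * u3 Y = cnj (w2 X) * w2 Y + cnj (?z3 X) * ?z3 Y"
    "\<And>X Y. u2 X * u3 Y - u2 Y * u3 X = w2 X * ?z3 Y - w2 Y * ?z3 X"
    "u2 \<xi> = 0" "Im (u3 \<xi>) = 0" "Re (u3 \<xi>) \<ge> 0" by (rule su2_rotation[OF w(2) l(3), of \<xi>]) (rule that)
  \<comment> \<open>The Hermitian form of three complex coordinates has the metric as real part and
    F as imaginary part; both rotations leave it unchanged.\<close>
  have H: "cnj (w1 X) * w1 Y + cnj (u2 X) * u2 Y + cnj (u3 X) * u3 Y =
      Complex (\<Sum>a=1..6. \<epsilon> a X * \<epsilon> a Y) (std_F (\<lambda>a. \<epsilon> a X) (\<lambda>a. \<epsilon> a Y))" for X Y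
  proof -
    have "cnj (w1 X) * w1 Y + cnj (u2 X) * u2 Y + cnj (u3 X) * u3 Y =
        cnj (?z1 X) * ?z1 Y + cnj (?z2 X) * ?z2 Y + cnj (?z3 X) * ?z3 Y"
      using w(3)[of X Y] u(3)[of X Y] by (simp add: add.assoc)
    then show ?thesis by (simp add: std_F_def sum_1_6 complex_eq_iff del: One_nat_def)
  qed
  have u3: "u3 \<xi> = 1"
  proof -
    have "(Re (u3 \<xi>))\<^sup>2 = 1"
      using arg_cong[OF H[of \<xi> \<xi>], of Re] unit by (simp add: w(5) u(5,6) power2_eq_square)
    then show ?thesis using u(6,7) by (simp add: complex_eq_iff power2_eq_1_iff)
  qed
  \<comment> \<open>Since \<xi> has coordinates (0, 0, 1), the Hermitian product of \<xi> with Y is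
    \<open>u3 Y\<close>, and its imaginary part is F(\<xi>, Y). The kernel condition thus removes
    the sixth real coordinate.\<close>
  have Im_u3: "Im (u3 Y) = 0" for Y
    using arg_cong[OF H[of \<xi> Y], of Im] by (simp add: w(5) u(5) u3 ker)
  define p where "p i = (if i = 1 then (\<lambda>X. Re (w1 X)) else if i = 2 then (\<lambda>X. Im (w1 X)) else if i = 3 then (\<lambda>X. Re (u2 X))
    else if i = 4 then (\<lambda>X. Im (u2 X)) else (\<lambda>X. Re (u3 X)))" for i :: nat
  have c: "w1 X = Complex (p 1 X) (p 2 X)" "u2 X = Complex (p 3 X) (p 4 X)" "u3 X = Complex (p 5 X) 0" for X
    by (simp_all add: p_def complex_eq_iff Im_u3)
  note p_eq = c[THEN arg_cong[of _ _ Re]] c[THEN arg_cong[of _ _ Im]]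
  have linp: "linear (p i)" for i
    using w(1) u(1,2) by (auto simp: p_def linear_iff)
  have pxi: "p 1 \<xi> = 0" "p 2 \<xi> = 0" "p 3 \<xi> = 0" "p 4 \<xi> = 0" "p 5 \<xi> = 1"
    by (simp_all add: p_def w(5) u(5) u3)
  have F: "std_F (\<lambda>a. \<epsilon> a X) (\<lambda>a. \<epsilon> a Y) = p 1 X * p 2 Y - p 2 X * p 1 Y + p 3 X * p 4 Y - p 4 X * p 3 Y" for X Y
    using arg_cong[OF H[of X Y], of Im] unfolding c by (simp del: One_nat_def)
  have s5: "(\<Sum>i=1..5. f i) = f 1 + f 2 + f 3 + f 4 + f (5::nat)" for f :: "nat \<Rightarrow> real"
    by (simp add: eval_nat_numeral add.assoc)
  have S: "(\<Sum>a=1..6. \<epsilon> a X * \<epsilon> a Y) = (\<Sum>i=1..5. p i X * p i Y)" for X Y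
    using arg_cong[OF H[of X Y], of Re] unfolding c s5 by (simp del: One_nat_def)
  have P: "std_Psi (\<lambda>a. \<epsilon> a X) (\<lambda>a. \<epsilon> a Y) (\<lambda>a. \<epsilon> a Z) = std_Psi (\<lambda>a. if a = 6 then 0 else p a X) (\<lambda>a. if a = 6 then 0 else p a Y) (\<lambda>a. if a = 6 then 0 else p a Z)" for X Y Z
    unfolding std_Psi_rotate[of w1 w2 \<epsilon> u2 u3, OF w(4) u(4)] c by (simp add: std_Psi_def del: One_nat_def)
  from that[OF linp pxi F S P] show ?thesis .
qed

text \<open>Numbering \<open>Basis\<close> turns the n functionals into an injective endomorphism,
  which is bijective for reasons of dimension; the dual vectors are the preimages of the standard
  basis.\<close>

lemma dual_basis:
  fixes p :: "nat \<Rightarrow> 'v::euclidean_space \<Rightarrow> real"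
  assumes lin: "\<And>i. i \<in> {1..n} \<Longrightarrow> linear (p i)" and inj: "\<And>X. (\<And>i. i \<in> {1..n} \<Longrightarrow> p i X = 0) \<Longrightarrow> X = 0"
    and dim: "DIM('v) = n"
  obtains B where "\<And>i j. i \<in> {1..n} \<Longrightarrow> j \<in> {1..n} \<Longrightarrow> p i (B j) = (if i = j then 1 else 0)"
    "\<And>X. X = (\<Sum>j=1..n. p j X *\<^sub>R B j)"
proof -
  have "card (Basis :: 'v set) = card {1..n}" using dim by simp
  then obtain \<beta> where \<beta>: "bij_betw \<beta> (Basis :: 'v set) {1..n}"
    using finite_same_card_bij[of "Basis :: 'v set" "{1..n}"] by auto
  define P where "P X = (\<Sum>b\<in>Basis. p (\<beta> b) X *\<^sub>R b)" for X :: 'v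
  have \<beta>_in: "\<beta> b \<in> {1..n}" if "b \<in> Basis" for b using \<beta> that bij_betwE by blast
  have P_inner: "P X \<bullet> b = p (\<beta> b) X" if "b \<in> Basis" for X b
    using that by (simp add: P_def inner_sum_left inner_Basis if_distrib cong: if_cong)
  have linP: "linear P"
    unfolding P_def using linear_add[OF lin[OF \<beta>_in]] linear_scale[OF lin[OF \<beta>_in]]
    by (auto simp: linear_iff scaleR_add_left sum.distrib scaleR_sum_right intro!: sum.cong)
  have "inj P"
  proof (rule linear_injective_0[OF linP, THEN iffD2], intro allI impI)
    fix X assume "P X = 0"
    show "X = 0"
    proof (rule inj)
      fix i assume "i \<in> {1..n}"
      then have "i \<in> \<beta> ` Basis" using \<beta> unfolding bij_betw_def by simp
      then obtain b where "b \<in> Basis" "\<beta> b = i" by blast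
      then show "p i X = 0" using P_inner[of b X] \<open>P X = 0\<close> by simp
    qed
  qed
  then have surjP: "surj P" by (rule linear_injective_imp_surjective[OF linP _ refl])
  define B where "B j = inv P (inv_into Basis \<beta> j)" for j
  have B: "P (B j) = inv_into Basis \<beta> j" for j
    unfolding B_def by (rule surj_f_inv_f[OF surjP])
  have 1: "p i (B j) = (if i = j then 1 else 0)" if ij: "i \<in> {1..n}" "j \<in> {1..n}" for i j
  proof -
    have b: "inv_into Basis \<beta> i \<in> Basis" "inv_into Basis \<beta> j \<in> Basis"
      using \<beta> ij by (simp_all add: bij_betw_def inv_into_into)
    have "inv_into Basis \<beta> j = inv_into Basis \<beta> i \<longleftrightarrow> i = j"
      using \<beta> ij by (metis bij_betw_inv_into_right)
    moreover have "p i (B j) = P (B j) \<bullet> inv_into Basis \<beta> i"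
      using P_inner[OF b(1)] \<beta> ij by (simp add: bij_betw_inv_into_right)
    ultimately show ?thesis using b by (auto simp: B inner_Basis)
  qed
  have 2: "X = (\<Sum>j=1..n. p j X *\<^sub>R B j)" for X
  proof -
    have "X - (\<Sum>j=1..n. p j X *\<^sub>R B j) = 0"
    proof (rule inj)
      fix i assume i: "i \<in> {1..n}"
      have "p i (\<Sum>j=1..n. p j X *\<^sub>R B j) = (\<Sum>j=1..n. p j X * (if i = j then 1 else 0))"
        using 1[OF i] by (simp add: linear_sum[OF lin[OF i]] linear_scale[OF lin[OF i]])
      also have "\<dots> = p i X" using i by (simp add: if_distrib cong: if_cong)
      finally show "p i (X - (\<Sum>j=1..n. p j X *\<^sub>R B j)) = 0"
        by (simp add: linear_diff[OF lin[OF i]])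
    qed
    then show ?thesis by simp
  qed
  from that[OF 1 2] show ?thesis .
qed


text \<open>Pointwise normal form: \<omega>1 = p12 + p34, while \<omega>2 and \<omega>3 are the real
  and imaginary part of (p1 + i p2) \<and> (p3 + i p4), and \<eta> = p5. Values on lists of other
  lengths are controlled separately by \<open>homogeneous\<close>.\<close>

definition su2_coframe :: "(nat \<Rightarrow> 'v::euclidean_space \<Rightarrow> real) \<Rightarrow> ('v, real) covector \<Rightarrow> ('v, real) covector \<Rightarrow>
    ('v, real) covector \<Rightarrow> ('v, real) covector \<Rightarrow> bool" where
  "su2_coframe p \<eta> \<omega>1 \<omega>2 \<omega>3 \<longleftrightarrow>
     (\<forall>i. linear (p i)) \<and> (\<forall>X. (\<forall>i\<in>{1..5}. p i X = 0) \<longrightarrow> X = 0) \<and>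
     (\<forall>X. \<eta> [X] = p 5 X) \<and>
     (\<forall>X Y. \<omega>1 [X, Y] = p 1 X * p 2 Y - p 2 X * p 1 Y + p 3 X * p 4 Y - p 4 X * p 3 Y) \<and>
     (\<forall>X Y. \<omega>2 [X, Y] = p 1 X * p 3 Y - p 3 X * p 1 Y - p 2 X * p 4 Y + p 4 X * p 2 Y) \<and>
     (\<forall>X Y. \<omega>3 [X, Y] = p 1 X * p 4 Y - p 4 X * p 1 Y + p 2 X * p 3 Y - p 3 X * p 2 Y)"

lemma ball_1_5: "(\<forall>i\<in>{1..5::nat}. P i) \<longleftrightarrow> P 1 \<and> P 2 \<and> P 3 \<and> P 4 \<and> P 5"
proof -
  have "{1..5::nat} = {1, 2, 3, 4, 5}" by auto
  then show ?thesis by simp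
qed

text \<open>Quaternionic relabelling of the coframe.\<close>
lemma su2_coframe_cycle:
  assumes "su2_coframe p \<eta> \<omega>1 \<omega>2 \<omega>3"
  shows "\<exists>q. su2_coframe q \<eta> \<omega>3 \<omega>1 \<omega>2"
proof (rule exI)
  show "su2_coframe (\<lambda>i. if i = 2 then p 4 else if i = 3 then p 2 else if i = 4 then p 3 else p i) \<eta> \<omega>3 \<omega>1 \<omega>2"
    using assms unfolding su2_coframe_def ball_1_5 by (simp del: One_nat_def)
qed

lemma su2_coframe_scale:
  assumes "su2_coframe p \<eta> \<omega>1 \<omega>2 \<omega>3" "t \<noteq> 0"
  shows "su2_coframe (\<lambda>i X. t * p i X) (\<lambda>vs. t * \<eta> vs) (\<lambda>vs. t\<^sup>2 * \<omega>1 vs) (\<lambda>vs. t\<^sup>2 * \<omega>2 vs) (\<lambda>vs. t\<^sup>2 * \<omega>3 vs)"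
proof -
  have lin: "linear (\<lambda>X. t * p i X)" for i
    using assms(1) by (simp add: su2_coframe_def linear_iff algebra_simps)
  have e: "\<eta> [X] = p 5 X"
    "\<omega>1 [X, Y] = p 1 X * p 2 Y - p 2 X * p 1 Y + p 3 X * p 4 Y - p 4 X * p 3 Y"
    "\<omega>2 [X, Y] = p 1 X * p 3 Y - p 3 X * p 1 Y - p 2 X * p 4 Y + p 4 X * p 2 Y"
    "\<omega>3 [X, Y] = p 1 X * p 4 Y - p 4 X * p 1 Y + p 2 X * p 3 Y - p 3 X * p 2 Y" for X Y
    using assms(1) by (simp_all add: su2_coframe_def)
  have nz: "X = 0" if "\<forall>i\<in>{1..5}. t * p i X = 0" for X
    using assms that by (simp add: su2_coframe_def)
  show ?thesis
    unfolding su2_coframe_def power2_eq_square e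
    by (intro conjI allI impI lin refl) (erule nz, algebra+)
qed

text \<open>The three forms are the standard basis of the self-dual 2-forms for the orientation
  p1234. On four arbitrary vectors all five claims are polynomial identities in the values of
  p.\<close>

lemma su2_coframe_wedge:
  assumes p: "su2_coframe p \<eta> \<omega>1 \<omega>2 \<omega>3"
    and h: "homogeneous 2 \<omega>1" "homogeneous 2 \<omega>2" "homogeneous 2 \<omega>3"
  shows "wedge \<omega>2 \<omega>2 = wedge \<omega>1 \<omega>1" "wedge \<omega>3 \<omega>3 = wedge \<omega>1 \<omega>1"
    "wedge \<omega>1 \<omega>2 = (\<lambda>_. 0)" "wedge \<omega>1 \<omega>3 = (\<lambda>_. 0)" "wedge \<omega>2 \<omega>3 = (\<lambda>_. 0)"
proof -
  have ext: "wedge a b = c" if "homogeneous 2 a" "homogeneous 2 b" "homogeneous 4 c"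
    "\<And>x y z w. wedge a b [x, y, z, w] = c [x, y, z, w]" for a b c :: "('a, real) covector"
  proof
    fix vs
    show "wedge a b vs = c vs"
    proof (cases "length vs = 4")
      case True
      then obtain x y z w where "vs = [x, y, z, w]" by (auto simp: numeral_eq_Suc length_Suc_conv)
      then show ?thesis using that(4) by simp
    next
      case False
      then show ?thesis using wedge_degree[OF that(1,2)] that(3) by (simp add: homogeneous_def)
    qed
  qed
  have w11: "homogeneous 4 (wedge \<omega>1 \<omega>1)"
    using wedge_degree[OF h(1,1)] by (simp add: homogeneous_def)
  have z: "homogeneous 4 (\<lambda>_. 0)" by (simp add: homogeneous_def)
  have e: "\<omega>1 [X, Y] = p 1 X * p 2 Y - p 2 X * p 1 Y + p 3 X * p 4 Y - p 4 X * p 3 Y"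
    "\<omega>2 [X, Y] = p 1 X * p 3 Y - p 3 X * p 1 Y - p 2 X * p 4 Y + p 4 X * p 2 Y"
    "\<omega>3 [X, Y] = p 1 X * p 4 Y - p 4 X * p 1 Y + p 2 X * p 3 Y - p 3 X * p 2 Y" for X Y
    using p by (simp_all add: su2_coframe_def)
  show "wedge \<omega>2 \<omega>2 = wedge \<omega>1 \<omega>1"
    by (rule ext[OF h(2,2) w11]) (unfold wedge_2_2[OF h(1,1)] wedge_2_2[OF h(2,2)] e, algebra)
  show "wedge \<omega>3 \<omega>3 = wedge \<omega>1 \<omega>1"
    by (rule ext[OF h(3,3) w11]) (unfold wedge_2_2[OF h(1,1)] wedge_2_2[OF h(3,3)] e, algebra)
  show "wedge \<omega>1 \<omega>2 = (\<lambda>_. 0)"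
    by (rule ext[OF h(1,2) z]) (unfold wedge_2_2[OF h(1,2)] e, algebra)
  show "wedge \<omega>1 \<omega>3 = (\<lambda>_. 0)"
    by (rule ext[OF h(1,3) z]) (unfold wedge_2_2[OF h(1,3)] e, algebra)
  show "wedge \<omega>2 \<omega>3 = (\<lambda>_. 0)"
    by (rule ext[OF h(2,3) z]) (unfold wedge_2_2[OF h(2,3)] e, algebra)
qed

lemma su2_coframe_dual_basis:
  fixes \<eta> :: "(real^5, real) covector"
  assumes "su2_coframe p \<eta> \<omega>1 \<omega>2 \<omega>3"
  obtains B where "\<And>i j. i \<in> {1..5} \<Longrightarrow> j \<in> {1..5} \<Longrightarrow> p i (B j) = (if i = j then 1 else 0)"
    "\<And>X. X = (\<Sum>j=1..5. p j X *\<^sub>R B j)"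
  by (rule dual_basis[of 5 p]) (use assms in \<open>auto simp: su2_coframe_def intro: that\<close>)

lemma su2_coframe_nondegenerate:
  fixes \<eta> :: "(real^5, real) covector"
  assumes p: "su2_coframe p \<eta> \<omega>1 \<omega>2 \<omega>3" and h: "homogeneous 2 \<omega>1" "homogeneous 1 \<eta>"
  shows "\<exists>vs. wedge (wedge \<omega>1 \<omega>1) \<eta> vs \<noteq> 0"
proof -
  obtain B where B: "\<And>i j. i \<in> {1..5} \<Longrightarrow> j \<in> {1..5} \<Longrightarrow> p i (B j) = (if i = j then 1 else 0)"
    by (rule su2_coframe_dual_basis[OF p]) (rule that)
  have w: "homogeneous 4 (wedge \<omega>1 \<omega>1)"
    using wedge_degree[OF h(1,1)] by (simp add: homogeneous_def)
  \<comment> \<open>The square of p12 + p34 is 2 p1234, hence the value 2.\<close>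
  have "wedge (wedge \<omega>1 \<omega>1) \<eta> [B 1, B 2, B 3, B 4, B 5] = 2"
    unfolding wedge_4_1[OF w h(2)] wedge_2_2[OF h(1,1)]
    using p by (simp add: su2_coframe_def B del: One_nat_def)
  then show ?thesis by (metis zero_neq_numeral)
qed

text \<open>Testing the hypothesis on the dual vectors expresses the first four coordinates of X by
  those of Y, up to order and signs. Then \<omega>3(X, Y) becomes the sum of the squares of the
  first four coordinates of Y.\<close>

lemma su2_coframe_positive:
  fixes \<eta> :: "(real^5, real) covector"
  assumes p: "su2_coframe p \<eta> \<omega>1 \<omega>2 \<omega>3" and XY: "interior X \<omega>1 = interior Y \<omega>2"
  shows "0 \<le> \<omega>3 [X, Y]"
proof -
  obtain B where B: "\<And>i j. i \<in> {1..5} \<Longrightarrow> j \<in> {1..5} \<Longrightarrow> p i (B j) = (if i = j then 1 else 0)"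
    by (rule su2_coframe_dual_basis[OF p]) (rule that)
  have eq: "p 1 X * p 2 Z - p 2 X * p 1 Z + p 3 X * p 4 Z - p 4 X * p 3 Z =
      p 1 Y * p 3 Z - p 3 Y * p 1 Z - p 2 Y * p 4 Z + p 4 Y * p 2 Z" for Z
    using fun_cong[OF XY, of "[Z]"] p by (simp add: interior_def su2_coframe_def)
  have "p 1 X = p 4 Y" "p 2 X = p 3 Y" "p 3 X = - p 2 Y" "p 4 X = - p 1 Y"
    using eq[of "B 2"] eq[of "B 1"] eq[of "B 4"] eq[of "B 3"] by (simp_all add: B del: One_nat_def)
  moreover have "\<omega>3 [X, Y] = p 1 X * p 4 Y - p 4 X * p 1 Y + p 2 X * p 3 Y - p 3 X * p 2 Y"
    using p by (simp add: su2_coframe_def)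
  ultimately show ?thesis by simp
qed

text \<open>The determinant of a skew matrix of odd size vanishes.\<close>
lemma skew_kernel_odd:
  fixes \<omega> :: "real^5 \<Rightarrow> real^5 \<Rightarrow> real"
  assumes bil: "bilinear \<omega>" and skew: "\<And>X Y. \<omega> X Y = - \<omega> Y X"
  obtains X where "X \<noteq> 0" "\<And>Y. \<omega> X Y = 0"
proof -
  define A :: "real^5^5" where "A = (\<chi> i j. \<omega> (axis j 1) (axis i 1))"
  have "transpose A $ i $ j = (- A) $ i $ j" for i j
    using skew[of "axis i 1" "axis j 1"] by (simp add: A_def transpose_def)
  then have "transpose A = - A" unfolding vec_eq_iff by blast
  then have "det A = det (- A)" by (metis det_transpose)
  also have "\<dots> = - det A"
  proof -
    \<comment> \<open>The sign is the fifth power of -1; this is where the odd dimension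
      enters.\<close>
    have "(\<Prod>i\<in>UNIV. (- A) $ i $ q i) = (\<Prod>i\<in>(UNIV::5 set). -1) * (\<Prod>i\<in>UNIV. A $ i $ q i)" for q
      unfolding prod.distrib[symmetric] by simp
    then show ?thesis unfolding det_def by (simp add: sum_negf)
  qed
  finally have "det A = 0" by simp
  then have "\<not> invertible A" using invertible_det_nz by blast
  then obtain X where X: "X \<noteq> 0" "A *v X = 0"
    unfolding invertible_left_inverse matrix_left_invertible_ker by blast
  have lin: "linear (\<lambda>X. \<omega> X Y)" "linear (\<omega> X)" for X Y using bil by (simp_all add: bilinear_def)
  have "\<omega> X (axis i 1) = (A *v X) $ i" for i
  proof -
    have "X = (\<Sum>j\<in>UNIV. (X $ j) *\<^sub>R axis j 1)" by (simp add: basis_expansion flip: scalar_mult_eq_scaleR)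
    then have "\<omega> X (axis i 1) = \<omega> (\<Sum>j\<in>UNIV. (X $ j) *\<^sub>R axis j 1) (axis i 1)" by simp
    also have "\<dots> = (\<Sum>j\<in>UNIV. (X $ j) * \<omega> (axis j 1) (axis i 1))"
      by (simp add: linear_sum[OF lin(1)] linear_scale[OF lin(1)])
    also have "\<dots> = (A *v X) $ i" by (simp add: A_def matrix_vector_mult_def mult.commute)
    finally show ?thesis .
  qed
  then have 0: "\<omega> X (axis i 1) = 0" for i using X(2) by simp
  have "\<omega> X Y = 0" for Y
  proof -
    have "Y = (\<Sum>j\<in>UNIV. (Y $ j) *\<^sub>R axis j 1)" by (simp add: basis_expansion flip: scalar_mult_eq_scaleR)
    then have "\<omega> X Y = \<omega> X (\<Sum>j\<in>UNIV. (Y $ j) *\<^sub>R axis j 1)" by simp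
    then show ?thesis by (simp add: linear_sum[OF lin(2)] linear_scale[OF lin(2)] 0)
  qed
  with X(1) that show ?thesis by blast
qed

text \<open>A nonzero vector extends to a basis. A top form vanishing on the list of that basis,
  with this vector in front, would vanish identically.\<close>

lemma top_form_interior_injective:
  fixes \<mu> :: "('v::euclidean_space, real) covector"
  assumes \<mu>: "alternating DIM('v) \<mu>" "\<mu> ws \<noteq> 0" and z: "\<And>vs. \<mu> (\<zeta> # vs) = 0"
  shows "\<zeta> = 0"
proof (rule ccontr)
  assume "\<zeta> \<noteq> 0"
  then have "independent {\<zeta>}" by simp
  then obtain C where C: "{\<zeta>} \<subseteq> C" "independent C" "span C = UNIV"
    using maximal_independent_subset_extend[of "{\<zeta>}" UNIV] by (metis UNIV_I subset_UNIV top.extremum_uniqueI)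
  have fin: "finite C" and card: "card C = DIM('v)"
    using C(2,3) independent_imp_finite dim_eq_card_independent[OF C(2)] dim_span[of C]
    by (auto simp del: dim_span)
  obtain l where l: "set l = C - {\<zeta>}" "distinct l" using finite_distinct_list[of "C - {\<zeta>}"] fin by auto
  have "length (\<zeta> # l) = DIM('v)"
    using distinct_card[OF l(2)] l(1) card C(1) fin by (simp add: card_Diff_singleton) 
       (metis DIM_positive Suc_pred)
  moreover have "set (\<zeta> # l) = C" "distinct (\<zeta> # l)" using l C(1) by auto
  ultimately have "\<mu> ws = 0"
    using alternating_eq_0_basis[OF \<mu>(1), of "\<zeta> # l"] C(3) z by metis
  then show False using \<mu>(2) by simp
qed

text \<open>Contraction of \<mu> with \<xi> and the square of \<omega>1 are both 4-forms annihilated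
  by \<xi>, so each is determined by its value on the four remaining dual vectors, and the two are
  proportional.\<close>

lemma top_form_interior_onto:
  fixes \<eta> :: "(real^5, real) covector"
  assumes p: "su2_coframe p \<eta> \<omega>1 \<omega>2 \<omega>3" and w: "alternating 2 \<omega>1"
    and \<mu>: "alternating 5 \<mu>" "\<mu> ws \<noteq> 0" and \<xi>: "p 1 \<xi> = 0" "p 2 \<xi> = 0" "p 3 \<xi> = 0" "p 4 \<xi> = 0" "p 5 \<xi> = 1"
  obtains r where "r \<noteq> 0" "\<And>vs. \<mu> ((r *\<^sub>R \<xi>) # vs) = wedge \<omega>1 \<omega>1 vs"
proof -
  obtain B where B: "\<And>i j. i \<in> {1..5} \<Longrightarrow> j \<in> {1..5} \<Longrightarrow> p i (B j) = (if i = j then 1 else 0)"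
    "\<And>X. X = (\<Sum>j=1..5. p j X *\<^sub>R B j)"
    by (rule su2_coframe_dual_basis[OF p]) (rule that)
  have s5: "(\<Sum>i=1..5. f i) = f 1 + f 2 + f 3 + f 4 + f (5::nat)" for f :: "nat \<Rightarrow> real^5"
    by (simp add: eval_nat_numeral add.assoc)
  have B5: "B 5 = \<xi>" using B(2)[of \<xi>] \<xi> unfolding s5 by simp
  have e: "\<omega>1 [X, Y] = p 1 X * p 2 Y - p 2 X * p 1 Y + p 3 X * p 4 Y - p 4 X * p 3 Y" for X Y
    using p by (simp add: su2_coframe_def)
  have k: "\<omega>1 [\<xi>, Y] = 0" "\<omega>1 [Y, \<xi>] = 0" for Y
    unfolding e \<xi> by simp_all
  have ww: "alternating 4 (wedge \<omega>1 \<omega>1)" by (rule alternating_wedge_2_2[OF w w])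
  note ww_eq = wedge_2_2[OF alternating_homogeneous[OF w] alternating_homogeneous[OF w]]
  have ne: "B i \<noteq> B j" if "i \<in> {1..5}" "j \<in> {1..5}" "i \<noteq> j" for i j
    using B(1)[of i j] B(1)[of i i] that by auto
  have dB: "distinct [\<xi>, B 1, B 2, B 3, B 4]" "distinct [B 1, B 2, B 3, B 4]"
    using ne unfolding B5[symmetric] by simp_all
  have span5: "span {\<xi>, B 1, B 2, B 3, B 4} = UNIV"
  proof -
    have "X \<in> span {\<xi>, B 1, B 2, B 3, B 4}" for X
      by (subst B(2)[of X]) (unfold s5 B5, intro span_add span_scale span_base, auto)
    then show ?thesis by auto
  qed
  define c where "c = \<mu> [\<xi>, B 1, B 2, B 3, B 4]"
  have c: "c \<noteq> 0"
  proof
    assume "c = 0"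
    have "\<mu> ws = 0"
    proof (rule alternating_eq_0_basis[OF \<mu>(1)])
      show "span (set [\<xi>, B 1, B 2, B 3, B 4]) = UNIV" using span5 by (simp del: One_nat_def)
      show "\<mu> [\<xi>, B 1, B 2, B 3, B 4] = 0" using \<open>c = 0\<close> by (simp only: c_def)
    qed (use dB in simp_all)
    then show False using \<mu>(2) by simp
  qed
  \<comment> \<open>The square of \<omega>1 takes the value 2 on B1, ..., B4, whereas \<xi>
    \<lrcorner> \<mu> takes the value c.\<close>
  define r where "r = 2 / c"
  have lin: "linear (\<lambda>u. \<mu> (u # vs))" if "length vs = 4" for vs
    using multilin_append[OF alternating_imp_multilin[OF \<mu>(1)], of "[]" vs] that by simp
  have r: "\<mu> ((r *\<^sub>R \<xi>) # vs) = r * \<mu> (\<xi> # vs)" for vs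
  proof (cases "length vs = 4")
    case True
    then show ?thesis using linear_scale[OF lin[OF True]] by simp
  qed (simp add: alternating_length[OF \<mu>(1)])
  define D where "D vs = r * \<mu> (\<xi> # vs) - wedge \<omega>1 \<omega>1 vs" for vs
  have int: "alternating 4 (interior \<xi> \<mu>)" using alternating_interior[of 4 \<mu> \<xi>] \<mu>(1) by simp
  have altD: "alternating 4 D"
    using int ww unfolding alternating_def D_def interior_def
    by (auto simp: linear_iff algebra_simps)
  have "D vs = 0" for vs
  proof (cases "length vs = 4")
    case True
    show ?thesis
    proof (rule multilin_eq_0_span[OF alternating_imp_multilin[OF altD] _ True])
      show "set vs \<subseteq> span {\<xi>, B 1, B 2, B 3, B 4}" unfolding span5 by simp
      fix ys assume ys: "length ys = 4" "set ys \<subseteq> {\<xi>, B 1, B 2, B 3, B 4}"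
      then obtain x y z t where ys_eq: "ys = [x, y, z, t]" by (auto simp: numeral_eq_Suc length_Suc_conv)
      consider "\<not> distinct ys" | "distinct ys" "\<xi> \<in> set ys" | "distinct ys" "\<xi> \<notin> set ys" by blast
      then show "D ys = 0"
      proof cases
        case 1
        then show ?thesis by (rule alternating_not_distinct[OF altD])
      next
        case 2
        then have "\<mu> (\<xi> # ys) = 0" by (intro alternating_not_distinct[OF \<mu>(1)]) simp
        moreover have "x = \<xi> \<or> y = \<xi> \<or> z = \<xi> \<or> t = \<xi>" using 2(2) ys_eq by auto
        then have "wedge \<omega>1 \<omega>1 ys = 0"
          unfolding ys_eq ww_eq by (elim disjE) (simp_all add: k)
        ultimately show ?thesis by (simp add: D_def)
      next
        case 3
        have "set ys = set [B 1, B 2, B 3, B 4]"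
          by (rule card_subset_eq) (use 3 ys distinct_card[OF 3(1)] distinct_card[OF dB(2)] in auto)
        moreover have "D [B 1, B 2, B 3, B 4] = 0"
          using c by (simp add: D_def r_def ww_eq e B(1) flip: c_def del: One_nat_def)
        ultimately show ?thesis using alternating_perm[OF altD _ dB(2) _ ys(1)] by simp
      qed
    qed
  qed (simp add: alternating_length[OF altD])
  then have "\<mu> ((r *\<^sub>R \<xi>) # vs) = wedge \<omega>1 \<omega>1 vs" for vs
    using r by (simp add: D_def)
  with that[of r] c show ?thesis by (simp add: r_def)
qed

section \<open>The exterior derivative in coordinates\<close>

text \<open>\<open>ext_deriv\<close> sees a chart only through the coordinate form attached to it.
  Without that argument the same formula applies to forms on any open set.\<close>

definition dform :: "'v::euclidean_space lform \<Rightarrow> 'v lform" where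
  "dform a x vs = (\<Sum>i<length vs.
     (-1) ^ i * frechet_derivative (\<lambda>y. a y (take i vs @ drop (Suc i) vs)) (at x) (vs ! i))"

lemma ext_deriv_eq_dform: "ext_deriv \<alpha> c = dform (\<alpha> c)"
  by (simp add: fun_eq_iff ext_deriv_def dform_def)

lemma dform_2: "dform a x [u, v] = frechet_derivative (\<lambda>y. a y [v]) (at x) u - frechet_derivative (\<lambda>y. a y [u]) (at x) v"
  by (simp add: dform_def lessThan_Suc)

lemma dform_3: "dform a x [u, v, w] = frechet_derivative (\<lambda>y. a y [v, w]) (at x) u
    - frechet_derivative (\<lambda>y. a y [u, w]) (at x) v + frechet_derivative (\<lambda>y. a y [u, v]) (at x) w"
  by (simp add: dform_def lessThan_Suc)

lemma dform_4: "dform a x [u, v, w, z] = frechet_derivative (\<lambda>y. a y [v, w, z]) (at x) u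
    - frechet_derivative (\<lambda>y. a y [u, w, z]) (at x) v + frechet_derivative (\<lambda>y. a y [u, v, z]) (at x) w
    - frechet_derivative (\<lambda>y. a y [u, v, w]) (at x) z"
  by (simp add: dform_def lessThan_Suc)

lemma frechet_derivative_cong:
  assumes "open V" "x \<in> V" "\<And>y. y \<in> V \<Longrightarrow> f y = g y"
  shows "frechet_derivative f (at x) = frechet_derivative g (at x)"
proof -
  have "(f has_derivative D) (at x) \<longleftrightarrow> (g has_derivative D) (at x)" for D
    using has_derivative_transform_within_open[OF _ assms(1,2), of f D UNIV g]
      has_derivative_transform_within_open[OF _ assms(1,2), of g D UNIV f] assms(3) by auto
  then show ?thesis by (simp add: frechet_derivative_def)
qed

lemma dform_cong:
  assumes "open V" "x \<in> V" "\<And>y. y \<in> V \<Longrightarrow> a y = b y"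
  shows "dform a x = dform b x"
proof
  fix vs
  have "frechet_derivative (\<lambda>y. a y l) (at x) = frechet_derivative (\<lambda>y. b y l) (at x)" for l
    by (rule frechet_derivative_cong[OF assms(1,2)]) (simp add: assms(3))
  then show "dform a x vs = dform b x vs" by (simp add: dform_def)
qed

lemma dform_degree:
  assumes "open V" "x \<in> V" "\<And>y. y \<in> V \<Longrightarrow> homogeneous k (a y)" "length vs \<noteq> Suc k"
  shows "dform a x vs = 0"
  unfolding dform_def
proof (rule sum.neutral, rule ballI)
  fix i assume "i \<in> {..<length vs}"
  then have l: "length (take i vs @ drop (Suc i) vs) \<noteq> k" using assms(4) by auto
  have "frechet_derivative (\<lambda>y. a y (take i vs @ drop (Suc i) vs)) (at x) = frechet_derivative (\<lambda>y. 0) (at x)"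
  proof (rule frechet_derivative_cong[OF assms(1,2)])
    fix y assume "y \<in> V"
    then show "a y (take i vs @ drop (Suc i) vs) = 0"
      using assms(3) l unfolding homogeneous_def by blast
  qed
  then show "(-1) ^ i * frechet_derivative (\<lambda>y. a y (take i vs @ drop (Suc i) vs)) (at x) (vs ! i) = 0"
    by simp
qed

lemma smooth_lform_homogeneous: "smooth_lform_on k V a \<Longrightarrow> y \<in> V \<Longrightarrow> homogeneous k (a y)"
  by (auto simp: smooth_lform_on_def intro: alternating_homogeneous)

lemma smooth_lform_smooth: "smooth_lform_on k V a \<Longrightarrow> smooth_on V (\<lambda>y. a y vs)"
  by (simp add: smooth_lform_on_def)

lemma frechet_derivative_scale:
  assumes "f differentiable (at x)"
  shows "frechet_derivative (\<lambda>y. r * f y) (at x) v = (r::real) * frechet_derivative f (at x) v"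
  using frechet_derivative_at[OF has_derivative_mult_right[OF iffD1[OF frechet_derivative_works assms], of r]]
  by (simp add: fun_eq_iff)

lemma dform_scale:
  assumes "\<And>vs. smooth_on V (\<lambda>y. a y vs)" "x \<in> V"
  shows "dform (\<lambda>y vs. r * a y vs) x vs = r * dform a x vs"
  unfolding dform_def sum_distrib_left
  by (rule sum.cong[OF refl])
     (simp add: frechet_derivative_scale[OF smooth_on_differentiable[OF assms]])

lemma frechet_derivative_diff:
  fixes f :: "'a::real_normed_vector \<Rightarrow> 'b::real_normed_vector"
  assumes "f differentiable (at x)" "g differentiable (at x)"
  shows "frechet_derivative (\<lambda>y. f y - g y) (at x) v = frechet_derivative f (at x) v - frechet_derivative g (at x) v"
  using frechet_derivative_at[OF has_derivative_diff[OF iffD1[OF frechet_derivative_works assms(1)] iffD1[OF frechet_derivative_works assms(2)]]]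
  by (simp add: fun_eq_iff)

lemma frechet_derivative_add:
  fixes f :: "'a::real_normed_vector \<Rightarrow> 'b::real_normed_vector"
  assumes "f differentiable (at x)" "g differentiable (at x)"
  shows "frechet_derivative (\<lambda>y. f y + g y) (at x) v = frechet_derivative f (at x) v + frechet_derivative g (at x) v"
  using frechet_derivative_at[OF has_derivative_add[OF iffD1[OF frechet_derivative_works assms(1)] iffD1[OF frechet_derivative_works assms(2)]]]
  by (simp add: fun_eq_iff)

text \<open>Each second derivative of a coefficient occurs twice with opposite signs. The closedness
  of \<omega>3 will come from this identity for 1-forms.\<close>

lemma dform_dform_1:
  assumes a: "smooth_lform_on 1 V a" and V: "open V" "x \<in> V"
  shows "dform (dform a) x vs = 0"
proof (cases "length vs = 3")
  case True
  then obtain u v w where vs: "vs = [u, v, w]" by (auto simp: numeral_eq_Suc length_Suc_conv)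
  have s: "smooth_on V (\<lambda>y. a y l)" for l using a by (rule smooth_lform_smooth)
  have d: "(\<lambda>y. frechet_derivative (\<lambda>y. a y l) (at y) u) differentiable (at x)" for l u
    by (rule smooth_on_differentiable[OF smooth_on_frechet[OF s] V(2)])
  note sym = symmetric_second_derivative[OF V(1) s V(2)]
  show ?thesis
    unfolding vs dform_3 dform_2 frechet_derivative_diff[OF d d]
    using sym[of "[w]" u v] sym[of "[v]" u w] sym[of "[u]" v w] by simp
next
  case False
  have "homogeneous 2 (dform a y)" if "y \<in> V" for y
    using dform_degree[OF V(1) that smooth_lform_homogeneous[OF a]] by (simp add: homogeneous_def)
  from dform_degree[OF V this] False show ?thesis by simp
qed

lemma dform_dform_2:
  assumes a: "smooth_lform_on 2 V a" and V: "open V" "x \<in> V"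
  shows "dform (dform a) x vs = 0"
proof (cases "length vs = 4")
  case True
  then obtain u v w z where vs: "vs = [u, v, w, z]" by (auto simp: numeral_eq_Suc length_Suc_conv)
  have s: "smooth_on V (\<lambda>y. a y l)" for l using a by (rule smooth_lform_smooth)
  have d: "(\<lambda>y. frechet_derivative (\<lambda>y. a y l) (at y) u) differentiable (at x)" for l u
    by (rule smooth_on_differentiable[OF smooth_on_frechet[OF s] V(2)])
  have d2: "(\<lambda>y. frechet_derivative (\<lambda>y. a y l) (at y) u - frechet_derivative (\<lambda>y. a y l') (at y) v) differentiable (at x)" for l l' u v
    by (intro differentiable_diff d)
  note sym = symmetric_second_derivative[OF V(1) s V(2)]
  show ?thesis
    unfolding vs dform_4 dform_3 frechet_derivative_add[OF d2 d] frechet_derivative_diff[OF d d]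
    using sym[of "[w, z]" u v] sym[of "[v, z]" u w] sym[of "[v, w]" u z] sym[of "[u, z]" v w] sym[of "[u, w]" v z]
      sym[of "[u, v]" w z] by simp
next
  case False
  have "homogeneous 3 (dform a y)" if "y \<in> V" for y
    using dform_degree[OF V(1) that smooth_lform_homogeneous[OF a]] by (simp add: homogeneous_def)
  from dform_degree[OF V this] False show ?thesis by simp
qed

section \<open>Derivatives of the standard forms\<close>

text \<open>Product rule with derivatives taken component by component, since vectors appear as
  functions of an index of which only the values at 1, ..., 6 matter.\<close>

lemma has_derivative_std_F:
  assumes "\<And>a. a \<in> {1..6} \<Longrightarrow> ((\<lambda>z. f z a) has_derivative (\<lambda>u. f' u a)) (at x)"
    and "\<And>a. a \<in> {1..6} \<Longrightarrow> ((\<lambda>z. g z a) has_derivative (\<lambda>u. g' u a)) (at x)"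
  shows "((\<lambda>z. std_F (f z) (g z)) has_derivative (\<lambda>u. std_F (f' u) (g x) + std_F (f x) (g' u))) (at x)"
proof -
  have d: "((\<lambda>z. f z 1) has_derivative (\<lambda>u. f' u 1)) (at x)"
    "((\<lambda>z. f z 2) has_derivative (\<lambda>u. f' u 2)) (at x)"
    "((\<lambda>z. f z 3) has_derivative (\<lambda>u. f' u 3)) (at x)"
    "((\<lambda>z. f z 4) has_derivative (\<lambda>u. f' u 4)) (at x)"
    "((\<lambda>z. f z 5) has_derivative (\<lambda>u. f' u 5)) (at x)"
    "((\<lambda>z. f z 6) has_derivative (\<lambda>u. f' u 6)) (at x)"
    "((\<lambda>z. g z 1) has_derivative (\<lambda>u. g' u 1)) (at x)"
    "((\<lambda>z. g z 2) has_derivative (\<lambda>u. g' u 2)) (at x)"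
    "((\<lambda>z. g z 3) has_derivative (\<lambda>u. g' u 3)) (at x)"
    "((\<lambda>z. g z 4) has_derivative (\<lambda>u. g' u 4)) (at x)"
    "((\<lambda>z. g z 5) has_derivative (\<lambda>u. g' u 5)) (at x)"
    "((\<lambda>z. g z 6) has_derivative (\<lambda>u. g' u 6)) (at x)"
    by (rule assms, simp)+
  show ?thesis
    unfolding std_F_def
    by (rule has_derivative_eq_rhs, (rule has_derivative_add has_derivative_diff has_derivative_mult d)+) (rule ext, algebra)
qed

lemma has_derivative_std_Psip:
  assumes "\<And>a. a \<in> {1..6} \<Longrightarrow> ((\<lambda>z. f z a) has_derivative (\<lambda>u. f' u a)) (at x)"
    and "\<And>a. a \<in> {1..6} \<Longrightarrow> ((\<lambda>z. g z a) has_derivative (\<lambda>u. g' u a)) (at x)"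
    and "\<And>a. a \<in> {1..6} \<Longrightarrow> ((\<lambda>z. h z a) has_derivative (\<lambda>u. h' u a)) (at x)"
  shows "((\<lambda>z. std_Psip (f z) (g z) (h z)) has_derivative
    (\<lambda>u. std_Psip (f' u) (g x) (h x) + std_Psip (f x) (g' u) (h x) + std_Psip (f x) (g x) (h' u))) (at x)"
proof -
  have d: "((\<lambda>z. f z 1) has_derivative (\<lambda>u. f' u 1)) (at x)"
    "((\<lambda>z. f z 2) has_derivative (\<lambda>u. f' u 2)) (at x)"
    "((\<lambda>z. f z 3) has_derivative (\<lambda>u. f' u 3)) (at x)"
    "((\<lambda>z. f z 4) has_derivative (\<lambda>u. f' u 4)) (at x)"
    "((\<lambda>z. f z 5) has_derivative (\<lambda>u. f' u 5)) (at x)"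
    "((\<lambda>z. f z 6) has_derivative (\<lambda>u. f' u 6)) (at x)"
    "((\<lambda>z. g z 1) has_derivative (\<lambda>u. g' u 1)) (at x)"
    "((\<lambda>z. g z 2) has_derivative (\<lambda>u. g' u 2)) (at x)"
    "((\<lambda>z. g z 3) has_derivative (\<lambda>u. g' u 3)) (at x)"
    "((\<lambda>z. g z 4) has_derivative (\<lambda>u. g' u 4)) (at x)"
    "((\<lambda>z. g z 5) has_derivative (\<lambda>u. g' u 5)) (at x)"
    "((\<lambda>z. g z 6) has_derivative (\<lambda>u. g' u 6)) (at x)"
    "((\<lambda>z. h z 1) has_derivative (\<lambda>u. h' u 1)) (at x)"
    "((\<lambda>z. h z 2) has_derivative (\<lambda>u. h' u 2)) (at x)"
    "((\<lambda>z. h z 3) has_derivative (\<lambda>u. h' u 3)) (at x)"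
    "((\<lambda>z. h z 4) has_derivative (\<lambda>u. h' u 4)) (at x)"
    "((\<lambda>z. h z 5) has_derivative (\<lambda>u. h' u 5)) (at x)"
    "((\<lambda>z. h z 6) has_derivative (\<lambda>u. h' u 6)) (at x)"
    by (rule assms, simp)+
  show ?thesis
    unfolding std_Psip_expand
    by (rule has_derivative_eq_rhs, (rule has_derivative_add has_derivative_diff has_derivative_mult d)+) (rule ext, algebra)
qed

lemma has_derivative_std_Psim:
  assumes "\<And>a. a \<in> {1..6} \<Longrightarrow> ((\<lambda>z. f z a) has_derivative (\<lambda>u. f' u a)) (at x)"
    and "\<And>a. a \<in> {1..6} \<Longrightarrow> ((\<lambda>z. g z a) has_derivative (\<lambda>u. g' u a)) (at x)"
    and "\<And>a. a \<in> {1..6} \<Longrightarrow> ((\<lambda>z. h z a) has_derivative (\<lambda>u. h' u a)) (at x)"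
  shows "((\<lambda>z. std_Psim (f z) (g z) (h z)) has_derivative
    (\<lambda>u. std_Psim (f' u) (g x) (h x) + std_Psim (f x) (g' u) (h x) + std_Psim (f x) (g x) (h' u))) (at x)"
proof -
  have d: "((\<lambda>z. f z 1) has_derivative (\<lambda>u. f' u 1)) (at x)"
    "((\<lambda>z. f z 2) has_derivative (\<lambda>u. f' u 2)) (at x)"
    "((\<lambda>z. f z 3) has_derivative (\<lambda>u. f' u 3)) (at x)"
    "((\<lambda>z. f z 4) has_derivative (\<lambda>u. f' u 4)) (at x)"
    "((\<lambda>z. f z 5) has_derivative (\<lambda>u. f' u 5)) (at x)"
    "((\<lambda>z. f z 6) has_derivative (\<lambda>u. f' u 6)) (at x)"
    "((\<lambda>z. g z 1) has_derivative (\<lambda>u. g' u 1)) (at x)"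
    "((\<lambda>z. g z 2) has_derivative (\<lambda>u. g' u 2)) (at x)"
    "((\<lambda>z. g z 3) has_derivative (\<lambda>u. g' u 3)) (at x)"
    "((\<lambda>z. g z 4) has_derivative (\<lambda>u. g' u 4)) (at x)"
    "((\<lambda>z. g z 5) has_derivative (\<lambda>u. g' u 5)) (at x)"
    "((\<lambda>z. g z 6) has_derivative (\<lambda>u. g' u 6)) (at x)"
    "((\<lambda>z. h z 1) has_derivative (\<lambda>u. h' u 1)) (at x)"
    "((\<lambda>z. h z 2) has_derivative (\<lambda>u. h' u 2)) (at x)"
    "((\<lambda>z. h z 3) has_derivative (\<lambda>u. h' u 3)) (at x)"
    "((\<lambda>z. h z 4) has_derivative (\<lambda>u. h' u 4)) (at x)"
    "((\<lambda>z. h z 5) has_derivative (\<lambda>u. h' u 5)) (at x)"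
    "((\<lambda>z. h z 6) has_derivative (\<lambda>u. h' u 6)) (at x)"
    by (rule assms, simp)+
  show ?thesis
    unfolding std_Psim_expand
    by (rule has_derivative_eq_rhs, (rule has_derivative_add has_derivative_diff has_derivative_mult d)+) (rule ext, algebra)
qed

text \<open>Form, base point and vector all vary with x. Expanding the vector in
  \<open>Basis\<close> leaves finitely many products of scalar functions, and regrouping the sum
  returns the two invariant terms.\<close>

lemma has_derivative_pairing:
  fixes a :: "'v::euclidean_space lform" and h :: "'w::real_normed_vector \<Rightarrow> 'v"
  assumes a: "smooth_lform_on 1 V a" and V: "open V" and U: "open U" "x \<in> U" "h ` U \<subseteq> V"
    and h: "(h has_derivative h') (at x)" and w: "(w has_derivative w') (at x)"
  shows "((\<lambda>z. a (h z) [w z]) has_derivative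
    (\<lambda>X. frechet_derivative (\<lambda>y. a y [w x]) (at (h x)) (h' X) + a (h x) [w' X])) (at x)"
proof -
  have lin: "linear (\<lambda>v. a y [v])" if "y \<in> V" for y
  proof -
    have "alternating 1 (a y)" using a that by (simp add: smooth_lform_on_def)
    from multilin_append[OF alternating_imp_multilin[OF this], of "[]" "[]"] show ?thesis by simp
  qed
  have hx: "h x \<in> V" using U by blast
  have d: "((\<lambda>y. a y l) has_derivative frechet_derivative (\<lambda>y. a y l) (at (h x))) (at (h x))" for l
    by (rule smooth_on_has_derivative[OF smooth_lform_smooth[OF a] hx])
  have dh: "((\<lambda>z. a (h z) [b]) has_derivative (\<lambda>X. frechet_derivative (\<lambda>y. a y [b]) (at (h x)) (h' X))) (at x)" for b
    using diff_chain_at[OF h d] by (simp add: o_def)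
  have "((\<lambda>z. \<Sum>b\<in>Basis. (w z \<bullet> b) * a (h z) [b]) has_derivative
     (\<lambda>X. \<Sum>b\<in>Basis. (w x \<bullet> b) * frechet_derivative (\<lambda>y. a y [b]) (at (h x)) (h' X) + (w' X \<bullet> b) * a (h x) [b])) (at x)"
    by (intro has_derivative_sum has_derivative_mult has_derivative_inner_left w dh)
  moreover have "frechet_derivative (\<lambda>y. a y [w x]) (at (h x)) u =
      (\<Sum>b\<in>Basis. (w x \<bullet> b) * frechet_derivative (\<lambda>y. a y [b]) (at (h x)) u)" for u
  proof -
    have "((\<lambda>y. \<Sum>b\<in>Basis. (w x \<bullet> b) * a y [b]) has_derivative
        (\<lambda>u. \<Sum>b\<in>Basis. (w x \<bullet> b) * frechet_derivative (\<lambda>y. a y [b]) (at (h x)) u)) (at (h x))"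
      by (intro has_derivative_sum has_derivative_mult_right d)
    then have "((\<lambda>y. a y [w x]) has_derivative
        (\<lambda>u. \<Sum>b\<in>Basis. (w x \<bullet> b) * frechet_derivative (\<lambda>y. a y [b]) (at (h x)) u)) (at (h x))"
      by (rule has_derivative_transform_within_open[OF _ V hx]) (simp add: linear_expand[OF lin, of _ "w x"])
    from frechet_derivative_at[OF this] show ?thesis by (metis (no_types, lifting))
  qed
  moreover have "a (h x) [w' X] = (\<Sum>b\<in>Basis. (w' X \<bullet> b) * a (h x) [b])" for X
    using linear_expand[OF lin[OF hx], of "w' X"] by simp
  ultimately have "((\<lambda>z. \<Sum>b\<in>Basis. (w z \<bullet> b) * a (h z) [b]) has_derivative
     (\<lambda>X. frechet_derivative (\<lambda>y. a y [w x]) (at (h x)) (h' X) + a (h x) [w' X])) (at x)"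
    by (simp add: sum.distrib)
  then show ?thesis
  proof (rule has_derivative_transform_within_open[OF _ U(1,2)])
    fix z assume "z \<in> U"
    then have "h z \<in> V" using U by blast
    from linear_expand[OF lin[OF this], of "w z"]
    show "(\<Sum>b\<in>Basis. (w z \<bullet> b) * a (h z) [b]) = a (h z) [w z]" by simp
  qed
qed

section \<open>The Levi-Civita connection in an adapted coframe\<close>

lemma frechet_derivative_eq: "(f has_derivative f') (at x) \<Longrightarrow> frechet_derivative f (at x) u = f' u"
  using frechet_derivative_at[of f f' x] by simp

lemma std_cong:
  assumes "\<And>a. a \<in> {1..6} \<Longrightarrow> x a = x' a" "\<And>a. a \<in> {1..6} \<Longrightarrow> y a = y' a" "\<And>a. a \<in> {1..6} \<Longrightarrow> z a = z' a"
  shows "std_F x y = std_F x' y'" "std_Psip x y z = std_Psip x' y' z'" "std_Psim x y z = std_Psim x' y' z'"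
  by (simp_all add: std_expand assms del: One_nat_def)

lemma std_Psip_swap: "std_Psip x y z = - std_Psip x z y" "std_Psip x y z = - std_Psip y x z"
  by (simp_all add: std_expand algebra_simps)

lemma std_Psip_add: "std_Psip (\<lambda>a. x a + x' a) y z = std_Psip x y z + std_Psip x' y z"
  "std_Psip y (\<lambda>a. x a + x' a) z = std_Psip y x z + std_Psip y x' z"
  "std_Psip y z (\<lambda>a. x a + x' a) = std_Psip y z x + std_Psip y z x'"
  by (simp_all add: std_expand algebra_simps)

locale su3_chart =
  fixes V :: "(real^6) set" and F \<Psi>p \<Psi>m :: "(real^6) lform" and e :: "nat \<Rightarrow> (real^6) lform"
    and g :: "real^6 \<Rightarrow> real^6 \<Rightarrow> real^6 \<Rightarrow> real"
  assumes openV: "open V"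
    and adapted: "adapted_coframe V F \<Psi>p \<Psi>m e"
    and metric: "\<And>y u v. y \<in> V \<Longrightarrow> g y u v = (\<Sum>i=1..6. e i y [u] * e i y [v])"
    and smoothF: "smooth_lform_on 2 V F" and smoothP: "smooth_lform_on 3 V \<Psi>p"
    and smoothM: "smooth_lform_on 3 V \<Psi>m"
    and dF: "\<And>y vs. y \<in> V \<Longrightarrow> dform F y vs = 3 * \<Psi>p y vs"
    and dM: "\<And>y vs. y \<in> V \<Longrightarrow> dform \<Psi>m y vs = - 2 * wedge (F y) (F y) vs"
begin

definition cf :: "real^6 \<Rightarrow> real^6 \<Rightarrow> nat \<Rightarrow> real" where "cf y v a = e a y [v]"

definition de :: "real^6 \<Rightarrow> real^6 \<Rightarrow> real^6 \<Rightarrow> nat \<Rightarrow> real" where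
  "de y u v a = frechet_derivative (\<lambda>z. e a z [v]) (at y) u"

lemma smooth_e: "a \<in> {1..6} \<Longrightarrow> smooth_lform_on 1 V (e a)"
  using adapted unfolding adapted_coframe_def by blast

lemma linear_cf: "y \<in> V \<Longrightarrow> a \<in> {1..6} \<Longrightarrow> linear (\<lambda>v. cf y v a)"
proof -
  assume "y \<in> V" "a \<in> {1..6}"
  then have "alternating 1 (e a y)" using smooth_e by (simp add: smooth_lform_on_def)
  from multilin_append[OF alternating_imp_multilin[OF this], of "[]" "[]"] show ?thesis
    by (simp add: cf_def)
qed

lemma F_cf: "y \<in> V \<Longrightarrow> F y [u, v] = std_F (cf y u) (cf y v)"
proof -
  assume y: "y \<in> V"
  have h: "homogeneous 1 (e a y)" if "a \<in> {1..6}" for a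
    using smooth_lform_homogeneous[OF smooth_e[OF that] y] .
  note w = wedge_1_1[OF h[of 1] h[of 2]] wedge_1_1[OF h[of 3] h[of 4]] wedge_1_1[OF h[of 5] h[of 6]]
  have "F y [u, v] = wedge (e 1 y) (e 2 y) [u, v] + wedge (e 3 y) (e 4 y) [u, v] + wedge (e 5 y) (e 6 y) [u, v]"
    using adapted y unfolding adapted_coframe_def by blast
  then show ?thesis by (simp add: w std_F_def cf_def del: One_nat_def)
qed

lemma Psi_cf:
  assumes y: "y \<in> V"
  shows "\<Psi>p y [u, v, w] = std_Psip (cf y u) (cf y v) (cf y w)"
    "\<Psi>m y [u, v, w] = std_Psim (cf y u) (cf y v) (cf y w)"
proof -
  have h: "homogeneous 1 (e a y)" if "a \<in> {1..6}" for a
    using smooth_lform_homogeneous[OF smooth_e[OF that] y] .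
  have hc: "homogeneous 1 (complex_covector (e a y) (e b y))" if "a \<in> {1..6}" "b \<in> {1..6}" for a b
    using h that by (simp add: homogeneous_def complex_covector_def complex_eq_iff)
  have h2: "homogeneous 2 (wedge (complex_covector (e 3 y) (e 4 y)) (complex_covector (e 5 y) (e 6 y)))"
    using wedge_degree[OF hc[of 3 4] hc[of 5 6]] by (simp add: homogeneous_def)
  have "complex_covector (\<Psi>p y) (\<Psi>m y) = wedge (complex_covector (e 1 y) (e 2 y))
      (wedge (complex_covector (e 3 y) (e 4 y)) (complex_covector (e 5 y) (e 6 y)))"
    using adapted y unfolding adapted_coframe_def by blast
  then have "complex_covector (\<Psi>p y) (\<Psi>m y) [u, v, w] = std_Psi (cf y u) (cf y v) (cf y w)"
    by (simp add: wedge_1_2[OF hc[of 1 2] h2] wedge_1_1[OF hc[of 3 4] hc[of 5 6]] std_Psi_def cf_def complex_covector_def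
        del: One_nat_def)
  then have "Complex (\<Psi>p y [u, v, w]) (\<Psi>m y [u, v, w]) = std_Psi (cf y u) (cf y v) (cf y w)"
    by (simp add: complex_covector_def)
  then show "\<Psi>p y [u, v, w] = std_Psip (cf y u) (cf y v) (cf y w)"
    "\<Psi>m y [u, v, w] = std_Psim (cf y u) (cf y v) (cf y w)"
    unfolding std_Psip_def std_Psim_def by (metis complex.sel(1), metis complex.sel(2))
qed

text \<open>An adapted coframe is only assumed to be linearly independent. A vector orthogonal to
  the image of the coordinate map would supply the coefficients of a linear relation, so that map is
  surjective and, in equal dimensions, injective.\<close>

lemma cf_inj:
  assumes y: "y \<in> V" and v: "\<And>a. a \<in> {1..6} \<Longrightarrow> cf y v a = 0"
  shows "v = 0"
proof -
  have "card (Basis :: (real^6) set) = card {1..6::nat}" by simp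
  then obtain \<beta> where \<beta>: "bij_betw \<beta> (Basis :: (real^6) set) {1..6::nat}"
    using finite_same_card_bij[of "Basis :: (real^6) set" "{1..6::nat}"] by auto
  have \<beta>_in: "\<beta> b \<in> {1..6}" if "b \<in> Basis" for b using \<beta> that bij_betwE by blast
  define L where "L v = (\<Sum>b\<in>Basis. cf y v (\<beta> b) *\<^sub>R b)" for v
  have linL: "linear L"
    unfolding L_def using linear_add[OF linear_cf[OF y \<beta>_in]] linear_scale[OF linear_cf[OF y \<beta>_in]]
    by (auto simp: linear_iff scaleR_add_left sum.distrib scaleR_sum_right intro!: sum.cong)
  have "surj L"
  proof (rule ccontr)
    assume "\<not> surj L"
    then have "span (range L) \<noteq> UNIV" using linear_subspace_image[OF linL subspace_UNIV] by (metis span_eq_iff)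
    then obtain w where w: "w \<noteq> 0" "\<forall>x\<in>span (range L). w \<bullet> x = 0"
      using span_not_UNIV_orthogonal by blast
    define c where "c i = w \<bullet> inv_into Basis \<beta> i" for i
    have "(\<Sum>i=1..6. c i * e i y [u]) = 0" for u
    proof -
      have "(\<Sum>i=1..6. c i * e i y [u]) = (\<Sum>b\<in>Basis. c (\<beta> b) * e (\<beta> b) y [u])"
        using sum.reindex_bij_betw[OF \<beta>, of "\<lambda>i. c i * e i y [u]"] by simp
      also have "\<dots> = (\<Sum>b\<in>Basis. (w \<bullet> b) * cf y u (\<beta> b))"
        using \<beta> by (intro sum.cong) (simp_all add: c_def cf_def bij_betw_inv_into_left)
      also have "\<dots> = w \<bullet> L u"
        by (simp add: L_def inner_sum_right mult.commute)
      also have "\<dots> = 0" using w(2) by (simp add: span_base)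
      finally show ?thesis .
    qed
    then have c0: "\<forall>i\<in>{1..6}. c i = 0"
      using adapted y unfolding adapted_coframe_def by blast
    have "w \<bullet> b = 0" if "b \<in> Basis" for b
    proof -
      have "c (\<beta> b) = 0" using c0 \<beta>_in[OF that] by blast
      then show ?thesis using that \<beta> by (simp add: c_def bij_betw_inv_into_left)
    qed
    then show False using w(1) by (metis euclidean_all_zero_iff)
  qed
  then have "inj L" by (rule linear_surjective_imp_injective[OF linL _ refl])
  moreover have "L v = L 0"
    unfolding linear_0[OF linL] unfolding L_def using v \<beta>_in by simp
  ultimately show ?thesis by (rule injD)
qed

lemma has_derivative_cf:
  assumes "y \<in> V" "a \<in> {1..6}"
  shows "((\<lambda>z. cf z v a) has_derivative (\<lambda>u. de y u v a)) (at y)"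
  unfolding cf_def de_def
  by (rule smooth_on_has_derivative[OF smooth_lform_smooth[OF smooth_e[OF assms(2)]] assms(1)])

lemma linear_de_1: "y \<in> V \<Longrightarrow> a \<in> {1..6} \<Longrightarrow> linear (\<lambda>u. de y u v a)"
  by (rule has_derivative_linear[OF has_derivative_cf])

lemma linear_de_2:
  assumes y: "y \<in> V" and a: "a \<in> {1..6}"
  shows "linear (\<lambda>v. de y u v a)"
proof (rule linearI)
  fix v w
  have "((\<lambda>z. cf z v a + cf z w a) has_derivative (\<lambda>u. de y u v a + de y u w a)) (at y)"
    by (intro has_derivative_add has_derivative_cf y a)
  then have "((\<lambda>z. cf z (v + w) a) has_derivative (\<lambda>u. de y u v a + de y u w a)) (at y)"
    by (rule has_derivative_transform_within_open[OF _ openV y]) (simp add: linear_add[OF linear_cf[OF _ a]])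
  from has_derivative_unique[OF this has_derivative_cf[OF y a]]
  show "de y u (v + w) a = de y u v a + de y u w a" by (metis)
next
  fix r :: real and v
  have "((\<lambda>z. r * cf z v a) has_derivative (\<lambda>u. r * de y u v a)) (at y)"
    by (intro has_derivative_mult_right has_derivative_cf y a)
  then have "((\<lambda>z. cf z (r *\<^sub>R v) a) has_derivative (\<lambda>u. r * de y u v a)) (at y)"
    by (rule has_derivative_transform_within_open[OF _ openV y]) (simp add: linear_scale[OF linear_cf[OF _ a]])
  from has_derivative_unique[OF this has_derivative_cf[OF y a]]
  show "de y u (r *\<^sub>R v) a = r *\<^sub>R de y u v a" by (simp add: fun_eq_iff)
qed

lemma frechet_F:
  assumes y: "y \<in> V"
  shows "frechet_derivative (\<lambda>z. F z [v, w]) (at y) u = std_F (de y u v) (cf y w) + std_F (cf y v) (de y u w)"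
proof -
  have "((\<lambda>z. F z [v, w]) has_derivative (\<lambda>u. std_F (de y u v) (cf y w) + std_F (cf y v) (de y u w))) (at y)"
    by (rule has_derivative_transform_within_open[OF _ openV y], rule has_derivative_std_F)
       ((rule has_derivative_cf[OF y], assumption)+, simp add: F_cf)
  from frechet_derivative_eq[OF this] show ?thesis .
qed

lemma frechet_Psi:
  assumes y: "y \<in> V"
  shows "frechet_derivative (\<lambda>z. \<Psi>p z [v, w, x]) (at y) u =
      std_Psip (de y u v) (cf y w) (cf y x) + std_Psip (cf y v) (de y u w) (cf y x) + std_Psip (cf y v) (cf y w) (de y u x)"
    "frechet_derivative (\<lambda>z. \<Psi>m z [v, w, x]) (at y) u =
      std_Psim (de y u v) (cf y w) (cf y x) + std_Psim (cf y v) (de y u w) (cf y x) + std_Psim (cf y v) (cf y w) (de y u x)"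
proof -
  have "((\<lambda>z. \<Psi>p z [v, w, x]) has_derivative (\<lambda>u. std_Psip (de y u v) (cf y w) (cf y x) +
      std_Psip (cf y v) (de y u w) (cf y x) + std_Psip (cf y v) (cf y w) (de y u x))) (at y)"
    by (rule has_derivative_transform_within_open[OF _ openV y], rule has_derivative_std_Psip)
       ((rule has_derivative_cf[OF y], assumption)+, simp add: Psi_cf)
  from frechet_derivative_eq[OF this]
  show "frechet_derivative (\<lambda>z. \<Psi>p z [v, w, x]) (at y) u =
      std_Psip (de y u v) (cf y w) (cf y x) + std_Psip (cf y v) (de y u w) (cf y x) + std_Psip (cf y v) (cf y w) (de y u x)" .
  have "((\<lambda>z. \<Psi>m z [v, w, x]) has_derivative (\<lambda>u. std_Psim (de y u v) (cf y w) (cf y x) +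
      std_Psim (cf y v) (de y u w) (cf y x) + std_Psim (cf y v) (cf y w) (de y u x))) (at y)"
    by (rule has_derivative_transform_within_open[OF _ openV y], rule has_derivative_std_Psim)
       ((rule has_derivative_cf[OF y], assumption)+, simp add: Psi_cf)
  from frechet_derivative_eq[OF this]
  show "frechet_derivative (\<lambda>z. \<Psi>m z [v, w, x]) (at y) u =
      std_Psim (de y u v) (cf y w) (cf y x) + std_Psim (cf y v) (de y u w) (cf y x) + std_Psim (cf y v) (cf y w) (de y u x)" .
qed

text \<open>From 3 \<Psi>p = dF and ddF = 0.\<close>

lemma dP:
  assumes y: "y \<in> V"
  shows "dform \<Psi>p y vs = 0"
proof -
  have "dform (\<lambda>y vs. 3 * \<Psi>p y vs) y vs = dform (dform F) y vs"
    using dform_cong[OF openV y, of "\<lambda>y vs. 3 * \<Psi>p y vs" "dform F"] dF by (simp add: fun_eq_iff)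
  then show ?thesis
    using dform_scale[OF smooth_lform_smooth[OF smoothP] y, where r = 3 and vs = vs] dform_dform_2[OF smoothF openV y, of vs] by simp
qed

end

text \<open>E consists of constant vectors, dual to the coframe at the one point y; the variation of
  the coframe near y is recorded by \<open>de\<close>.\<close>

locale su3_point = su3_chart +
  fixes y :: "real^6" and E :: "nat \<Rightarrow> real^6"
  assumes y: "y \<in> V"
    and dual: "\<And>i j. i \<in> {1..6} \<Longrightarrow> j \<in> {1..6} \<Longrightarrow> cf y (E j) i = (if i = j then 1 else 0)"
    and expand: "\<And>v. v = (\<Sum>j=1..6. cf y v j *\<^sub>R E j)"
begin

text \<open>Half of the Koszul expression for coordinate fields u, v, tested against E a, after
  writing g as the sum of squares of the coframe. It is the a-th component of the Christoffel
  vector, see \<open>cf_christoffel\<close>.\<close>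

definition gam :: "real^6 \<Rightarrow> real^6 \<Rightarrow> nat \<Rightarrow> real" where
  "gam u v a = (de y u v a + de y v u a + (\<Sum>b=1..6. cf y v b * de y u (E a) b) + (\<Sum>b=1..6. cf y u b * de y v (E a) b)
    - (\<Sum>b=1..6. cf y v b * de y (E a) u b) - (\<Sum>b=1..6. cf y u b * de y (E a) v b)) / 2"

text \<open>The \<open>b\<close>-th frame component of \<open>\<nabla>\<^sub>u e\<^sup>a\<close>, see \<open>cf_christoffel\<close>.\<close>
definition conn :: "real^6 \<Rightarrow> nat \<Rightarrow> nat \<Rightarrow> real" where
  "conn u a b = de y u (E b) a - gam u (E b) a"

lemma gam_sym: "gam u v = gam v u"
  by (simp add: fun_eq_iff gam_def)

lemma expand_linear: "linear f \<Longrightarrow> f v = (\<Sum>j=1..6. cf y v j * f (E j))" for f :: "real^6 \<Rightarrow> real"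
  by (subst expand[of v]) (simp add: linear_sum linear_scale)

lemma linear_gam:
  assumes a: "a \<in> {1..6}"
  shows "linear (\<lambda>v. gam u v a)"
proof -
  have l: "linear (\<lambda>v. \<Sum>b=1..6. f v b)" if "\<And>b. b \<in> {1..6} \<Longrightarrow> linear (\<lambda>v. f v b)" for f :: "real^6 \<Rightarrow> nat \<Rightarrow> real"
    using that by (rule linear_compose_sum[rule_format])
  have m: "linear (\<lambda>v. f v * c)" "linear (\<lambda>v. c * f v)" if "linear f" for f :: "real^6 \<Rightarrow> real" and c
    using that by (simp_all add: linear_iff algebra_simps)
  have "linear (\<lambda>v. (de y u v a + de y v u a + (\<Sum>b=1..6. cf y v b * de y u (E a) b) + (\<Sum>b=1..6. cf y u b * de y v (E a) b)
    - (\<Sum>b=1..6. cf y v b * de y (E a) u b) - (\<Sum>b=1..6. cf y u b * de y (E a) v b)) * (1 / 2))"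
    by (intro m linear_compose_add linear_compose_sub l linear_de_1 linear_de_2 linear_cf y a)
  then show ?thesis by (simp add: gam_def)
qed

lemma frechet_g:
  "frechet_derivative (\<lambda>z. g z v w) (at y) u = (\<Sum>a=1..6. de y u v a * cf y w a + cf y v a * de y u w a)"
proof -
  have "((\<lambda>z. \<Sum>a=1..6. cf z v a * cf z w a) has_derivative
      (\<lambda>u. \<Sum>a=1..6. cf y v a * de y u w a + de y u v a * cf y w a)) (at y)"
    by (intro has_derivative_sum has_derivative_mult has_derivative_cf y)
  then have "((\<lambda>z. g z v w) has_derivative
      (\<lambda>u. \<Sum>a=1..6. cf y v a * de y u w a + de y u v a * cf y w a)) (at y)"
    by (rule has_derivative_transform_within_open[OF _ openV y]) (simp add: metric cf_def)
  from frechet_derivative_eq[OF this] show ?thesis by (simp add: add.commute)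
qed

lemma g_cf: "g y v w = (\<Sum>a=1..6. cf y v a * cf y w a)"
  using metric[OF y] by (simp add: cf_def)

lemma g_E: "a \<in> {1..6} \<Longrightarrow> g y v (E a) = cf y v a"
  by (simp add: g_cf dual if_distrib cong: if_cong)

text \<open>The Koszul condition is linear in the test vector, so W is verified on the dual frame.
  Uniqueness, required by the definite description, follows because g-products with the frame
  vectors are coframe components.\<close>

lemma cf_christoffel:
  assumes a: "a \<in> {1..6}"
  shows "cf y (christoffel g y u v) a = gam u v a"
proof -
  define W where "W = (\<Sum>a=1..6. gam u v a *\<^sub>R E a)"
  have cfW: "cf y W b = gam u v b" if "b \<in> {1..6}" for b
    unfolding W_def linear_sum[OF linear_cf[OF y that]] linear_scale[OF linear_cf[OF y that]]
    using that by (simp add: dual if_distrib cong: if_cong)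
  have eq: "2 * g y W z = frechet_derivative (\<lambda>y. g y v z) (at y) u + frechet_derivative (\<lambda>y. g y u z) (at y) v
      - frechet_derivative (\<lambda>y. g y u v) (at y) z" for z
  proof -
    let ?K = "\<lambda>z. (\<Sum>b=1..6. de y u v b * cf y z b + cf y v b * de y u z b) + (\<Sum>b=1..6. de y v u b * cf y z b + cf y u b * de y v z b)
      - (\<Sum>b=1..6. de y z u b * cf y v b + cf y u b * de y z v b)"
    have m: "linear (\<lambda>v. f v * c)" "linear (\<lambda>v. c * f v)" if "linear f" for f :: "real^6 \<Rightarrow> real" and c
      using that by (simp_all add: linear_iff algebra_simps)
    have l: "linear (\<lambda>v. \<Sum>b=1..6. f v b)" if "\<And>b. b \<in> {1..6} \<Longrightarrow> linear (\<lambda>v. f v b)" for f :: "real^6 \<Rightarrow> nat \<Rightarrow> real"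
      using that by (rule linear_compose_sum[rule_format])
    have "linear ?K"
      by (intro m linear_compose_add linear_compose_sub l linear_de_1 linear_de_2 linear_cf y)
    moreover have "?K (E b) = 2 * gam u v b" if b: "b \<in> {1..6}" for b
    proof -
      have "(\<Sum>c=1..6. f c * cf y (E b) c) = f b" for f :: "nat \<Rightarrow> real"
        using b by (simp add: dual if_distrib cong: if_cong)
      then show ?thesis by (simp add: gam_def sum.distrib mult.commute[of "de y (E b) _ _"])
    qed
    ultimately have "?K z = (\<Sum>b=1..6. cf y z b * (2 * gam u v b))"
      using expand_linear[of ?K z] by simp
    also have "\<dots> = 2 * g y W z"
      by (simp add: g_cf cfW sum_distrib_left mult_ac)
    finally show ?thesis unfolding frechet_g by simp
  qed
  have "christoffel g y u v = W"
    unfolding christoffel_def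
  proof (rule the_equality)
    show "\<forall>z. 2 * g y W z = frechet_derivative (\<lambda>y. g y v z) (at y) u + frechet_derivative (\<lambda>y. g y u z) (at y) v
      - frechet_derivative (\<lambda>y. g y u v) (at y) z" using eq by blast
    fix W' assume "\<forall>z. 2 * g y W' z = frechet_derivative (\<lambda>y. g y v z) (at y) u + frechet_derivative (\<lambda>y. g y u z) (at y) v
      - frechet_derivative (\<lambda>y. g y u v) (at y) z"
    then have gg: "g y W' z = g y W z" for z using eq[of z] by (elim allE[of _ z]) linarith
    have "cf y (W' - W) b = 0" if "b \<in> {1..6}" for b
      using gg[of "E b"] g_E[OF that] linear_diff[OF linear_cf[OF y that]] by simp
    then have "W' - W = 0" by (rule cf_inj[OF y])
    then show "W' = W" by simp
  qed
  then show ?thesis using cfW[OF a] by simp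
qed

text \<open>Metric compatibility: the coframe is orthonormal, so its connection matrix is skew. In
  the Koszul expression the relevant sums collapse at frame vectors.\<close>

lemma skew6_conn: "skew6 (conn u)"
  unfolding skew6_def conn_def gam_def
proof (intro ballI)
  fix a b :: nat assume ab: "a \<in> {1..6}" "b \<in> {1..6}"
  have s: "(\<Sum>c=1..6. cf y (E b) c * f c) = f b" if "b \<in> {1..6}" for b and f :: "nat \<Rightarrow> real"
    using that by (simp add: dual if_distrib if_distribR cong: if_cong)
  show "de y u (E b) a - (de y u (E b) a + de y (E b) u a + (\<Sum>ba=1..6. cf y (E b) ba * de y u (E a) ba) + (\<Sum>ba=1..6. cf y u ba * de y (E b) (E a) ba)
      - (\<Sum>ba=1..6. cf y (E b) ba * de y (E a) u ba) - (\<Sum>ba=1..6. cf y u ba * de y (E a) (E b) ba)) / 2 =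
    - (de y u (E a) b - (de y u (E a) b + de y (E a) u b + (\<Sum>ba=1..6. cf y (E a) ba * de y u (E b) ba) + (\<Sum>ba=1..6. cf y u ba * de y (E a) (E b) ba)
      - (\<Sum>ba=1..6. cf y (E a) ba * de y (E b) u ba) - (\<Sum>ba=1..6. cf y u ba * de y (E b) (E a) ba)) / 2)"
    unfolding s[OF ab(1)] s[OF ab(2)] by (simp add: field_simps)
qed

text \<open>The Leibniz rule for the component of v along the coframe: one term from the covariant
  derivative of the coframe, one from that of the coordinate field v. Both sides are linear in v and
  agree on the frame by definition of \<open>conn\<close>.\<close>

lemma de_conn:
  assumes a: "a \<in> {1..6}"
  shows "de y u v a = act (conn u) (cf y v) a + gam u v a"
proof -
  have "linear (\<lambda>v. de y u v a - gam u v a)"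
    by (intro linear_compose_sub linear_de_2 linear_gam y a)
  from expand_linear[OF this, of v] show ?thesis
    by (simp add: act_def conn_def mult.commute)
qed

lemma linear_conn:
  assumes "a \<in> {1..6}"
  shows "linear (\<lambda>u. conn u a b)"
proof -
  have "linear (\<lambda>u. gam u (E b) a)" using linear_gam[OF assms, of "E b"] by (simp add: gam_sym)
  then show ?thesis unfolding conn_def by (intro linear_compose_sub linear_de_1 y assms)
qed

lemma cf_E: "k \<in> {1..6} \<Longrightarrow> a \<in> {1..6} \<Longrightarrow> cf y (E k) a = unit_coord k a"
  by (simp add: dual unit_coord_def)

lemma std_cf_E:
  assumes k: "k \<in> {1..6}"
  shows "std_F x (cf y (E k)) = std_F x (unit_coord k)" "std_F (cf y (E k)) x = std_F (unit_coord k) x"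
    "std_Psip x z (cf y (E k)) = std_Psip x z (unit_coord k)" "std_Psip x (cf y (E k)) z = std_Psip x (unit_coord k) z"
    "std_Psip (cf y (E k)) x z = std_Psip (unit_coord k) x z"
    "std_Psim x z (cf y (E k)) = std_Psim x z (unit_coord k)" "std_Psim x (cf y (E k)) z = std_Psim x (unit_coord k) z"
    "std_Psim (cf y (E k)) x z = std_Psim (unit_coord k) x z"
  by (rule std_cong; simp only: cf_E[OF k])+

lemma de_E: "de y (E i) (E j) = (\<lambda>a. conn (E i) a j + gam (E i) (E j) a)"
  by (simp add: conn_def)

text \<open>The symmetric part \<open>gam\<close> of the derivative of the coframe cancels in the exterior derivatives.\<close>
lemma torsion: "nearly_kaehler_torsion (conn u) (cf y u)"
proof -
  have "nearly_kaehler_torsion (conn (E k)) (unit_coord k)" if k: "k \<in> {1..6}" for k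
  proof (rule nearly_kaehler_torsion_frame[of "\<lambda>a b k. conn (E k) a b", OF _ _ _ _ k])
    show "skew6 (\<lambda>a b. conn (E k) a b)" for k by (rule skew6_conn)
  next
    fix i j k :: nat assume r: "i \<in> {1..6}" "j \<in> {1..6}" "k \<in> {1..6}"
    show "(std_F (\<lambda>a. conn (E i) a j) (unit_coord k) + std_F (unit_coord j) (\<lambda>a. conn (E i) a k))
      - (std_F (\<lambda>a. conn (E j) a i) (unit_coord k) + std_F (unit_coord i) (\<lambda>a. conn (E j) a k))
      + (std_F (\<lambda>a. conn (E k) a i) (unit_coord j) + std_F (unit_coord i) (\<lambda>a. conn (E k) a j))
      = 3 * std_Psip (unit_coord i) (unit_coord j) (unit_coord k)"
      using dF[OF y, of "[E i, E j, E k]"]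
        std_F_swap[of "unit_coord j" "gam (E i) (E k)"] std_F_swap[of "unit_coord i" "gam (E j) (E k)"]
        std_F_swap[of "unit_coord k" "gam (E i) (E j)"]
      unfolding dform_3 frechet_F[OF y] Psi_cf[OF y] de_E std_F_add std_cf_E[OF r(1)] std_cf_E[OF r(2)] std_cf_E[OF r(3)]
        gam_sym[of "E j" "E i"] gam_sym[of "E k" "E i"] gam_sym[of "E k" "E j"]
      by linarith
  next
    fix i j k l :: nat assume r: "i \<in> {1..6}" "j \<in> {1..6}" "k \<in> {1..6}" "l \<in> {1..6}"
    note gs = gam_sym[of "E j" "E i"] gam_sym[of "E k" "E i"] gam_sym[of "E k" "E j"]
        gam_sym[of "E l" "E i"] gam_sym[of "E l" "E j"] gam_sym[of "E l" "E k"]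
    note cs = std_cf_E[OF r(1)] std_cf_E[OF r(2)] std_cf_E[OF r(3)] std_cf_E[OF r(4)]
    show "(std_Psip (\<lambda>a. conn (E i) a j) (unit_coord k) (unit_coord l) + std_Psip (unit_coord j) (\<lambda>a. conn (E i) a k) (unit_coord l)
        + std_Psip (unit_coord j) (unit_coord k) (\<lambda>a. conn (E i) a l))
      - (std_Psip (\<lambda>a. conn (E j) a i) (unit_coord k) (unit_coord l) + std_Psip (unit_coord i) (\<lambda>a. conn (E j) a k) (unit_coord l)
        + std_Psip (unit_coord i) (unit_coord k) (\<lambda>a. conn (E j) a l))
      + (std_Psip (\<lambda>a. conn (E k) a i) (unit_coord j) (unit_coord l) + std_Psip (unit_coord i) (\<lambda>a. conn (E k) a j) (unit_coord l)
        + std_Psip (unit_coord i) (unit_coord j) (\<lambda>a. conn (E k) a l))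
      - (std_Psip (\<lambda>a. conn (E l) a i) (unit_coord j) (unit_coord k) + std_Psip (unit_coord i) (\<lambda>a. conn (E l) a j) (unit_coord k)
        + std_Psip (unit_coord i) (unit_coord j) (\<lambda>a. conn (E l) a k)) = 0"
      using dP[OF y, of "[E i, E j, E k, E l]"]
        std_Psip_swap(2)[of "unit_coord j" "gam (E i) (E k)" "unit_coord l"]
        std_Psip_swap(1)[of "unit_coord j" "unit_coord k" "gam (E i) (E l)"] std_Psip_swap(2)[of "unit_coord j" "gam (E i) (E l)" "unit_coord k"]
        std_Psip_swap(1)[of "unit_coord i" "unit_coord k" "gam (E j) (E l)"]
      unfolding dform_4 frechet_Psi[OF y] de_E std_Psip_add cs gs
      by linarith
    show "(std_Psim (\<lambda>a. conn (E i) a j) (unit_coord k) (unit_coord l) + std_Psim (unit_coord j) (\<lambda>a. conn (E i) a k) (unit_coord l)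
        + std_Psim (unit_coord j) (unit_coord k) (\<lambda>a. conn (E i) a l))
      - (std_Psim (\<lambda>a. conn (E j) a i) (unit_coord k) (unit_coord l) + std_Psim (unit_coord i) (\<lambda>a. conn (E j) a k) (unit_coord l)
        + std_Psim (unit_coord i) (unit_coord k) (\<lambda>a. conn (E j) a l))
      + (std_Psim (\<lambda>a. conn (E k) a i) (unit_coord j) (unit_coord l) + std_Psim (unit_coord i) (\<lambda>a. conn (E k) a j) (unit_coord l)
        + std_Psim (unit_coord i) (unit_coord j) (\<lambda>a. conn (E k) a l))
      - (std_Psim (\<lambda>a. conn (E l) a i) (unit_coord j) (unit_coord k) + std_Psim (unit_coord i) (\<lambda>a. conn (E l) a j) (unit_coord k)
        + std_Psim (unit_coord i) (unit_coord j) (\<lambda>a. conn (E l) a k))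
      = - 4 * (std_F (unit_coord i) (unit_coord j) * std_F (unit_coord k) (unit_coord l)
        - std_F (unit_coord i) (unit_coord k) * std_F (unit_coord j) (unit_coord l)
        + std_F (unit_coord i) (unit_coord l) * std_F (unit_coord j) (unit_coord k))"
    proof -
      \<comment> \<open>The six shuffles coincide in pairs, giving the factor 2; with the
        coefficient -2 of F \<and> F it produces the -4 of the frame identity.\<close>
      have "wedge (F y) (F y) [E i, E j, E k, E l] = 2 * (std_F (unit_coord i) (unit_coord j) * std_F (unit_coord k) (unit_coord l)
        - std_F (unit_coord i) (unit_coord k) * std_F (unit_coord j) (unit_coord l)
        + std_F (unit_coord i) (unit_coord l) * std_F (unit_coord j) (unit_coord k))"
        unfolding wedge_2_2[OF smooth_lform_homogeneous[OF smoothF y] smooth_lform_homogeneous[OF smoothF y]] F_cf[OF y] cs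
        by simp
      then show ?thesis
        using dM[OF y, of "[E i, E j, E k, E l]"]
          std_Psim_swap(2)[of "unit_coord j" "gam (E i) (E k)" "unit_coord l"]
          std_Psim_swap(1)[of "unit_coord j" "unit_coord k" "gam (E i) (E l)"] std_Psim_swap(2)[of "unit_coord j" "gam (E i) (E l)" "unit_coord k"]
          std_Psim_swap(1)[of "unit_coord i" "unit_coord k" "gam (E j) (E l)"]
        unfolding dform_4 frechet_Psi[OF y] de_E std_Psim_add cs gs
        by linarith
    qed
  qed
  from nearly_kaehler_torsion_combine[of "\<lambda>a b k. conn (E k) a b" "cf y u", OF this]
  have "nearly_kaehler_torsion (\<lambda>a b. \<Sum>k=1..6. cf y u k * conn (E k) a b) (cf y u)" by simp
  moreover have "conn u a b = (\<Sum>k=1..6. cf y u k * conn (E k) a b)" if "a \<in> {1..6}" for a b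
    by (rule expand_linear[OF linear_conn[OF that]])
  ultimately show ?thesis by (simp add: nearly_kaehler_torsion_def del: One_nat_def)
qed

end

section \<open>Totally geodesic hypersurfaces in coordinates\<close>

lemma act_skew:
  assumes "skew6 A"
  shows "(\<Sum>a=1..6. x a * act A y a) = - (\<Sum>a=1..6. act A x a * y a)"
  unfolding act_def sum_1_6 skew6_rules[OF assms] by algebra

text \<open>The image of L has dimension 5, so adjoining one vector outside it spans
  everything.\<close>

lemma hyperplane_decomposition:
  fixes L :: "real^5 \<Rightarrow> real^6"
  assumes L: "linear L" "inj L" and \<nu>: "\<nu> \<notin> range L"
  obtains c Z where "u = c *\<^sub>R \<nu> + L Z"
proof -
  have sub: "subspace (range L)" using linear_subspace_image[OF L(1) subspace_UNIV] .
  have "dim (range L) = 5" using dim_image_eq[OF L(1), of UNIV] L(2) by (simp add: inj_on_subset)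
  moreover have "\<nu> \<notin> span (range L)" using \<nu> sub by (metis span_eq_iff)
  ultimately have "dim (insert \<nu> (range L)) = DIM(real^6)" by (simp add: dim_insert)
  then have "u \<in> span (insert \<nu> (range L))" by (metis dim_eq_full UNIV_I)
  then obtain c where "u - c *\<^sub>R \<nu> \<in> span (range L)" by (auto simp: span_breakdown_eq)
  then have "u - c *\<^sub>R \<nu> \<in> range L" using sub by (metis span_eq_iff)
  then obtain Z where "u - c *\<^sub>R \<nu> = L Z" by auto
  then have "u = c *\<^sub>R \<nu> + L Z" by (simp add: algebra_simps)
  then show thesis by (rule that)
qed

text \<open>\<open>unit\<close> and \<open>kernel\<close> are required on all of U because they are
  differentiated at x, whereas injectivity of the derivative and \<open>geodesic\<close> are
  required at x alone.\<close>

locale su3_hypersurface = su3_point V F \<Psi>p \<Psi>m e g "h x" E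
  for V F \<Psi>p \<Psi>m e g and h :: "real^5 \<Rightarrow> real^6" and x E +
  fixes U :: "(real^5) set" and \<xi> :: "real^5 \<Rightarrow> real^5"
  assumes openU: "open U" and x: "x \<in> U" and hU: "h ` U \<subseteq> V" and smooth_h: "smooth_on U h"
    and inj_h: "inj (frechet_derivative h (at x))" and smooth_xi: "smooth_on U \<xi>"
    and unit: "\<And>z. z \<in> U \<Longrightarrow> (\<Sum>a=1..6. cf (h z) (frechet_derivative h (at z) (\<xi> z)) a * cf (h z) (frechet_derivative h (at z) (\<xi> z)) a) = 1"
    and kernel: "\<And>z Y. z \<in> U \<Longrightarrow> std_F (cf (h z) (frechet_derivative h (at z) (\<xi> z))) (cf (h z) (frechet_derivative h (at z) Y)) = 0"
    and geodesic: "\<And>X Y. second_fundamental_form g h x X Y = 0"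
begin

definition eps :: "real^5 \<Rightarrow> real^5 \<Rightarrow> nat \<Rightarrow> real" where
  "eps z Y = cf (h z) (frechet_derivative h (at z) Y)"

text \<open>Coframe components of the unit normal J\<xi>. By \<open>kernel\<close> it is orthogonal
  to the hypersurface, and by construction it is as smooth as \<xi>.\<close>

definition nrm :: "real^5 \<Rightarrow> nat \<Rightarrow> real" where
  "nrm z = std_J (eps z (\<xi> z))"

text \<open>Components of the covariant derivative, along X, of the push-forward of the constant
  field Y. It is symmetric in X and Y and therefore cancels in exterior derivatives on the
  hypersurface.\<close>

definition bet :: "real^5 \<Rightarrow> real^5 \<Rightarrow> nat \<Rightarrow> real" where
  "bet X Y a = gam (frechet_derivative h (at x) X) (frechet_derivative h (at x) Y) a
     + cf (h x) (frechet_derivative (\<lambda>z. frechet_derivative h (at z) Y) (at x) X) a"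

abbreviation "Dh \<equiv> frechet_derivative h (at x)"

lemma bet_sym: "bet X Y = bet Y X"
  unfolding bet_def symmetric_second_derivative[OF openU smooth_h x, of Y X] gam_sym[of "Dh X"] ..

lemma linear_Dh: "linear Dh"
  by (rule smooth_on_linear_frechet[OF smooth_h x])

lemma nrm_unit: "z \<in> U \<Longrightarrow> (\<Sum>a=1..6. nrm z a * nrm z a) = 1"
  using unit by (simp add: nrm_def std_J_norm eps_def del: One_nat_def)

lemma nrm_orthogonal: "z \<in> U \<Longrightarrow> (\<Sum>a=1..6. nrm z a * eps z Y a) = 0"
  unfolding nrm_def std_J_orthogonal unfolding eps_def by (rule kernel)

text \<open>The same Leibniz rule as in \<open>de_conn\<close>, now along the immersion: the
  connection acts on the components and \<open>bet\<close> carries the derivative of the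
  pushed-forward field.\<close>

lemma has_derivative_eps:
  assumes a: "a \<in> {1..6}"
  shows "((\<lambda>z. eps z Y a) has_derivative (\<lambda>X. act (conn (Dh X)) (eps x Y) a + bet X Y a)) (at x)"
proof -
  have "((\<lambda>z. e a (h z) [frechet_derivative h (at z) Y]) has_derivative
    (\<lambda>X. frechet_derivative (\<lambda>y. e a y [Dh Y]) (at (h x)) (Dh X)
       + e a (h x) [frechet_derivative (\<lambda>z. frechet_derivative h (at z) Y) (at x) X])) (at x)"
    by (rule has_derivative_pairing[OF smooth_e[OF a] openV openU x hU smooth_on_has_derivative[OF smooth_h x]
          smooth_on_has_derivative[OF smooth_on_frechet[OF smooth_h] x]])
  then have "((\<lambda>z. eps z Y a) has_derivative
    (\<lambda>X. de (h x) (Dh X) (Dh Y) a + cf (h x) (frechet_derivative (\<lambda>z. frechet_derivative h (at z) Y) (at x) X) a)) (at x)"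
    by (simp only: eps_def cf_def de_def)
  then show ?thesis unfolding de_conn[OF a] by (simp add: bet_def eps_def add.assoc)
qed

definition normal :: "real^6" where
  "normal = (\<Sum>a=1..6. nrm x a *\<^sub>R E a)"

lemma cf_sum_E: "a \<in> {1..6} \<Longrightarrow> cf (h x) (\<Sum>b=1..6. f b *\<^sub>R E b) a = f a"
  by (simp add: linear_sum[OF linear_cf[OF y]] linear_scale[OF linear_cf[OF y]] dual if_distrib cong: if_cong)

lemma g_normal: "g (h x) normal v = (\<Sum>a=1..6. nrm x a * cf (h x) v a)"
  unfolding g_cf normal_def by (rule sum.cong) (simp_all add: cf_sum_E del: One_nat_def)

lemma normal_tangent: "(\<Sum>a=1..6. nrm x a * cf (h x) (Dh Y) a) = 0"
  using nrm_orthogonal[OF x, of Y] by (simp add: eps_def)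

lemma decomposition:
  obtains c Z where "u = c *\<^sub>R normal + Dh Z"
proof (rule hyperplane_decomposition[OF linear_Dh inj_h, of normal u])
  show "normal \<notin> range Dh"
  proof
    assume "normal \<in> range Dh"
    then obtain Y where "normal = Dh Y" by auto
    then have "g (h x) normal normal = 0" using g_normal[of "Dh Y"] normal_tangent by simp
    moreover have "g (h x) normal normal = (\<Sum>a=1..6. nrm x a * nrm x a)"
      unfolding g_normal by (rule sum.cong) (simp_all add: normal_def cf_sum_E del: One_nat_def)
    ultimately show False using nrm_unit[OF x] by simp
  qed
qed (rule that)

text \<open>This is the vanishing of the second fundamental form in components. As
  \<open>normal_part\<close> is a definite description, the multiple of the unit normal in the
  decomposition is first shown to be the only candidate.\<close>

lemma bet_tangent: "(\<Sum>a=1..6. nrm x a * bet X Y a) = 0"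
proof -
  define w where "w = cov_deriv_along g h x X Y"
  have w: "cf (h x) w a = bet X Y a" if a: "a \<in> {1..6}" for a
    unfolding w_def cov_deriv_along_def linear_add[OF linear_cf[OF y a]] cf_christoffel[OF a] bet_def by simp
  obtain c Z where cZ: "w = c *\<^sub>R normal + Dh Z" by (rule decomposition)
  have g_scale: "g (h x) (c *\<^sub>R normal) v = c * g (h x) normal v" for v
    unfolding g_cf by (simp add: linear_scale[OF linear_cf[OF y]] sum_distrib_left mult.assoc)
  have gn: "g (h x) normal (Dh Y) = 0" for Y using g_normal normal_tangent by simp
  have "normal_part (g (h x)) (range Dh) w = c *\<^sub>R normal"
    unfolding normal_part_def
  proof (rule the_equality)
    show "w - c *\<^sub>R normal \<in> range Dh \<and> (\<forall>z\<in>range Dh. g (h x) (c *\<^sub>R normal) z = 0)"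
      using cZ by (auto simp: g_scale gn)
    fix n assume n: "w - n \<in> range Dh \<and> (\<forall>z\<in>range Dh. g (h x) n z = 0)"
    then obtain Y where Y: "w - n = Dh Y" by auto
    then have d: "n - c *\<^sub>R normal = Dh (Z - Y)"
      using cZ by (simp add: linear_diff[OF linear_Dh] algebra_simps)
    have "g (h x) (n - c *\<^sub>R normal) v = g (h x) n v - g (h x) (c *\<^sub>R normal) v" for v
      unfolding g_cf by (simp add: linear_diff[OF linear_cf[OF y]] sum_subtractf left_diff_distrib)
    then have "g (h x) (n - c *\<^sub>R normal) (Dh (Z - Y)) = 0" using n by (simp add: g_scale gn)
    then have "(\<Sum>a=1..6. cf (h x) (n - c *\<^sub>R normal) a * cf (h x) (n - c *\<^sub>R normal) a) = 0"
      unfolding d[symmetric] g_cf .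
    then have "cf (h x) (n - c *\<^sub>R normal) a = 0" if "a \<in> {1..6}" for a
      using that by (subst (asm) sum_nonneg_eq_0_iff) auto
    then have "n - c *\<^sub>R normal = 0" by (rule cf_inj[OF y])
    then show "n = c *\<^sub>R normal" by simp
  qed
  then have 0: "c *\<^sub>R normal = 0"
    using geodesic[of X Y] unfolding second_fundamental_form_def w_def by simp
  have "(\<Sum>a=1..6. nrm x a * bet X Y a) = (\<Sum>a=1..6. nrm x a * cf (h x) w a)"
    by (rule sum.cong) (simp_all add: w del: One_nat_def)
  also have "\<dots> = 0" using normal_tangent[of Z] cZ 0 by simp
  finally show ?thesis .
qed

text \<open>Expresses that the normal is parallel: its components change by the connection matrix
  only. Smoothness of \<xi> gives the existence of the derivative; its value is found from the two
  families of constraints satisfied by the normal.\<close>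

lemma has_derivative_nrm:
  assumes a: "a \<in> {1..6}"
  shows "((\<lambda>z. nrm z a) has_derivative (\<lambda>X. act (conn (Dh X)) (nrm x) a)) (at x)"
proof -
  define w where "w z = frechet_derivative h (at z) (\<xi> z)" for z
  have sw: "smooth_on U w" unfolding w_def by (rule smooth_on_frechet_apply[OF openU smooth_h smooth_xi])
  define d where "d X b = frechet_derivative (\<lambda>y. e b y [w x]) (at (h x)) (Dh X) + e b (h x) [frechet_derivative w (at x) X]" for X b
  have dw: "((\<lambda>z. eps z (\<xi> z) b) has_derivative (\<lambda>X. d X b)) (at x)" if "b \<in> {1..6}" for b
    using has_derivative_pairing[OF smooth_e[OF that] openV openU x hU smooth_on_has_derivative[OF smooth_h x]
          smooth_on_has_derivative[OF sw x]]
    by (simp only: d_def eps_def cf_def w_def)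
  have dn: "((\<lambda>z. nrm z b) has_derivative (\<lambda>X. std_J (d X) b)) (at x)" if b: "b \<in> {1..6}" for b
  proof -
    have "b = 1 \<or> b = 2 \<or> b = 3 \<or> b = 4 \<or> b = 5 \<or> b = 6" using b by auto
    then show ?thesis
      unfolding nrm_def
      by (elim disjE; hypsubst; simp only: std_J_simps; intro has_derivative_minus dw; simp)
  qed
  have "std_J (d X) a = act (conn (Dh X)) (nrm x) a" for X
  proof -
    \<comment> \<open>The defect is orthogonal to the normal by differentiating its unit length, and
      to every tangent vector by differentiating the orthogonality and using
      \<open>bet_tangent\<close>. Tangent vectors and the normal span, so it is orthogonal to
      itself.\<close>
    define m where "m b = std_J (d X) b - act (conn (Dh X)) (nrm x) b" for b
    have "((\<lambda>z. \<Sum>b=1..6. nrm z b * nrm z b) has_derivative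
        (\<lambda>X. \<Sum>b=1..6. nrm x b * std_J (d X) b + std_J (d X) b * nrm x b)) (at x)"
      by (intro has_derivative_sum has_derivative_mult dn)
    then have "((\<lambda>z. 1) has_derivative
        (\<lambda>X. \<Sum>b=1..6. nrm x b * std_J (d X) b + std_J (d X) b * nrm x b)) (at x)"
      by (rule has_derivative_transform_within_open[OF _ openU x]) (rule nrm_unit)
    from frechet_derivative_eq[OF this, of X]
    have n1: "(\<Sum>b=1..6. std_J (d X) b * nrm x b) = 0"
      by (simp add: mult.commute flip: sum_distrib_left)
    have m1: "(\<Sum>b=1..6. m b * nrm x b) = 0"
    proof -
      have "(\<Sum>b=1..6. act (conn (Dh X)) (nrm x) b * nrm x b) = 0"
        using act_skew[OF skew6_conn, of "nrm x" "Dh X" "nrm x"] by (simp add: mult.commute[of "nrm x _"])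
      then show ?thesis using n1 by (simp add: m_def left_diff_distrib sum_subtractf)
    qed
    have m2: "(\<Sum>b=1..6. m b * eps x Y b) = 0" for Y
    proof -
      have "((\<lambda>z. \<Sum>b=1..6. nrm z b * eps z Y b) has_derivative
          (\<lambda>X. \<Sum>b=1..6. nrm x b * (act (conn (Dh X)) (eps x Y) b + bet X Y b) + std_J (d X) b * eps x Y b)) (at x)"
        by (intro has_derivative_sum has_derivative_mult dn has_derivative_eps)
      then have "((\<lambda>z. 0) has_derivative
          (\<lambda>X. \<Sum>b=1..6. nrm x b * (act (conn (Dh X)) (eps x Y) b + bet X Y b) + std_J (d X) b * eps x Y b)) (at x)"
        by (rule has_derivative_transform_within_open[OF _ openU x]) (rule nrm_orthogonal)
      from frechet_derivative_eq[OF this, of X]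
      have "(\<Sum>b=1..6. nrm x b * act (conn (Dh X)) (eps x Y) b) + (\<Sum>b=1..6. std_J (d X) b * eps x Y b) = 0"
        using bet_tangent[of X Y] by (simp add: sum.distrib distrib_left)
      then show ?thesis
        using act_skew[OF skew6_conn, of "nrm x" "Dh X" "eps x Y"]
        by (simp add: m_def left_diff_distrib sum_subtractf)
    qed
    define W where "W = (\<Sum>b=1..6. m b *\<^sub>R E b)"
    have W: "cf (h x) W b = m b" if "b \<in> {1..6}" for b unfolding W_def by (rule cf_sum_E[OF that])
    obtain c Z where cZ: "W = c *\<^sub>R normal + Dh Z" by (rule decomposition)
    have "(\<Sum>b=1..6. m b * cf (h x) W b) = c * (\<Sum>b=1..6. m b * nrm x b) + (\<Sum>b=1..6. m b * eps x Z b)"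
    proof -
      have "(\<Sum>b=1..6. m b * cf (h x) W b) = (\<Sum>b=1..6. c * (m b * nrm x b) + m b * eps x Z b)"
      proof (rule sum.cong[OF refl])
        fix b :: nat assume b: "b \<in> {1..6}"
        have "cf (h x) W b = c * nrm x b + eps x Z b"
          unfolding cZ linear_add[OF linear_cf[OF y b]] linear_scale[OF linear_cf[OF y b]]
          by (simp only: normal_def cf_sum_E[OF b] eps_def real_scaleR_def)
        then show "m b * cf (h x) W b = c * (m b * nrm x b) + m b * eps x Z b" by (simp add: algebra_simps)
      qed
      then show ?thesis by (simp add: sum.distrib sum_distrib_left)
    qed
    then have "(\<Sum>b=1..6. m b * cf (h x) W b) = 0" unfolding m1 m2 by simp
    moreover have "(\<Sum>b=1..6. m b * cf (h x) W b) = (\<Sum>b=1..6. m b * m b)"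
      by (rule sum.cong) (simp_all add: W del: One_nat_def)
    ultimately have "(\<Sum>b=1..6. m b * m b) = 0" by simp
    then have "m a = 0" using a by (subst (asm) sum_nonneg_eq_0_iff) auto
    then show ?thesis by (simp add: m_def)
  qed
  with dn[OF a] show ?thesis by simp
qed

lemma torsion_tangent: "nearly_kaehler_torsion (conn (Dh X)) (eps x X)"
  unfolding eps_def by (rule torsion)

text \<open>Written as minus the contraction of F with the parallel normal, \<eta> has derivative
  given by \<open>std_F_act\<close>. Antisymmetrising yields 2 \<Psi>p(J\<xi>, X, Y), and moving J
  out turns this into -2 \<Psi>m(\<xi>, X, Y).\<close>

lemma dform_eta:
  assumes "\<And>z Y. z \<in> U \<Longrightarrow> \<eta> z [Y] = (\<Sum>a=1..6. eps z (\<xi> z) a * eps z Y a)"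
  shows "dform \<eta> x [X, Y] = - 2 * std_Psim (eps x (\<xi> x)) (eps x X) (eps x Y)"
proof -
  have D: "frechet_derivative (\<lambda>z. \<eta> z [Y]) (at x) X = - (std_Psip (eps x X) (nrm x) (eps x Y) + std_F (nrm x) (bet X Y))" for X Y
  proof -
    have "((\<lambda>z. std_F (nrm z) (eps z Y)) has_derivative
        (\<lambda>X. std_F (act (conn (Dh X)) (nrm x)) (eps x Y) + std_F (nrm x) (\<lambda>a. act (conn (Dh X)) (eps x Y) a + bet X Y a))) (at x)"
      by (rule has_derivative_std_F) ((rule has_derivative_nrm, assumption), (rule has_derivative_eps, assumption))
    from has_derivative_minus[OF this]
    have "((\<lambda>z. \<eta> z [Y]) has_derivative
        (\<lambda>X. - (std_F (act (conn (Dh X)) (nrm x)) (eps x Y) + std_F (nrm x) (\<lambda>a. act (conn (Dh X)) (eps x Y) a + bet X Y a)))) (at x)"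
      by (rule has_derivative_transform_within_open[OF _ openU x]) (simp add: assms nrm_def std_F_J)
    from frechet_derivative_eq[OF this, of X] show ?thesis
      using std_F_act[OF skew6_conn torsion_tangent, of X "nrm x" "eps x Y"] unfolding std_F_add by simp
  qed
  show ?thesis
    unfolding dform_2 D bet_sym[of Y X] nrm_def std_Psip_swap(2)[of "eps x X"] std_Psip_swap(2)[of "eps x Y"] std_Psip_J
    using std_Psim_swap(1)[of "eps x (\<xi> x)" "eps x X" "eps x Y"] by simp
qed

text \<open>The equation dF = 3 \<Psi>p restricted to the hypersurface. The 3 arises as the number
  of terms in the alternating sum, each contributing the same value of \<Psi>p.\<close>

lemma dform_omega1:
  assumes "\<And>z X Y. z \<in> U \<Longrightarrow> \<omega>1 z [X, Y] = std_F (eps z X) (eps z Y)"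
  shows "dform \<omega>1 x [X, Y, Z] = 3 * std_Psip (eps x X) (eps x Y) (eps x Z)"
proof -
  have D: "frechet_derivative (\<lambda>z. \<omega>1 z [Y, Z]) (at x) X =
      std_Psip (eps x X) (eps x Y) (eps x Z) + std_F (bet X Y) (eps x Z) + std_F (eps x Y) (bet X Z)" for X Y Z
  proof -
    have "((\<lambda>z. std_F (eps z Y) (eps z Z)) has_derivative
        (\<lambda>X. std_F (\<lambda>a. act (conn (Dh X)) (eps x Y) a + bet X Y a) (eps x Z)
           + std_F (eps x Y) (\<lambda>a. act (conn (Dh X)) (eps x Z) a + bet X Z a))) (at x)"
      by (rule has_derivative_std_F) (rule has_derivative_eps, assumption)+
    then have "((\<lambda>z. \<omega>1 z [Y, Z]) has_derivative
        (\<lambda>X. std_F (\<lambda>a. act (conn (Dh X)) (eps x Y) a + bet X Y a) (eps x Z)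
           + std_F (eps x Y) (\<lambda>a. act (conn (Dh X)) (eps x Z) a + bet X Z a))) (at x)"
      by (rule has_derivative_transform_within_open[OF _ openU x]) (simp add: assms)
    from frechet_derivative_eq[OF this, of X] show ?thesis
      using std_F_act[OF skew6_conn torsion_tangent, of X "eps x Y" "eps x Z"] unfolding std_F_add by simp
  qed
  show ?thesis
    unfolding dform_3 D bet_sym[of Y X] bet_sym[of Z X] bet_sym[of Z Y]
    using std_F_swap[of "bet X Z" "eps x Y"] std_F_swap[of "bet X Y" "eps x Z"] std_F_swap[of "bet Y Z" "eps x X"]
      std_Psip_swap(2)[of "eps x Y" "eps x X" "eps x Z"]
      std_Psip_swap(2)[of "eps x Z" "eps x X" "eps x Y"] std_Psip_swap(1)[of "eps x X" "eps x Z" "eps x Y"]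
    by linarith
qed

text \<open>Here \<omega>2 is read as the contraction of \<Psi>m with the parallel normal, so only
  \<open>std_Psim_act\<close> contributes. Contracting F with the normal gives -\<eta>, and the
  three terms of the alternating sum agree.\<close>

lemma dform_omega2:
  assumes "\<And>z X Y. z \<in> U \<Longrightarrow> \<omega>2 z [X, Y] = std_Psip (eps z (\<xi> z)) (eps z X) (eps z Y)"
  defines "\<eta> \<equiv> \<lambda>Y. \<Sum>a=1..6. eps x (\<xi> x) a * eps x Y a"
  shows "dform \<omega>2 x [X, Y, Z] = - 3 * (\<eta> X * std_F (eps x Y) (eps x Z) - \<eta> Y * std_F (eps x X) (eps x Z) + \<eta> Z * std_F (eps x X) (eps x Y))"
proof -
  have \<eta>: "std_F (nrm x) (eps x Y) = - \<eta> Y" "std_F (eps x Y) (nrm x) = \<eta> Y" for Y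
    using std_F_swap[of "eps x Y" "nrm x"] by (simp_all add: nrm_def std_F_J \<eta>_def)
  have D: "frechet_derivative (\<lambda>z. \<omega>2 z [Y, Z]) (at x) X =
      - (\<eta> X * std_F (eps x Y) (eps x Z) + std_F (eps x X) (eps x Y) * \<eta> Z - std_F (eps x X) (eps x Z) * \<eta> Y)
      + std_Psim (nrm x) (bet X Y) (eps x Z) + std_Psim (nrm x) (eps x Y) (bet X Z)" for X Y Z
  proof -
    have "((\<lambda>z. std_Psim (nrm z) (eps z Y) (eps z Z)) has_derivative
        (\<lambda>X. std_Psim (act (conn (Dh X)) (nrm x)) (eps x Y) (eps x Z)
           + std_Psim (nrm x) (\<lambda>a. act (conn (Dh X)) (eps x Y) a + bet X Y a) (eps x Z)
           + std_Psim (nrm x) (eps x Y) (\<lambda>a. act (conn (Dh X)) (eps x Z) a + bet X Z a))) (at x)"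
      by (rule has_derivative_std_Psim) ((rule has_derivative_nrm, assumption), (rule has_derivative_eps, assumption)+)
    then have "((\<lambda>z. \<omega>2 z [Y, Z]) has_derivative
        (\<lambda>X. std_Psim (act (conn (Dh X)) (nrm x)) (eps x Y) (eps x Z)
           + std_Psim (nrm x) (\<lambda>a. act (conn (Dh X)) (eps x Y) a + bet X Y a) (eps x Z)
           + std_Psim (nrm x) (eps x Y) (\<lambda>a. act (conn (Dh X)) (eps x Z) a + bet X Z a))) (at x)"
      by (rule has_derivative_transform_within_open[OF _ openU x]) (simp add: assms(1) nrm_def std_Psim_J)
    from frechet_derivative_eq[OF this, of X] show ?thesis
      using std_Psim_act[OF skew6_conn torsion_tangent, of X "nrm x" "eps x Y" "eps x Z"]
      unfolding std_Psim_add \<eta> by (simp add: algebra_simps)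
  qed
  show ?thesis
    unfolding dform_3 D bet_sym[of Y X] bet_sym[of Z X] bet_sym[of Z Y]
    using std_Psim_swap(1)[of "nrm x" "bet X Z" "eps x Y"] std_F_swap[of "eps x Y" "eps x X"]
      std_F_swap[of "eps x Z" "eps x X"] std_F_swap[of "eps x Z" "eps x Y"]
      std_Psim_swap(1)[of "nrm x" "bet X Y" "eps x Z"] std_Psim_swap(1)[of "nrm x" "bet Y Z" "eps x X"]
    by (simp add: algebra_simps)
qed

end

section \<open>Tensor fields on manifolds and their pullbacks\<close>

lemma chart_facts:
  assumes M: "smooth_manifold M" and c: "c \<in> atlas M"
  shows "open (cimg c)" "inj_on (cmap c) (cdom c)" "openin (mtop M) (cdom c)" "cdom c \<subseteq> topspace (mtop M)"
    "homeomorphic_map (subtopology (mtop M) (cdom c)) (top_of_set (cimg c)) (cmap c)"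
proof -
  show 1: "open (cimg c)" "openin (mtop M) (cdom c)"
    "homeomorphic_map (subtopology (mtop M) (cdom c)) (top_of_set (cimg c)) (cmap c)"
    using M c unfolding smooth_manifold_def by blast+
  show "cdom c \<subseteq> topspace (mtop M)" using 1(2) by (rule openin_subset)
  then have "topspace (subtopology (mtop M) (cdom c)) = cdom c" by (simp add: Int_absorb1)
  then show "inj_on (cmap c) (cdom c)" using homeomorphic_imp_injective_map[OF 1(3)] by simp
qed

lemma cinv_cmap: "smooth_manifold M \<Longrightarrow> c \<in> atlas M \<Longrightarrow> p \<in> cdom c \<Longrightarrow> cinv c (cmap c p) = p"
  using chart_facts(2) by (metis inv_into_f_f)

lemma cinv_in: "x \<in> cimg c \<Longrightarrow> cinv c x \<in> cdom c"
  by (rule inv_into_into)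

lemma cmap_cinv: "x \<in> cimg c \<Longrightarrow> cmap c (cinv c x) = x"
  by (rule f_inv_into_f)

lemma open_chart_image:
  assumes M: "smooth_manifold M" and c: "c \<in> atlas M" and A: "openin (mtop M) A"
  shows "open (cmap c ` (cdom c \<inter> A))"
proof -
  note f = chart_facts[OF M c]
  have "openin (subtopology (mtop M) (cdom c)) (cdom c \<inter> A)"
    using A by (metis openin_subtopology_Int Int_commute)
  then have "openin (top_of_set (cimg c)) (cmap c ` (cdom c \<inter> A))"
    using homeomorphic_imp_open_map[OF f(5)] by (simp add: open_map_def)
  then show ?thesis using f(1) by (simp add: openin_open_eq)
qed

definition trans_map :: "('a, 'v) chart \<Rightarrow> ('a, 'v) chart \<Rightarrow> 'v \<Rightarrow> 'v" where
  "trans_map c d = cmap d \<circ> cinv c"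

definition overlap :: "('a, 'v) chart \<Rightarrow> ('a, 'v) chart \<Rightarrow> 'v set" where
  "overlap c d = cmap c ` (cdom c \<inter> cdom d)"

lemma open_overlap: "smooth_manifold M \<Longrightarrow> c \<in> atlas M \<Longrightarrow> d \<in> atlas M \<Longrightarrow> open (overlap c d)"
  unfolding overlap_def by (rule open_chart_image[OF _ _ chart_facts(3)])

lemma smooth_trans_map: "smooth_manifold M \<Longrightarrow> c \<in> atlas M \<Longrightarrow> d \<in> atlas M \<Longrightarrow> smooth_on (overlap c d) (trans_map c d)"
  unfolding smooth_manifold_def overlap_def trans_map_def by blast

lemma trans_map_cmap:
  "smooth_manifold M \<Longrightarrow> c \<in> atlas M \<Longrightarrow> p \<in> cdom c \<Longrightarrow> trans_map c d (cmap c p) = cmap d p"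
  by (simp add: trans_map_def cinv_cmap)

text \<open>The derivative of the reverse transition map is a right inverse, by the chain
  rule.\<close>

lemma trans_map_surj:
  assumes M: "smooth_manifold M" and c: "c \<in> atlas M" "d \<in> atlas M" and x: "x \<in> overlap c d"
  shows "surj (frechet_derivative (trans_map c d) (at x))"
proof -
  obtain p where p: "p \<in> cdom c" "p \<in> cdom d" "x = cmap c p" using x by (auto simp: overlap_def)
  have tx: "trans_map c d x = cmap d p" using trans_map_cmap[OF M c(1) p(1)] p(3) by simp
  have x': "trans_map c d x \<in> overlap d c" using tx p by (auto simp: overlap_def)
  have d1: "trans_map c d differentiable (at x)"
    by (rule smooth_on_differentiable[OF smooth_trans_map[OF M c] x])
  have tx2: "trans_map d c (trans_map c d x) = x"
    unfolding tx trans_map_cmap[OF M c(2) p(2)] by (simp add: p(3))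
  have d2: "trans_map d c differentiable (at (trans_map c d x))"
    by (rule smooth_on_differentiable[OF smooth_trans_map[OF M c(2,1)] x'])
  have d1': "trans_map c d differentiable (at (trans_map d c (trans_map c d x)))" unfolding tx2 by (rule d1)
  have "v = frechet_derivative (trans_map c d) (at x) (frechet_derivative (trans_map d c) (at (trans_map c d x)) v)" for v
  proof -
    have "frechet_derivative (\<lambda>z. trans_map c d (trans_map d c z)) (at (trans_map c d x)) = frechet_derivative (\<lambda>z. z) (at (trans_map c d x))"
    proof (rule frechet_derivative_cong[OF open_overlap[OF M c(2,1)] x'])
      fix z assume "z \<in> overlap d c"
      then obtain q where q: "q \<in> cdom d" "q \<in> cdom c" "z = cmap d q" by (auto simp: overlap_def)
      show "trans_map c d (trans_map d c z) = z"
        unfolding q(3) trans_map_cmap[OF M c(2) q(1)] by (rule trans_map_cmap[OF M c(1) q(2)])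
    qed
    then show ?thesis
      using frechet_chain[OF d2 d1', of v] unfolding tx2 by simp
  qed
  then show ?thesis by (rule surjI[OF sym])
qed

text \<open>Variable entries are replaced by constant basis vectors one at a time, from the right;
  \<open>cs\<close> collects the entries already made constant.\<close>

lemma smooth_on_tensor_eval:
  fixes a :: "'v::euclidean_space \<Rightarrow> ('v, real) covector" and h :: "'u::real_normed_vector \<Rightarrow> 'v"
  assumes U: "open U" and V: "open V" "h ` U \<subseteq> V" and h: "smooth_on U h"
    and lin: "\<And>y. y \<in> V \<Longrightarrow> multilin k (a y)" and sm: "\<And>vs. length vs = k \<Longrightarrow> smooth_on V (\<lambda>y. a y vs)"
    and ws: "\<And>w. w \<in> set ws \<Longrightarrow> smooth_on U w" and len: "length ws + length cs = k"
  shows "smooth_on U (\<lambda>x. a (h x) (map (\<lambda>w. w x) ws @ cs))"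
  using ws len
proof (induction ws arbitrary: cs rule: rev_induct)
  case Nil
  have "smooth_on U (\<lambda>x. a (h x) cs)"
    by (rule smooth_on_compose[OF U V h sm]) (use Nil(2) in simp)
  then show ?case by simp
next
  case (snoc w ws)
  have "smooth_on U (\<lambda>x. \<Sum>b\<in>Basis. (w x \<bullet> b) * a (h x) (map (\<lambda>w. w x) ws @ b # cs))"
  proof (intro smooth_on_sum[OF U] smooth_on_mult[OF U] smooth_on_inner[OF U] smooth_on_const)
    show "smooth_on U w" using snoc.prems(1) by simp
    show "smooth_on U (\<lambda>x. a (h x) (map (\<lambda>w. w x) ws @ b # cs))" for b
      by (rule snoc.IH) (use snoc.prems in simp_all)
  qed
  moreover have "(\<Sum>b\<in>Basis. (w x \<bullet> b) * a (h x) (map (\<lambda>w. w x) ws @ b # cs)) = a (h x) (map (\<lambda>w. w x) (ws @ [w]) @ cs)"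
    if "x \<in> U" for x
  proof -
    have "multilin k (a (h x))" using lin V(2) that by blast
    from multilin_append[OF this, of "map (\<lambda>w. w x) ws" cs]
    have "linear (\<lambda>u. a (h x) (map (\<lambda>w. w x) ws @ u # cs))" using snoc.prems(2) by simp
    from linear_expand[OF this, of "w x"] show ?thesis by simp
  qed
  ultimately show ?case by (rule smooth_on_cong[OF U, rotated])
qed

text \<open>No symmetry is imposed, so forms and the metric share one theory of pullback; only lists
  of length k are constrained.\<close>

definition tensor_field :: "('a, 'v::euclidean_space) manifold \<Rightarrow> nat \<Rightarrow> ('a, 'v) mform \<Rightarrow> bool" where
  "tensor_field M k \<alpha> \<longleftrightarrow>
     (\<forall>c\<in>atlas M. (\<forall>x\<in>cimg c. multilin k (\<alpha> c x)) \<and> (\<forall>vs. length vs = k \<longrightarrow> smooth_on (cimg c) (\<lambda>x. \<alpha> c x vs))) \<and>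
     (\<forall>c\<in>atlas M. \<forall>d\<in>atlas M. \<forall>p\<in>cdom c \<inter> cdom d. \<forall>vs. length vs = k \<longrightarrow>
        \<alpha> c (cmap c p) vs = \<alpha> d (cmap d p) (map (frechet_derivative (trans_map c d) (at (cmap c p))) vs))"

lemma tensor_fieldD:
  assumes "tensor_field M k \<alpha>" "c \<in> atlas M"
  shows "x \<in> cimg c \<Longrightarrow> multilin k (\<alpha> c x)" "length vs = k \<Longrightarrow> smooth_on (cimg c) (\<lambda>x. \<alpha> c x vs)"
    "d \<in> atlas M \<Longrightarrow> p \<in> cdom c \<Longrightarrow> p \<in> cdom d \<Longrightarrow> length vs = k \<Longrightarrow>
      \<alpha> c (cmap c p) vs = \<alpha> d (cmap d p) (map (frechet_derivative (trans_map c d) (at (cmap c p))) vs)"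
  using assms unfolding tensor_field_def by blast+

lemma kform_imp_tensor_field: "kform M k \<alpha> \<Longrightarrow> tensor_field M k \<alpha>"
  unfolding kform_def tensor_field_def smooth_lform_on_def trans_map_def
  by (blast intro: alternating_imp_multilin)

lemma kformI:
  assumes "tensor_field M k \<alpha>" "\<And>c x. c \<in> atlas M \<Longrightarrow> x \<in> cimg c \<Longrightarrow> alternating k (\<alpha> c x)" 
    and M: "smooth_manifold M"
  shows "kform M k \<alpha>"
  unfolding kform_def smooth_lform_on_def
proof (intro conjI ballI allI)
  fix c x assume "c \<in> atlas M" "x \<in> cimg c"
  then show "alternating k (\<alpha> c x)" by (rule assms(2))
next
  fix c vs assume c: "c \<in> atlas M"
  show "smooth_on (cimg c) (\<lambda>x. \<alpha> c x vs)"
  proof (cases "length vs = k")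
    case True
    then show ?thesis by (rule tensor_fieldD(2)[OF assms(1) c])
  next
    case False
    then have "0 = \<alpha> c x vs" if "x \<in> cimg c" for x using alternating_length[OF assms(2)[OF c that]] by simp
    then show ?thesis by (rule smooth_on_cong[OF chart_facts(1)[OF M c]]) simp_all
  qed
next
  fix c c' p vs assume c: "c \<in> atlas M" "c' \<in> atlas M" and p: "p \<in> cdom c \<inter> cdom c'"
  then have i: "cmap c p \<in> cimg c" "cmap c' p \<in> cimg c'" by auto
  show "\<alpha> c (cmap c p) vs = \<alpha> c' (cmap c' p) (map (frechet_derivative (cmap c' \<circ> cinv c) (at (cmap c p))) vs)"
  proof (cases "length vs = k")
    case True
    then show ?thesis using tensor_fieldD(3)[OF assms(1) c(1,2)] p by (simp add: trans_map_def)
  next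
    case False
    then show ?thesis
      using alternating_length[OF assms(2)[OF c(1) i(1)]] alternating_length[OF assms(2)[OF c(2) i(2)]] by simp
  qed
qed

text \<open>A value needs some chart of the target around the image point, and one is chosen
  separately for every point; \<open>pull_eq\<close> frees the result from this choice.\<close>

definition pull :: "('a, 'v::euclidean_space) manifold \<Rightarrow> ('b \<Rightarrow> 'a) \<Rightarrow> ('a, 'v) mform \<Rightarrow> ('b, 'w::euclidean_space) mform" where
  "pull M f \<alpha> c x vs =
     (let d = SOME d. d \<in> atlas M \<and> f (cinv c x) \<in> cdom d
      in \<alpha> d (local_rep f c d x) (map (frechet_derivative (local_rep f c d) (at x)) vs))"

section \<open>Coordinate representatives of an immersion and pulled-back tensors\<close>

locale immersed =
  fixes N :: "('b, 'w::euclidean_space) manifold" and M :: "('a, 'v::euclidean_space) manifold" and f :: "'b \<Rightarrow> 'a"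
  assumes M: "smooth_manifold M" and N: "smooth_manifold N" and imm: "immersion N M f"
begin

lemma open_local_rep_dom:
  assumes c: "c \<in> atlas N" "d \<in> atlas M"
  shows "open (local_rep_dom f c d)"
proof -
  have "continuous_map (mtop N) (mtop M) f" using imm by (simp add: immersion_def)
  then have "openin (mtop N) {p \<in> topspace (mtop N). f p \<in> cdom d}"
    by (rule openin_continuous_map_preimage) (rule chart_facts(3)[OF M c(2)])
  then have "open (cmap c ` (cdom c \<inter> {p \<in> topspace (mtop N). f p \<in> cdom d}))"
    by (rule open_chart_image[OF N c(1)])
  moreover have "cmap c ` (cdom c \<inter> {p \<in> topspace (mtop N). f p \<in> cdom d}) = local_rep_dom f c d"
  proof (intro equalityI subsetI)
    fix x assume "x \<in> cmap c ` (cdom c \<inter> {p \<in> topspace (mtop N). f p \<in> cdom d})"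
    then show "x \<in> local_rep_dom f c d" by (auto simp: local_rep_dom_def cinv_cmap[OF N c(1)])
  next
    fix x assume x: "x \<in> local_rep_dom f c d"
    then have "x \<in> cimg c" "f (cinv c x) \<in> cdom d" by (simp_all add: local_rep_dom_def)
    then have "cinv c x \<in> cdom c" "cmap c (cinv c x) = x" "f (cinv c x) \<in> cdom d"
      using cinv_in[of x c] cmap_cinv[of x c] by blast+
    then show "x \<in> cmap c ` (cdom c \<inter> {p \<in> topspace (mtop N). f p \<in> cdom d})"
      using chart_facts(4)[OF N c(1)] by (intro image_eqI[of _ _ "cinv c x"]) auto
  qed
  ultimately show ?thesis by simp
qed

lemma local_rep_in: "x \<in> local_rep_dom f c d \<Longrightarrow> local_rep f c d x \<in> cimg d"
  by (auto simp: local_rep_dom_def local_rep_def)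

lemma smooth_local_rep:
  "c \<in> atlas N \<Longrightarrow> d \<in> atlas M \<Longrightarrow> smooth_on (local_rep_dom f c d) (local_rep f c d)"
  using imm unfolding immersion_def by blast

lemma inj_local_rep:
  "c \<in> atlas N \<Longrightarrow> d \<in> atlas M \<Longrightarrow> x \<in> local_rep_dom f c d \<Longrightarrow> inj (frechet_derivative (local_rep f c d) (at x))"
  using imm unfolding immersion_def by blast

lemma target_chart:
  assumes "c \<in> atlas N" "x \<in> cimg c"
  obtains d where "d \<in> atlas M" "x \<in> local_rep_dom f c d"
proof -
  have "cinv c x \<in> topspace (mtop N)" using chart_facts(4)[OF N assms(1)] cinv_in[OF assms(2)] by blast
  then have "f (cinv c x) \<in> topspace (mtop M)"
    using imm unfolding immersion_def by (meson continuous_map_image_subset_topspace image_subset_iff)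
  then obtain d where "d \<in> atlas M" "f (cinv c x) \<in> cdom d" using M unfolding smooth_manifold_def by blast
  then show thesis using that assms(2) by (simp add: local_rep_dom_def)
qed

lemma local_rep_target_change:
  assumes c: "c \<in> atlas N" and d: "d \<in> atlas M" "d' \<in> atlas M" and x: "x \<in> local_rep_dom f c d" "x \<in> local_rep_dom f c d'"
  shows "frechet_derivative (local_rep f c d') (at x) v =
    frechet_derivative (trans_map d d') (at (local_rep f c d x)) (frechet_derivative (local_rep f c d) (at x) v)"
    "local_rep f c d x = cmap d (f (cinv c x))"
proof -
  show eq: "local_rep f c d x = cmap d (f (cinv c x))" by (simp add: local_rep_def)
  have o: "open (local_rep_dom f c d \<inter> local_rep_dom f c d')" using open_local_rep_dom c d by blast
  have "frechet_derivative (local_rep f c d') (at x) = frechet_derivative (\<lambda>z. trans_map d d' (local_rep f c d z)) (at x)"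
  proof (rule frechet_derivative_cong[OF o])
    fix z assume "z \<in> local_rep_dom f c d \<inter> local_rep_dom f c d'"
    then have "f (cinv c z) \<in> cdom d" by (auto simp: local_rep_dom_def)
    then show "local_rep f c d' z = trans_map d d' (local_rep f c d z)"
      using trans_map_cmap[OF M d(1)] by (simp add: local_rep_def)
  qed (use x in simp)
  moreover have "local_rep f c d x \<in> overlap d d'"
    using x by (auto simp: eq overlap_def local_rep_dom_def)
  ultimately show "frechet_derivative (local_rep f c d') (at x) v =
    frechet_derivative (trans_map d d') (at (local_rep f c d x)) (frechet_derivative (local_rep f c d) (at x) v)"
    using frechet_chain[OF smooth_on_differentiable[OF smooth_local_rep[OF c d(1)] x(1)]
        smooth_on_differentiable[OF smooth_trans_map[OF M d]], of v] by simp
qed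

lemma local_rep_source_change:
  assumes c: "c \<in> atlas N" "c' \<in> atlas N" and d: "d \<in> atlas M" and p: "p \<in> cdom c" "p \<in> cdom c'" "f p \<in> cdom d"
  shows "frechet_derivative (local_rep f c d) (at (cmap c p)) v =
    frechet_derivative (local_rep f c' d) (at (cmap c' p)) (frechet_derivative (trans_map c c') (at (cmap c p)) v)"
proof -
  define x where "x = cmap c p"
  have x: "x \<in> local_rep_dom f c d" "x \<in> overlap c c'"
    using p by (auto simp: x_def local_rep_dom_def overlap_def cinv_cmap[OF N c(1)])
  have tx: "trans_map c c' x = cmap c' p" unfolding x_def by (rule trans_map_cmap[OF N c(1) p(1)])
  have x': "trans_map c c' x \<in> local_rep_dom f c' d"
    using p by (auto simp: tx local_rep_dom_def cinv_cmap[OF N c(2)])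
  have o: "open (local_rep_dom f c d \<inter> overlap c c')"
    using open_local_rep_dom[OF c(1) d] open_overlap[OF N c] by blast
  have "frechet_derivative (local_rep f c d) (at x) = frechet_derivative (\<lambda>z. local_rep f c' d (trans_map c c' z)) (at x)"
  proof (rule frechet_derivative_cong[OF o])
    fix z assume "z \<in> local_rep_dom f c d \<inter> overlap c c'"
    then obtain q where q: "q \<in> cdom c" "q \<in> cdom c'" "z = cmap c q" by (auto simp: overlap_def)
    show "local_rep f c d z = local_rep f c' d (trans_map c c' z)"
      unfolding q(3) trans_map_cmap[OF N c(1) q(1)]
      by (simp add: local_rep_def cinv_cmap[OF N c(1) q(1)] cinv_cmap[OF N c(2) q(2)])
  qed (use x in simp)
  then show ?thesis
    using frechet_chain[OF smooth_on_differentiable[OF smooth_trans_map[OF N c] x(2)]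
        smooth_on_differentiable[OF smooth_local_rep[OF c(2) d] x'], of v]
    unfolding tx unfolding x_def by simp
qed

text \<open>Two target charts differ by a transition map whose derivative appears both in the chain
  rule for the representative and in the transformation law of \<alpha>.\<close>

lemma pull_eq:
  assumes \<alpha>: "tensor_field M k \<alpha>" and c: "c \<in> atlas N" "d \<in> atlas M" and x: "x \<in> local_rep_dom f c d" and vs: "length vs = k"
  shows "pull M f \<alpha> c x vs = \<alpha> d (local_rep f c d x) (map (frechet_derivative (local_rep f c d) (at x)) vs)"
proof -
  define d' where "d' = (SOME d. d \<in> atlas M \<and> f (cinv c x) \<in> cdom d)"
  have fx: "f (cinv c x) \<in> cdom d" using x by (simp add: local_rep_dom_def)
  have "d' \<in> atlas M \<and> f (cinv c x) \<in> cdom d'"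
    unfolding d'_def by (rule someI[of _ d]) (use c fx in simp)
  then have d': "d' \<in> atlas M" "f (cinv c x) \<in> cdom d'" by auto
  have x': "x \<in> local_rep_dom f c d'" using d' x by (simp add: local_rep_dom_def)
  note lc = local_rep_target_change[OF c(1) d'(1) c(2) x' x]
  have "pull M f \<alpha> c x vs = \<alpha> d' (local_rep f c d' x) (map (frechet_derivative (local_rep f c d') (at x)) vs)"
    by (simp add: pull_def Let_def flip: d'_def)
  also have "\<dots> = \<alpha> d (cmap d (f (cinv c x))) (map (frechet_derivative (trans_map d' d) (at (local_rep f c d' x)))
      (map (frechet_derivative (local_rep f c d') (at x)) vs))"
    unfolding lc(2) by (rule tensor_fieldD(3)[OF \<alpha> d'(1) c(2) d'(2) fx]) (use vs in simp)
  also have "\<dots> = \<alpha> d (local_rep f c d x) (map (frechet_derivative (local_rep f c d) (at x)) vs)"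
    by (simp add: o_def flip: lc(1)) (simp add: local_rep_target_change(2)[OF c(1) c(2) c(2) x x])
  finally show ?thesis .
qed

lemma pull_tensor_field:
  assumes \<alpha>: "tensor_field M k \<alpha>"
  shows "tensor_field N k (pull M f \<alpha>)"
  unfolding tensor_field_def
proof (intro conjI ballI allI impI)
  fix c x assume c: "c \<in> atlas N" "x \<in> cimg c"
  obtain d where d: "d \<in> atlas M" "x \<in> local_rep_dom f c d" using target_chart[OF c] .
  let ?L = "frechet_derivative (local_rep f c d) (at x)"
  have L: "linear ?L" by (rule smooth_on_linear_frechet[OF smooth_local_rep[OF c(1) d(1)] d(2)])
  show "multilin k (pull M f \<alpha> c x)"
    unfolding multilin_def
  proof (intro allI impI)
    fix vs :: "'w list" and i assume *: "length vs = k \<and> i < k"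
    have "linear (\<lambda>u. \<alpha> d (local_rep f c d x) ((map ?L vs)[i := u]))"
      by (rule multilinD[OF tensor_fieldD(1)[OF \<alpha> d(1) local_rep_in[OF d(2)]]]) (use * in simp_all)
    from linear_compose[OF L this]
    show "linear (\<lambda>u. pull M f \<alpha> c x (vs[i := u]))"
      using * by (simp add: pull_eq[OF \<alpha> c(1) d] o_def map_update)
  qed
next
  fix c vs assume c: "c \<in> atlas N" and vs: "length (vs :: 'w list) = k"
  show "smooth_on (cimg c) (\<lambda>x. pull M f \<alpha> c x vs)"
  \<comment> \<open>The selected chart of M may jump from point to point, so smoothness is shown
    near each point in one fixed chart.\<close>
  proof (rule smooth_on_local[OF chart_facts(1)[OF N c]])
    fix x assume "x \<in> cimg c"
    then obtain d where d: "d \<in> atlas M" "x \<in> local_rep_dom f c d" using target_chart[OF c] by blast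
    let ?U = "local_rep_dom f c d" and ?h = "local_rep f c d"
    have o: "open ?U" by (rule open_local_rep_dom[OF c d(1)])
    have "smooth_on ?U (\<lambda>z. \<alpha> d (?h z) (map (\<lambda>w. w z) (map (\<lambda>v z. frechet_derivative ?h (at z) v) vs) @ []))"
    proof (rule smooth_on_tensor_eval[OF o chart_facts(1)[OF M d(1)] _ smooth_local_rep[OF c d(1)]])
      show "?h ` ?U \<subseteq> cimg d" by (rule image_subsetI) (rule local_rep_in)
      show "multilin k (\<alpha> d y)" if "y \<in> cimg d" for y by (rule tensor_fieldD(1)[OF \<alpha> d(1) that])
      show "smooth_on (cimg d) (\<lambda>y. \<alpha> d y us)" if "length us = k" for us by (rule tensor_fieldD(2)[OF \<alpha> d(1) that])
      show "smooth_on ?U w" if "w \<in> set (map (\<lambda>v z. frechet_derivative ?h (at z) v) vs)" for w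
        using that smooth_on_frechet[OF smooth_local_rep[OF c d(1)]] by auto
    qed (use vs in simp)
    then have "smooth_on ?U (\<lambda>z. pull M f \<alpha> c z vs)"
      by (rule smooth_on_cong[OF o, rotated]) (simp add: pull_eq[OF \<alpha> c d(1) _ vs] o_def)
    then show "\<exists>V. open V \<and> x \<in> V \<and> smooth_on V (\<lambda>x. pull M f \<alpha> c x vs)" using o d(2) by blast
  qed
next
  fix c c' p vs assume c: "c \<in> atlas N" "c' \<in> atlas N" and p: "p \<in> cdom c \<inter> cdom c'" and vs: "length (vs :: 'w list) = k"
  have pc: "cmap c p \<in> cimg c" using p by blast
  obtain d where d: "d \<in> atlas M" "cmap c p \<in> local_rep_dom f c d" using target_chart[OF c(1) pc] .
  have fp: "f p \<in> cdom d" using d(2) p by (simp add: local_rep_dom_def cinv_cmap[OF N c(1)])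
  have d': "cmap c' p \<in> local_rep_dom f c' d" using p fp by (simp add: local_rep_dom_def cinv_cmap[OF N c(2)])
  have v: "local_rep f c d (cmap c p) = local_rep f c' d (cmap c' p)"
    using p by (simp add: local_rep_def cinv_cmap[OF N c(1)] cinv_cmap[OF N c(2)])
  show "pull M f \<alpha> c (cmap c p) vs = pull M f \<alpha> c' (cmap c' p) (map (frechet_derivative (trans_map c c') (at (cmap c p))) vs)"
    using p ext[of "frechet_derivative (local_rep f c d) (at (cmap c p))", OF local_rep_source_change[OF c d(1) _ _ fp]]
    by (simp add: pull_eq[OF \<alpha> c(1) d vs] pull_eq[OF \<alpha> c(2) d(1) d'] vs v o_def)
qed

text \<open>Lists of every length are concerned, which \<open>pull_eq\<close> does not cover; the
  chosen chart is therefore used directly.\<close>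

lemma pull_alternating:
  assumes \<alpha>: "kform M k \<alpha>" and c: "c \<in> atlas N" "x \<in> cimg c"
  shows "alternating k (pull M f \<alpha> c x)"
proof -
  define d where "d = (SOME d. d \<in> atlas M \<and> f (cinv c x) \<in> cdom d)"
  have "\<exists>d. d \<in> atlas M \<and> f (cinv c x) \<in> cdom d"
    using target_chart[OF c] unfolding local_rep_dom_def by blast
  from someI_ex[OF this] have d: "d \<in> atlas M" "f (cinv c x) \<in> cdom d" by (simp_all add: d_def)
  then have x: "x \<in> local_rep_dom f c d" using c by (simp add: local_rep_dom_def)
  have "alternating k (\<alpha> d (local_rep f c d x))"
    using \<alpha> d(1) local_rep_in[OF x] unfolding kform_def smooth_lform_on_def by blast
  from alternating_pull[OF smooth_on_linear_frechet[OF smooth_local_rep[OF c(1) d(1)] x] this]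
  show ?thesis by (simp add: pull_def[abs_def] Let_def flip: d_def)
qed

lemma pull_kform: "kform M k \<alpha> \<Longrightarrow> kform N k (pull M f \<alpha>)"
  using kformI[OF pull_tensor_field[OF kform_imp_tensor_field] pull_alternating N] .

end

section \<open>The induced SU(2)-structure\<close>

lemma smooth_lform_subset: "smooth_lform_on k V a \<Longrightarrow> W \<subseteq> V \<Longrightarrow> smooth_lform_on k W a"
  unfolding smooth_lform_on_def by (meson smooth_on_subset subsetD)

lemma wedge_map: "wedge a b (map L vs) = wedge (\<lambda>vs. a (map L vs)) (\<lambda>vs. b (map L vs)) vs"
  by (simp add: wedge_def nths_map)

lemma wedge_scale:
  fixes a b :: "('v, real) covector"
  shows "wedge (\<lambda>vs. r * a vs) (\<lambda>vs. s * b vs) vs = r * s * wedge a b vs"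
  by (simp add: wedge_def sum_distrib_left mult_ac)

lemma smooth_on_wedge:
  assumes "open S" "\<And>vs. smooth_on S (\<lambda>x. a x vs)" "\<And>vs. smooth_on S (\<lambda>x. b x vs)"
  shows "smooth_on S (\<lambda>x. wedge (a x) (b x) vs :: real)"
  unfolding wedge_def by (intro smooth_on_sum smooth_on_mult assms smooth_on_const)

lemma kformD:
  assumes "kform M k \<alpha>" "c \<in> atlas M"
  shows "smooth_lform_on k (cimg c) (\<alpha> c)" "x \<in> cimg c \<Longrightarrow> alternating k (\<alpha> c x)"
    "smooth_on (cimg c) (\<lambda>x. \<alpha> c x vs)"
    "d \<in> atlas M \<Longrightarrow> p \<in> cdom c \<Longrightarrow> p \<in> cdom d \<Longrightarrow>
      \<alpha> c (cmap c p) vs = \<alpha> d (cmap d p) (map (frechet_derivative (trans_map c d) (at (cmap c p))) vs)"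
  using assms unfolding kform_def smooth_lform_on_def trans_map_def by blast+

locale nk_hypersurface = immersed N M f
  for N :: "('b, real^5) manifold" and M :: "('a, real^6) manifold" and f :: "'b \<Rightarrow> 'a" +
  fixes F \<Psi>p \<Psi>m :: "('a, real^6) mform" and g :: "('a, real^6) mmetric" and \<mu> :: "('b, real^5) mform"
  assumes nk: "nearly_kaehler M F \<Psi>p \<Psi>m" and met: "su3_metric M F \<Psi>p \<Psi>m g"
    and ori: "orientation_form N \<mu>" and tg: "totally_geodesic N M g f"
begin

definition om1 :: "('b, real^5) mform" where "om1 = pull M f F"
definition Pp :: "('b, real^5) mform" where "Pp = pull M f \<Psi>p"
definition Pm :: "('b, real^5) mform" where "Pm = pull M f \<Psi>m"

definition gt :: "('a, real^6) mform" where
  "gt d y vs = (if length vs = 2 then g d y (vs ! 0) (vs ! 1) else 0)"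

definition G :: "('b, real^5) mform" where "G = pull M f gt"

definition zeta :: "('b, real^5) chart \<Rightarrow> real^5 \<Rightarrow> real^5" where
  "zeta c x = (THE z. \<forall>vs. \<mu> c x (z # vs) = wedge (om1 c x) (om1 c x) vs)"

text \<open>\<open>G\<close> gives a squared length, hence the exponent -1/2. The factor is
  positive, so the sign selected by the orientation is kept.\<close>

definition xi :: "('b, real^5) chart \<Rightarrow> real^5 \<Rightarrow> real^5" where
  "xi c x = (G c x [zeta c x, zeta c x] powr (-1/2)) *\<^sub>R zeta c x"

definition eta :: "('b, real^5) mform" where
  "eta c x vs = (if length vs = 1 then G c x [xi c x, hd vs] else 0)"

definition om2 :: "('b, real^5) mform" where "om2 c x = interior (xi c x) (Pp c x)"
definition om3 :: "('b, real^5) mform" where "om3 c x = interior (xi c x) (Pm c x)"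

section \<open>The pulled-back forms and metric in an adapted frame\<close>

lemma kforms_M: "kform M 2 F" "kform M 3 \<Psi>p" "kform M 3 \<Psi>m"
  using nk unfolding nearly_kaehler_def su3_structure_def by blast+

lemma tensor_gt: "tensor_field M 2 gt"
proof -
  have rm: "riemannian_metric M g" using met by (simp add: su3_metric_def)
  have rm1: "smooth_on (cimg c) (\<lambda>x. g c x u v)" if "c \<in> atlas M" for c u v
    using rm that unfolding riemannian_metric_def by blast
  have rm2: "g c (cmap c p) u v = g d (cmap d p) (frechet_derivative (trans_map c d) (at (cmap c p)) u)
      (frechet_derivative (trans_map c d) (at (cmap c p)) v)" if "c \<in> atlas M" "d \<in> atlas M" "p \<in> cdom c \<inter> cdom d" for c d p u v
    using rm that unfolding riemannian_metric_def trans_map_def by blast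
  show ?thesis
    unfolding tensor_field_def
  proof (intro conjI ballI allI impI)
    fix c x assume "c \<in> atlas M" "x \<in> cimg c"
    then have b: "bilinear (g c x)" using rm unfolding riemannian_metric_def by blast
    show "multilin 2 (gt c x)"
      unfolding multilin_def
    proof (intro allI impI)
      fix vs :: "(real^6) list" and i :: nat assume "length vs = 2 \<and> i < 2"
      then obtain u v where vs: "vs = [u, v]" and i: "i = 0 \<or> i = 1"
        by (auto simp: numeral_2_eq_2 length_Suc_conv less_Suc_eq)
      then show "linear (\<lambda>u. gt c x (vs[i := u]))"
        using b by (auto simp: vs gt_def bilinear_def)
    qed
  next
    fix c and vs :: "(real^6) list" assume "c \<in> atlas M" "length vs = 2"
    then show "smooth_on (cimg c) (\<lambda>x. gt c x vs)"
      using rm1[of c "vs ! 0" "vs ! 1"] by (simp add: gt_def)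
  next
    fix c d p and vs :: "(real^6) list" assume "c \<in> atlas M" "d \<in> atlas M" "p \<in> cdom c \<inter> cdom d" "length vs = 2"
    then show "gt c (cmap c p) vs = gt d (cmap d p) (map (frechet_derivative (trans_map c d) (at (cmap c p))) vs)"
      using rm2[of c d p "vs ! 0" "vs ! 1"] by (simp add: gt_def)
  qed
qed

lemma tensor_G: "tensor_field N 2 G"
  unfolding G_def by (rule pull_tensor_field[OF tensor_gt])

lemma kform_om1: "kform N 2 om1" unfolding om1_def by (rule pull_kform[OF kforms_M(1)])
lemma kform_Pp: "kform N 3 Pp" unfolding Pp_def by (rule pull_kform[OF kforms_M(2)])
lemma kform_Pm: "kform N 3 Pm" unfolding Pm_def by (rule pull_kform[OF kforms_M(3)])

lemma kform_mu: "kform N 5 \<mu>"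
  using ori unfolding orientation_form_def by simp

lemma linear_G:
  assumes "c \<in> atlas N" "x \<in> cimg c"
  shows "linear (\<lambda>X. G c x [X, Y])" "linear (\<lambda>Y. G c x [X, Y])"
  using multilin_append[OF tensor_fieldD(1)[OF tensor_G assms], of "[]" "[Y]"]
    multilin_append[OF tensor_fieldD(1)[OF tensor_G assms], of "[X]" "[]"] by simp_all

lemma frame_at:
  assumes c: "c \<in> atlas N" "x \<in> cimg c"
  obtains d V e where "d \<in> atlas M" "x \<in> local_rep_dom f c d" "local_rep f c d x \<in> V"
    "su3_chart V (F d) (\<Psi>p d) (\<Psi>m d) e (g d)"
proof -
  obtain d where d: "d \<in> atlas M" "x \<in> local_rep_dom f c d" using target_chart[OF c] .
  have y: "local_rep f c d x \<in> cimg d" by (rule local_rep_in[OF d(2)])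
  obtain V e where V: "open V" "local_rep f c d x \<in> V" "V \<subseteq> cimg d" "adapted_coframe V (F d) (\<Psi>p d) (\<Psi>m d) e"
    "\<forall>y\<in>V. \<forall>u v. g d y u v = (\<Sum>i=1..6. e i y [u] * e i y [v])"
    using met y d(1) unfolding su3_metric_def by blast
  have dF: "ext_deriv F \<approx>\<^bsub>M\<^esub> 3 \<odot> \<Psi>p" "ext_deriv \<Psi>m \<approx>\<^bsub>M\<^esub> (-2) \<odot> (F \<triangle> F)"
    using nk by (simp_all add: nearly_kaehler_def)
  have "su3_chart V (F d) (\<Psi>p d) (\<Psi>m d) e (g d)"
  proof
    show "smooth_lform_on 2 V (F d)" "smooth_lform_on 3 V (\<Psi>p d)" "smooth_lform_on 3 V (\<Psi>m d)"
      using kformD(1)[OF kforms_M(1) d(1)] kformD(1)[OF kforms_M(2) d(1)] kformD(1)[OF kforms_M(3) d(1)]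
        smooth_lform_subset[OF _ V(3)] by blast+
    fix y vs assume "y \<in> V"
    then have y: "y \<in> cimg d" using V(3) by blast
    have "ext_deriv F d y = (3 \<odot> \<Psi>p) d y" "ext_deriv \<Psi>m d y = ((-2) \<odot> (F \<triangle> F)) d y"
      using dF d(1) y unfolding form_eq_def by blast+
    from this[THEN fun_cong, of vs]
    show "dform (F d) y vs = 3 * \<Psi>p d y vs" "dform (\<Psi>m d) y vs = - 2 * wedge (F d y) (F d y) vs"
      by (simp_all add: ext_deriv_eq_dform scale_form_def wedge_form_def)
  qed (use V in blast)+
  with d V(2) show thesis by (rule that)
qed

lemma pull_frame:
  assumes c: "c \<in> atlas N" "d \<in> atlas M" and z: "z \<in> local_rep_dom f c d" "local_rep f c d z \<in> V"
    and ch: "su3_chart V (F d) (\<Psi>p d) (\<Psi>m d) e (g d)"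
  defines "\<epsilon> \<equiv> \<lambda>X. su3_chart.cf e (local_rep f c d z) (frechet_derivative (local_rep f c d) (at z) X)"
  shows "om1 c z [X, Y] = std_F (\<epsilon> X) (\<epsilon> Y)" "G c z [X, Y] = (\<Sum>a=1..6. \<epsilon> X a * \<epsilon> Y a)"
    "Pp c z [X, Y, Z] = std_Psip (\<epsilon> X) (\<epsilon> Y) (\<epsilon> Z)" "Pm c z [X, Y, Z] = std_Psim (\<epsilon> X) (\<epsilon> Y) (\<epsilon> Z)"
    "\<And>a. a \<in> {1..6} \<Longrightarrow> linear (\<lambda>X. \<epsilon> X a)" "(\<And>a. a \<in> {1..6} \<Longrightarrow> \<epsilon> X a = 0) \<Longrightarrow> X = 0"
proof -
  interpret su3_chart V "F d" "\<Psi>p d" "\<Psi>m d" e "g d" by (rule ch)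
  let ?L = "frechet_derivative (local_rep f c d) (at z)"
  have L: "linear ?L" by (rule smooth_on_linear_frechet[OF smooth_local_rep[OF c] z(1)])
  note t = kforms_M[THEN kform_imp_tensor_field]
  show "om1 c z [X, Y] = std_F (\<epsilon> X) (\<epsilon> Y)"
    unfolding om1_def \<epsilon>_def by (simp add: pull_eq[OF t(1) c z(1)] F_cf[OF z(2)])
  show "Pp c z [X, Y, Z] = std_Psip (\<epsilon> X) (\<epsilon> Y) (\<epsilon> Z)"
    unfolding Pp_def \<epsilon>_def by (simp add: pull_eq[OF t(2) c z(1)] Psi_cf[OF z(2)])
  show "Pm c z [X, Y, Z] = std_Psim (\<epsilon> X) (\<epsilon> Y) (\<epsilon> Z)"
    unfolding Pm_def \<epsilon>_def by (simp add: pull_eq[OF t(3) c z(1)] Psi_cf[OF z(2)])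
  show "G c z [X, Y] = (\<Sum>a=1..6. \<epsilon> X a * \<epsilon> Y a)"
    unfolding G_def \<epsilon>_def by (simp add: pull_eq[OF tensor_gt c z(1)] gt_def metric[OF z(2)] cf_def)
  show "linear (\<lambda>X. \<epsilon> X a)" if "a \<in> {1..6}" for a
    using linear_compose[OF L linear_cf[OF z(2) that]] unfolding \<epsilon>_def o_def .
  show "X = 0" if "\<And>a. a \<in> {1..6} \<Longrightarrow> \<epsilon> X a = 0"
  proof -
    have "?L X = 0" using that unfolding \<epsilon>_def by (rule cf_inj[OF z(2)])
    then show ?thesis using inj_local_rep[OF c z(1)] linear_injective_0[OF L] by blast
  qed
qed

lemma G_positive:
  assumes c: "c \<in> atlas N" "x \<in> cimg c" and X: "X \<noteq> 0"
  shows "G c x [X, X] > 0"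
proof -
  obtain d V e where d: "d \<in> atlas M" "x \<in> local_rep_dom f c d" "local_rep f c d x \<in> V"
    "su3_chart V (F d) (\<Psi>p d) (\<Psi>m d) e (g d)" using frame_at[OF c] .
  note fr = pull_frame[OF c(1) d]
  have "G c x [X, X] \<ge> 0" unfolding fr(2) by (intro sum_nonneg) simp
  moreover have "G c x [X, X] \<noteq> 0"
  proof
    assume "G c x [X, X] = 0"
    then have "X = 0" unfolding fr(2) by (intro fr(6)) (subst (asm) sum_nonneg_eq_0_iff, auto)
    then show False using X by simp
  qed
  ultimately show ?thesis by simp
qed

lemma zeta_unique:
  assumes c: "c \<in> atlas N" "x \<in> cimg c"
    and z: "\<And>vs. \<mu> c x (z # vs) = wedge (om1 c x) (om1 c x) vs"
  shows "zeta c x = z"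
  unfolding zeta_def
proof (rule the_equality)
  fix z' assume z': "\<forall>vs. \<mu> c x (z' # vs) = wedge (om1 c x) (om1 c x) vs"
  have \<mu>: "alternating 5 (\<mu> c x)" by (rule kformD(2)[OF kform_mu c])
  obtain ws where ws: "\<mu> c x ws \<noteq> 0" using ori c unfolding orientation_form_def nowhere_zero_def by blast
  have "\<mu> c x ((z' - z) # vs) = 0" for vs
  proof (cases "length vs = 4")
    case True
    then have "linear (\<lambda>u. \<mu> c x (u # vs))"
      using multilin_append[OF alternating_imp_multilin[OF \<mu>], of "[]" vs] by simp
    then show ?thesis using linear_diff[of "\<lambda>u. \<mu> c x (u # vs)" z' z] z[of vs] spec[OF z', of vs] by simp
  next
    case False
    then show ?thesis by (intro alternating_length[OF \<mu>]) simp
  qed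
  then have "z' - z = 0" using top_form_interior_injective[of "\<mu> c x" ws "z' - z"] \<mu> ws by simp
  then show "z' = z" by simp
qed (use z in blast)

text \<open>A skew form in dimension five has a kernel vector. Normalised, it permits the standard
  coframe of the hyperplane, in which the equation defining \<zeta> is solved by a multiple of that
  vector; uniqueness identifies this solution with \<open>zeta\<close>.\<close>

lemma zeta_exists:
  assumes c: "c \<in> atlas N" "x \<in> cimg c"
  shows "\<And>vs. \<mu> c x (zeta c x # vs) = wedge (om1 c x) (om1 c x) vs" "zeta c x \<noteq> 0" "\<And>Y. om1 c x [zeta c x, Y] = 0"
proof -
  obtain d V e where d: "d \<in> atlas M" "x \<in> local_rep_dom f c d" "local_rep f c d x \<in> V"
    "su3_chart V (F d) (\<Psi>p d) (\<Psi>m d) e (g d)" using frame_at[OF c] .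
  note fr = pull_frame[OF c(1) d]
  define \<epsilon> where "\<epsilon> a X = su3_chart.cf e (local_rep f c d x) (frechet_derivative (local_rep f c d) (at x) X) a" for a X
  have w: "alternating 2 (om1 c x)" by (rule kformD(2)[OF kform_om1 c])
  have "bilinear (\<lambda>X Y. om1 c x [X, Y])"
    using multilin_append[OF alternating_imp_multilin[OF w], of "[]" "[_]"]
      multilin_append[OF alternating_imp_multilin[OF w], of "[_]" "[]"] by (simp add: bilinear_def)
  moreover have "om1 c x [X, Y] = - om1 c x [Y, X]" for X Y
    using alternating_swap[OF w, of "[Y, X]" 0 1] by simp
  ultimately obtain X0 where X0: "X0 \<noteq> 0" "\<And>Y. om1 c x [X0, Y] = 0" using skew_kernel_odd by blast
  have s: "G c x [X0, X0] > 0" by (rule G_positive[OF c X0(1)])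
  \<comment> \<open>The sign of the unit vector is still arbitrary; the factor r found below absorbs
    it.\<close>
  define s where "s = 1 / sqrt (G c x [X0, X0])"
  have s2: "s * s * G c x [X0, X0] = 1" "s \<noteq> 0" using s by (simp_all add: s_def)
  define \<xi> where "\<xi> = s *\<^sub>R X0"
  have om: "om1 c x [\<xi>, Y] = 0" for Y
    using linear_scale[OF multilin_append[OF alternating_imp_multilin[OF w], of "[]" "[Y]", simplified], of s X0] X0(2)
    by (simp add: \<xi>_def)
  have "G c x [\<xi>, \<xi>] = 1"
    using s2 by (simp add: \<xi>_def linear_scale[OF linear_G(1)[OF c]] linear_scale[OF linear_G(2)[OF c]] mult.assoc)
  then have unit: "(\<Sum>a=1..6. \<epsilon> a \<xi> * \<epsilon> a \<xi>) = 1" unfolding fr(2) \<epsilon>_def .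
  have ker: "std_F (\<lambda>a. \<epsilon> a \<xi>) (\<lambda>a. \<epsilon> a Y) = 0" for Y using om unfolding fr(1) \<epsilon>_def .
  have lin: "linear (\<epsilon> a)" if "a \<in> {1..6}" for a using fr(5)[OF that] unfolding \<epsilon>_def .
  obtain p :: "nat \<Rightarrow> real^5 \<Rightarrow> real" where p: "\<And>i. linear (p i)" "p 1 \<xi> = 0" "p 2 \<xi> = 0" "p 3 \<xi> = 0" "p 4 \<xi> = 0" "p 5 \<xi> = 1"
    "\<And>X Y. std_F (\<lambda>a. \<epsilon> a X) (\<lambda>a. \<epsilon> a Y) = p 1 X * p 2 Y - p 2 X * p 1 Y + p 3 X * p 4 Y - p 4 X * p 3 Y"
    "\<And>X Y. (\<Sum>a=1..6. \<epsilon> a X * \<epsilon> a Y) = (\<Sum>i=1..5. p i X * p i Y)"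
    by (rule hyperplane_coframe[of \<epsilon> \<xi>, OF lin unit ker]) (assumption, rule that)
  have inj: "X = 0" if "\<forall>i\<in>{1..5}. p i X = 0" for X
  proof -
    have "G c x [X, X] = 0" unfolding fr(2) using p(8)[of X X] that by (simp add: \<epsilon>_def)
    then show ?thesis using G_positive[OF c, of X] by fastforce
  qed
  \<comment> \<open>The slots other than \<open>om1\<close> are filled with the model forms
    determined by p, since \<xi> in its final normalisation is not yet available.\<close>
  have co: "su2_coframe p (\<lambda>vs. p 5 (hd vs)) (om1 c x)
      (\<lambda>vs. p 1 (vs ! 0) * p 3 (vs ! 1) - p 3 (vs ! 0) * p 1 (vs ! 1) - p 2 (vs ! 0) * p 4 (vs ! 1) + p 4 (vs ! 0) * p 2 (vs ! 1))
      (\<lambda>vs. p 1 (vs ! 0) * p 4 (vs ! 1) - p 4 (vs ! 0) * p 1 (vs ! 1) + p 2 (vs ! 0) * p 3 (vs ! 1) - p 3 (vs ! 0) * p 2 (vs ! 1))"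
    unfolding su2_coframe_def using p(1) inj p(7) unfolding fr(1) \<epsilon>_def by simp
  obtain ws where ws: "\<mu> c x ws \<noteq> 0" using ori c unfolding orientation_form_def nowhere_zero_def by blast
  obtain r where r: "r \<noteq> 0" "\<And>vs. \<mu> c x ((r *\<^sub>R \<xi>) # vs) = wedge (om1 c x) (om1 c x) vs"
    by (rule top_form_interior_onto[OF co w kformD(2)[OF kform_mu c] ws p(2-6)]) (rule that)
  have z: "zeta c x = r *\<^sub>R \<xi>" by (rule zeta_unique[OF c r(2)])
  show "\<mu> c x (zeta c x # vs) = wedge (om1 c x) (om1 c x) vs" for vs unfolding z by (rule r(2))
  show "zeta c x \<noteq> 0" using r(1) s2(2) X0(1) by (simp add: z \<xi>_def)
  show "om1 c x [zeta c x, Y] = 0" for Y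
    using linear_scale[OF multilin_append[OF alternating_imp_multilin[OF w], of "[]" "[Y]", simplified], of r \<xi>] om
    by (simp add: z)
qed

lemma xi_props:
  assumes c: "c \<in> atlas N" "x \<in> cimg c"
  shows "G c x [xi c x, xi c x] = 1" "om1 c x [xi c x, Y] = 0"
proof -
  have w: "alternating 2 (om1 c x)" by (rule kformD(2)[OF kform_om1 c])
  have pos: "G c x [zeta c x, zeta c x] > 0" by (rule G_positive[OF c zeta_exists(2)[OF c]])
  define a where "a = G c x [zeta c x, zeta c x]"
  have a: "a > 0" using pos by (simp add: a_def)
  have "a powr (-1/2) * a powr (-1/2) = a powr (-1)" using powr_add[of a "-1/2" "-1/2"] by simp
  also have "\<dots> = 1 / a" using a by (rule powr_neg_one)
  finally have "a powr (-1/2) * (a powr (-1/2) * a) = 1" using a by (simp flip: mult.assoc)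
  then show "G c x [xi c x, xi c x] = 1"
    by (simp add: xi_def linear_scale[OF linear_G(1)[OF c]] linear_scale[OF linear_G(2)[OF c]] flip: a_def)
  show "om1 c x [xi c x, Y] = 0"
    using linear_scale[OF multilin_append[OF alternating_imp_multilin[OF w], of "[]" "[Y]", simplified]] zeta_exists(3)[OF c]
    by (simp add: xi_def)
qed

text \<open>On the hyperplane the third complex coordinate is the real functional p5, so the volume
  form becomes (\<omega>2 + i \<omega>3) \<and> \<eta>. Its real part is the second claim, which
  later turns 3 \<Psi>p into 3 \<eta> \<and> \<omega>2.\<close>

lemma su2_coframe_at:
  assumes c: "c \<in> atlas N" "x \<in> cimg c"
  shows "\<exists>p. su2_coframe p (eta c x) (om1 c x) (om2 c x) (om3 c x) \<and>
    (\<forall>X Y Z. Pp c x [X, Y, Z] = p 5 X * om2 c x [Y, Z] - p 5 Y * om2 c x [X, Z] + p 5 Z * om2 c x [X, Y])"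
proof -
  obtain d V e where d: "d \<in> atlas M" "x \<in> local_rep_dom f c d" "local_rep f c d x \<in> V"
    "su3_chart V (F d) (\<Psi>p d) (\<Psi>m d) e (g d)" using frame_at[OF c] .
  note fr = pull_frame[OF c(1) d]
  define \<epsilon> where "\<epsilon> a X = su3_chart.cf e (local_rep f c d x) (frechet_derivative (local_rep f c d) (at x) X) a" for a X
  have unit: "(\<Sum>a=1..6. \<epsilon> a (xi c x) * \<epsilon> a (xi c x)) = 1" using xi_props(1)[OF c] unfolding fr(2) \<epsilon>_def .
  have ker: "std_F (\<lambda>a. \<epsilon> a (xi c x)) (\<lambda>a. \<epsilon> a Y) = 0" for Y using xi_props(2)[OF c] unfolding fr(1) \<epsilon>_def .
  have lin: "linear (\<epsilon> a)" if "a \<in> {1..6}" for a using fr(5)[OF that] unfolding \<epsilon>_def .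
  obtain p :: "nat \<Rightarrow> real^5 \<Rightarrow> real" where p: "\<And>i. linear (p i)" "p 1 (xi c x) = 0" "p 2 (xi c x) = 0" "p 3 (xi c x) = 0" "p 4 (xi c x) = 0" "p 5 (xi c x) = 1"
    "\<And>X Y. std_F (\<lambda>a. \<epsilon> a X) (\<lambda>a. \<epsilon> a Y) = p 1 X * p 2 Y - p 2 X * p 1 Y + p 3 X * p 4 Y - p 4 X * p 3 Y"
    "\<And>X Y. (\<Sum>a=1..6. \<epsilon> a X * \<epsilon> a Y) = (\<Sum>i=1..5. p i X * p i Y)"
    "\<And>X Y Z. std_Psi (\<lambda>a. \<epsilon> a X) (\<lambda>a. \<epsilon> a Y) (\<lambda>a. \<epsilon> a Z) = std_Psi (\<lambda>a. if a = 6 then 0 else p a X) (\<lambda>a. if a = 6 then 0 else p a Y) (\<lambda>a. if a = 6 then 0 else p a Z)"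
    by (rule hyperplane_coframe[of \<epsilon> "xi c x", OF lin unit ker]) (assumption, rule that)
  have s5: "(\<Sum>i=1..5. q i) = q 1 + q 2 + q 3 + q 4 + q (5::nat)" for q :: "nat \<Rightarrow> real"
    by (simp add: eval_nat_numeral add.assoc)
  have inj: "X = 0" if "\<forall>i\<in>{1..5}. p i X = 0" for X
  proof -
    have "G c x [X, X] = 0" unfolding fr(2) using p(8)[of X X] that by (simp add: \<epsilon>_def)
    then show ?thesis using G_positive[OF c, of X] by fastforce
  qed
  have P: "Pp c x [X, Y, Z] = std_Psip (\<lambda>a. if a = 6 then 0 else p a X) (\<lambda>a. if a = 6 then 0 else p a Y) (\<lambda>a. if a = 6 then 0 else p a Z)"
    "Pm c x [X, Y, Z] = std_Psim (\<lambda>a. if a = 6 then 0 else p a X) (\<lambda>a. if a = 6 then 0 else p a Y) (\<lambda>a. if a = 6 then 0 else p a Z)" for X Y Z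
    unfolding fr(3,4) using p(9)[of X Y Z] by (simp_all add: std_Psip_def std_Psim_def \<epsilon>_def)
  have e: "eta c x [X] = p 5 X" for X
    using p(8)[of "xi c x" X] unfolding eta_def s5 by (simp add: fr(2) \<epsilon>_def p(2-6) del: One_nat_def)
  have o1: "om1 c x [X, Y] = p 1 X * p 2 Y - p 2 X * p 1 Y + p 3 X * p 4 Y - p 4 X * p 3 Y" for X Y
    using p(7)[of X Y] unfolding fr(1) \<epsilon>_def .
  have o2: "om2 c x [X, Y] = p 1 X * p 3 Y - p 3 X * p 1 Y - p 2 X * p 4 Y + p 4 X * p 2 Y" for X Y
    by (simp add: om2_def interior_def P std_Psip_expand p(2-6) del: One_nat_def)
  have o3: "om3 c x [X, Y] = p 1 X * p 4 Y - p 4 X * p 1 Y + p 2 X * p 3 Y - p 3 X * p 2 Y" for X Y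
    by (simp add: om3_def interior_def P std_Psim_expand p(2-6) del: One_nat_def)
  have "su2_coframe p (eta c x) (om1 c x) (om2 c x) (om3 c x)"
    unfolding su2_coframe_def using p(1) inj e o1 o2 o3 by blast
  moreover have "Pp c x [X, Y, Z] = p 5 X * om2 c x [Y, Z] - p 5 Y * om2 c x [X, Z] + p 5 Z * om2 c x [X, Y]" for X Y Z
    unfolding P(1) o2 std_Psip_expand by (simp del: One_nat_def) algebra
  ultimately show ?thesis by blast
qed

end

section \<open>Smoothness and chart independence of the induced structure\<close>

context nk_hypersurface
begin

text \<open>A Cramer-type formula: inserting the other four basis vectors into the equation for
  \<zeta> isolates one coordinate, multiplied by the nonvanishing value of \<mu> on the
  basis.\<close>

lemma smooth_zeta:
  assumes c: "c \<in> atlas N"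
  shows "smooth_on (cimg c) (zeta c)"
proof -
  have o: "open (cimg c)" by (rule chart_facts(1)[OF N c])
  have "\<exists>l. set l = Basis - {b} \<and> distinct l" for b :: "real^5"
    by (rule finite_distinct_list) simp
  then obtain l where l: "\<And>b :: real^5. set (l b) = Basis - {b} \<and> distinct (l b)" by metis
  have len: "length (b # l b) = 5" if "b \<in> Basis" for b
    using distinct_card[of "l b"] l[of b] that by (simp add: card_Diff_singleton)
  have ne: "\<mu> c x (b # l b) \<noteq> 0" if x: "x \<in> cimg c" and b: "b \<in> Basis" for x b
  proof
    assume 0: "\<mu> c x (b # l b) = 0"
    have s: "set (b # l b) = Basis" using l[of b] b by auto
    obtain ws where ws: "\<mu> c x ws \<noteq> 0" using ori c x unfolding orientation_form_def nowhere_zero_def by blast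
    have "\<mu> c x ws = 0"
    proof (rule alternating_eq_0_basis[OF kformD(2)[OF kform_mu c x] len[OF b] _ _ 0])
      show "span (set (b # l b)) = UNIV" unfolding s by (rule span_Basis)
      show "distinct (b # l b)" using l[of b] by simp
    qed
    then show False using ws by simp
  qed
  let ?m = "\<lambda>b x. \<mu> c x (b # l b)"
  \<comment> \<open>The factor m times the power -1 of m squared is 1 / m, written so that the base
    is positive whatever the sign of m.\<close>
  have eq: "(\<Sum>b\<in>Basis. (wedge (om1 c x) (om1 c x) (l b) * (?m b x * ((?m b x * ?m b x) powr (-1)))) *\<^sub>R b) = zeta c x"
    if x: "x \<in> cimg c" for x
  proof -
    have "wedge (om1 c x) (om1 c x) (l b) * (?m b x * ((?m b x * ?m b x) powr (-1))) = zeta c x \<bullet> b" if b: "b \<in> Basis" for b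
    proof -
      note \<mu> = kformD(2)[OF kform_mu c x]
      have lin: "linear (\<lambda>u. \<mu> c x (u # l b))"
        using multilin_append[OF alternating_imp_multilin[OF \<mu>], of "[]" "l b"] len[OF b] by simp
      have "\<mu> c x (zeta c x # l b) = (\<Sum>b'\<in>Basis. (zeta c x \<bullet> b') * \<mu> c x (b' # l b))"
        using linear_expand[OF lin, of "zeta c x"] by simp
      also have "\<dots> = (\<Sum>b'\<in>Basis. if b' = b then (zeta c x \<bullet> b) * ?m b x else 0)"
      proof (rule sum.cong[OF refl])
        fix b' :: "real^5" assume "b' \<in> Basis"
        then have "\<mu> c x (b' # l b) = 0" if "b' \<noteq> b"
          using that l[of b] by (intro alternating_not_distinct[OF \<mu>]) simp
        then show "(zeta c x \<bullet> b') * \<mu> c x (b' # l b) = (if b' = b then (zeta c x \<bullet> b) * ?m b x else 0)" by simp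
      qed
      also have "\<dots> = (zeta c x \<bullet> b) * ?m b x" using b by simp
      finally have "wedge (om1 c x) (om1 c x) (l b) = (zeta c x \<bullet> b) * ?m b x"
        using zeta_exists(1)[OF c x] by simp
      moreover have "?m b x * ((?m b x * ?m b x) powr (-1)) = 1 / ?m b x"
        using ne[OF x b] by (simp add: powr_neg_one zero_less_mult_iff linorder_neq_iff)
      ultimately show ?thesis using ne[OF x b] by simp
    qed
    then show ?thesis by (simp add: euclidean_representation)
  qed
  have "smooth_on (cimg c) (\<lambda>x. \<Sum>b\<in>Basis. (wedge (om1 c x) (om1 c x) (l b) * (?m b x * ((?m b x * ?m b x) powr (-1)))) *\<^sub>R b)"
  proof (intro smooth_on_sum[OF o] smooth_on_scaleR[OF o] smooth_on_mult[OF o] smooth_on_const)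
    fix b :: "real^5" assume b: "b \<in> Basis"
    show "smooth_on (cimg c) (\<lambda>x. wedge (om1 c x) (om1 c x) (l b))"
      by (rule smooth_on_wedge[OF o]) (rule kformD(3)[OF kform_om1 c])+
    show m: "smooth_on (cimg c) (\<lambda>x. ?m b x)" by (rule kformD(3)[OF kform_mu c])
    show "smooth_on (cimg c) (\<lambda>x. (?m b x * ?m b x) powr (-1))"
      by (rule smooth_on_powr[OF o smooth_on_mult[OF o m m]])
        (use ne[OF _ b] in \<open>auto simp: zero_less_mult_iff linorder_neq_iff\<close>)
  qed
  then show ?thesis by (rule smooth_on_cong[OF o, rotated]) (rule eq)
qed

lemma smooth_G_eval:
  assumes c: "c \<in> atlas N" and u: "smooth_on (cimg c) u" and v: "smooth_on (cimg c) v"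
  shows "smooth_on (cimg c) (\<lambda>x. G c x [u x, v x])"
proof -
  have o: "open (cimg c)" by (rule chart_facts(1)[OF N c])
  have "smooth_on (cimg c) (\<lambda>x. G c ((\<lambda>x. x) x) (map (\<lambda>w. w x) [u, v] @ []))"
    by (rule smooth_on_tensor_eval[OF o o _ smooth_on_ident[OF o] tensor_fieldD(1)[OF tensor_G c] tensor_fieldD(2)[OF tensor_G c]])
       (use u v in auto)
  then show ?thesis by simp
qed

lemma smooth_xi:
  assumes c: "c \<in> atlas N"
  shows "smooth_on (cimg c) (xi c)"
proof -
  have o: "open (cimg c)" by (rule chart_facts(1)[OF N c])
  have "smooth_on (cimg c) (\<lambda>x. (G c x [zeta c x, zeta c x] powr (-1/2)) *\<^sub>R zeta c x)"
    by (intro smooth_on_scaleR[OF o] smooth_on_powr[OF o] smooth_G_eval[OF c] smooth_zeta[OF c] G_positive[OF c] zeta_exists(2)[OF c])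
  then show ?thesis by (simp add: xi_def[abs_def])
qed

text \<open>The transported vector solves the defining equation in the new chart, and the solution
  is unique. Surjectivity of the derivative ensures that every argument list in the new chart is the
  image of one in the old.\<close>

lemma zeta_change:
  assumes c: "c \<in> atlas N" "d \<in> atlas N" and p: "p \<in> cdom c" "p \<in> cdom d"
  shows "frechet_derivative (trans_map c d) (at (cmap c p)) (zeta c (cmap c p)) = zeta d (cmap d p)"
proof -
  let ?D = "frechet_derivative (trans_map c d) (at (cmap c p))"
  have x: "cmap c p \<in> cimg c" "cmap d p \<in> cimg d" "cmap c p \<in> overlap c d" using p by (auto simp: overlap_def)
  have s: "surj ?D" by (rule trans_map_surj[OF N c x(3)])
  have "\<mu> d (cmap d p) (?D (zeta c (cmap c p)) # vs) = wedge (om1 d (cmap d p)) (om1 d (cmap d p)) vs" for vs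
  proof -
    obtain us where us: "vs = map ?D us" using s by (metis ex_map_conv surjD)
    have "\<mu> d (cmap d p) (?D (zeta c (cmap c p)) # vs) = \<mu> c (cmap c p) (zeta c (cmap c p) # us)"
      unfolding us using kformD(4)[OF kform_mu c p, of "zeta c (cmap c p) # us"] by simp
    also have "\<dots> = wedge (om1 c (cmap c p)) (om1 c (cmap c p)) us" by (rule zeta_exists(1)[OF c(1) x(1)])
    also have "\<dots> = wedge (om1 d (cmap d p)) (om1 d (cmap d p)) vs"
      unfolding us wedge_map by (simp flip: kformD(4)[OF kform_om1 c p])
    finally show ?thesis .
  qed
  from zeta_unique[OF c(2) x(2) this] show ?thesis by simp
qed

lemma xi_change:
  assumes c: "c \<in> atlas N" "d \<in> atlas N" and p: "p \<in> cdom c" "p \<in> cdom d"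
  shows "frechet_derivative (trans_map c d) (at (cmap c p)) (xi c (cmap c p)) = xi d (cmap d p)"
proof -
  have "linear (frechet_derivative (trans_map c d) (at (cmap c p)))"
    by (rule smooth_on_linear_frechet[OF smooth_trans_map[OF N c]]) (use p in \<open>auto simp: overlap_def\<close>)
  moreover have "G c (cmap c p) [zeta c (cmap c p), zeta c (cmap c p)] = G d (cmap d p) [zeta d (cmap d p), zeta d (cmap d p)]"
    using tensor_fieldD(3)[OF tensor_G c p, of "[zeta c (cmap c p), zeta c (cmap c p)]"] zeta_change[OF c p] by simp
  ultimately show ?thesis by (simp add: xi_def linear_scale zeta_change[OF c p])
qed

lemma kform_interior:
  assumes \<alpha>: "kform N (Suc k) \<alpha>"
  shows "kform N k (\<lambda>c x. interior (xi c x) (\<alpha> c x))"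
proof (rule kformI[OF _ _ N])
  show alt: "alternating k (interior (xi c x) (\<alpha> c x))" if "c \<in> atlas N" "x \<in> cimg c" for c x
    by (rule alternating_interior[OF kformD(2)[OF \<alpha> that]])
  show "tensor_field N k (\<lambda>c x. interior (xi c x) (\<alpha> c x))"
    unfolding tensor_field_def
  proof (intro conjI ballI allI impI)
    fix c x assume "c \<in> atlas N" "x \<in> cimg c"
    then show "multilin k (interior (xi c x) (\<alpha> c x))" by (rule alternating_imp_multilin[OF alt])
  next
    fix c and vs :: "(real^5) list" assume c: "c \<in> atlas N" and vs: "length vs = k"
    have o: "open (cimg c)" by (rule chart_facts(1)[OF N c])
    note t = kform_imp_tensor_field[OF \<alpha>]
    have "smooth_on (cimg c) (\<lambda>x. \<alpha> c ((\<lambda>x. x) x) (map (\<lambda>w. w x) [xi c] @ vs))"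
      by (rule smooth_on_tensor_eval[OF o o _ smooth_on_ident[OF o] tensor_fieldD(1)[OF t c] tensor_fieldD(2)[OF t c]])
         (use smooth_xi[OF c] vs in auto)
    then show "smooth_on (cimg c) (\<lambda>x. interior (xi c x) (\<alpha> c x) vs)" by (simp add: interior_def)
  next
    fix c d p and vs :: "(real^5) list" assume c: "c \<in> atlas N" "d \<in> atlas N" and p: "p \<in> cdom c \<inter> cdom d"
    then show "interior (xi c (cmap c p)) (\<alpha> c (cmap c p)) vs =
        interior (xi d (cmap d p)) (\<alpha> d (cmap d p)) (map (frechet_derivative (trans_map c d) (at (cmap c p))) vs)"
      using kformD(4)[OF \<alpha> c, of p "xi c (cmap c p) # vs"] xi_change[OF c, of p] by (simp add: interior_def)
  qed
qed

lemma kform_om2: "kform N 2 om2"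
  using kform_interior[of 2 Pp] kform_Pp by (simp add: om2_def[abs_def])

lemma kform_om3: "kform N 2 om3"
  using kform_interior[of 2 Pm] kform_Pm by (simp add: om3_def[abs_def])

lemma kform_eta: "kform N 1 eta"
proof (rule kformI[OF _ _ N])
  show alt: "alternating 1 (eta c x)" if "c \<in> atlas N" "x \<in> cimg c" for c x
    using alternating_1[OF linear_G(2)[OF that]] by (simp add: eta_def[abs_def])
  show "tensor_field N 1 eta"
    unfolding tensor_field_def
  proof (intro conjI ballI allI impI)
    fix c x assume "c \<in> atlas N" "x \<in> cimg c"
    then show "multilin 1 (eta c x)" by (rule alternating_imp_multilin[OF alt])
  next
    fix c and vs :: "(real^5) list" assume c: "c \<in> atlas N" and vs: "length vs = 1"
    show "smooth_on (cimg c) (\<lambda>x. eta c x vs)"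
      using smooth_G_eval[OF c smooth_xi[OF c] smooth_on_const, of "hd vs"] vs by (simp add: eta_def)
  next
    fix c d p and vs :: "(real^5) list" assume c: "c \<in> atlas N" "d \<in> atlas N" and p: "p \<in> cdom c \<inter> cdom d" and vs: "length vs = 1"
    obtain v where "vs = [v]" using vs by (auto simp: length_Suc_conv)
    then show "eta c (cmap c p) vs = eta d (cmap d p) (map (frechet_derivative (trans_map c d) (at (cmap c p))) vs)"
      using tensor_fieldD(3)[OF tensor_G c, of p "[xi c (cmap c p), v]"] xi_change[OF c, of p] p by (simp add: eta_def)
  qed
qed

text \<open>Around a given point the coordinate representative of the immersion, an adapted coframe
  and its dual frame satisfy the requirements of \<open>su3_hypersurface\<close>, so its three
  derivative formulas apply.\<close>

lemma structure_equations:
  assumes c: "c \<in> atlas N" "x \<in> cimg c"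
  shows "dform (eta c) x [X, Y] = - 2 * om3 c x [X, Y]"
    "dform (om1 c) x [X, Y, Z] = 3 * Pp c x [X, Y, Z]"
    "dform (om2 c) x [X, Y, Z] = - 3 * (eta c x [X] * om1 c x [Y, Z] - eta c x [Y] * om1 c x [X, Z] + eta c x [Z] * om1 c x [X, Y])"
proof -
  obtain d V e where d: "d \<in> atlas M" "x \<in> local_rep_dom f c d" "local_rep f c d x \<in> V"
    "su3_chart V (F d) (\<Psi>p d) (\<Psi>m d) e (g d)" using frame_at[OF c] .
  interpret ch: su3_chart V "F d" "\<Psi>p d" "\<Psi>m d" e "g d" by (rule d(4))
  define h where "h = local_rep f c d"
  \<comment> \<open>The part of the chart that is mapped into the domain of the coframe; an adapted
    coframe exists only locally.\<close>
  define U where "U = local_rep_dom f c d \<inter> h -` V"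
  have sm: "smooth_on (local_rep_dom f c d) h" unfolding h_def by (rule smooth_local_rep[OF c(1) d(1)])
  have U: "open U" unfolding U_def
    by (rule continuous_open_preimage[OF smooth_on_imp_continuous[OF sm] open_local_rep_dom[OF c(1) d(1)] ch.openV])
  have x: "x \<in> U" using d(2,3) by (simp add: U_def h_def)
  have Uz: "z \<in> local_rep_dom f c d" "local_rep f c d z \<in> V" "z \<in> cimg c" if "z \<in> U" for z
    using that by (auto simp: U_def h_def local_rep_dom_def)
  note fr = pull_frame[OF c(1) d(1) Uz(1,2) d(4), folded h_def]
  have hx: "h x \<in> V" using x by (simp add: U_def)
  obtain E where E: "\<And>i j. i \<in> {1..6} \<Longrightarrow> j \<in> {1..6} \<Longrightarrow> ch.cf (h x) (E j) i = (if i = j then 1 else 0)"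
    "\<And>v. v = (\<Sum>j=1..6. ch.cf (h x) v j *\<^sub>R E j)"
  proof (rule dual_basis[of 6 "\<lambda>i v. ch.cf (h x) v i"])
    show "linear (\<lambda>v. ch.cf (h x) v i)" if "i \<in> {1..6}" for i by (rule ch.linear_cf[OF hx that])
    show "X = 0" if "\<And>i. i \<in> {1..6} \<Longrightarrow> ch.cf (h x) X i = 0" for X by (rule ch.cf_inj[OF hx that])
    show "DIM(real^6) = 6" by simp
  qed (rule that)
  interpret hy: su3_hypersurface V "F d" "\<Psi>p d" "\<Psi>m d" e "g d" h x E U "xi c"
  proof
    show "h ` U \<subseteq> V" by (auto simp: U_def)
    show "smooth_on U h" by (rule smooth_on_subset[OF sm]) (simp add: U_def)
    show "inj (frechet_derivative h (at x))" unfolding h_def by (rule inj_local_rep[OF c(1) d(1,2)])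
    show "smooth_on U (xi c)" by (rule smooth_on_subset[OF smooth_xi[OF c(1)]]) (auto simp: U_def local_rep_dom_def)
    show "(\<Sum>a=1..6. ch.cf (h z) (frechet_derivative h (at z) (xi c z)) a * ch.cf (h z) (frechet_derivative h (at z) (xi c z)) a) = 1"
      if "z \<in> U" for z using xi_props(1)[OF c(1) Uz(3)[OF that]] unfolding fr(2)[OF that that] .
    show "std_F (ch.cf (h z) (frechet_derivative h (at z) (xi c z))) (ch.cf (h z) (frechet_derivative h (at z) Y)) = 0"
      if "z \<in> U" for z Y using xi_props(2)[OF c(1) Uz(3)[OF that]] unfolding fr(1)[OF that that] .
    show "second_fundamental_form (g d) h x X Y = 0" for X Y
      using tg c(1) d(1,2) unfolding totally_geodesic_def h_def by blast
  qed (fact hx E(1) E(2) U x)+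
  show "dform (eta c) x [X, Y] = - 2 * om3 c x [X, Y]"
  proof -
    have "eta c z [Y] = (\<Sum>a=1..6. hy.eps z (xi c z) a * hy.eps z Y a)" if "z \<in> U" for z Y
      unfolding hy.eps_def fr(2)[OF that that, symmetric] by (simp add: eta_def)
    from hy.dform_eta[of "eta c", OF this] show ?thesis
      by (simp add: om3_def interior_def fr(4)[OF x x] hy.eps_def)
  qed
  show "dform (om1 c) x [X, Y, Z] = 3 * Pp c x [X, Y, Z]"
  proof -
    have "om1 c z [X, Y] = std_F (hy.eps z X) (hy.eps z Y)" if "z \<in> U" for z X Y
      unfolding hy.eps_def by (rule fr(1)[OF that that])
    from hy.dform_omega1[of "om1 c", OF this] show ?thesis by (simp add: fr(3)[OF x x] hy.eps_def)
  qed
  show "dform (om2 c) x [X, Y, Z] = - 3 * (eta c x [X] * om1 c x [Y, Z] - eta c x [Y] * om1 c x [X, Z] + eta c x [Z] * om1 c x [X, Y])"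
  proof -
    have "om2 c z [X, Y] = std_Psip (hy.eps z (xi c z)) (hy.eps z X) (hy.eps z Y)" if "z \<in> U" for z X Y
      unfolding hy.eps_def om2_def interior_def by (rule fr(3)[OF that that])
    from hy.dform_omega2[of "om2 c", OF this] show ?thesis
      by (simp add: fr(1)[OF x x] fr(2)[OF x x] hy.eps_def eta_def)
  qed
qed

lemma dform_eta_eq:
  assumes c: "c \<in> atlas N" "x \<in> cimg c"
  shows "dform (eta c) x vs = - 2 * om3 c x vs"
proof (cases "length vs = 2")
  case True
  then obtain X Y where "vs = [X, Y]" by (auto simp: numeral_2_eq_2 length_Suc_conv)
  then show ?thesis using structure_equations(1)[OF c] by simp
next
  case False
  then have "dform (eta c) x vs = 0"
    by (intro dform_degree[OF chart_facts(1)[OF N c(1)] c(2) smooth_lform_homogeneous[OF kformD(1)[OF kform_eta c(1)]]]) simp_all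
  then show ?thesis using alternating_length[OF kformD(2)[OF kform_om3 c] False] by simp
qed

lemma homogeneous_forms:
  assumes c: "c \<in> atlas N" "x \<in> cimg c"
  shows "homogeneous 1 (eta c x)" "homogeneous 2 (om1 c x)" "homogeneous 2 (om2 c x)" "homogeneous 2 (om3 c x)"
  using kformD(2)[OF kform_eta c] kformD(2)[OF kform_om1 c] kformD(2)[OF kform_om2 c] kformD(2)[OF kform_om3 c]
  by (simp_all add: alternating_homogeneous)

lemma dform_om_eq:
  assumes c: "c \<in> atlas N" "x \<in> cimg c"
  shows "dform (om1 c) x vs = 3 * wedge (eta c x) (om2 c x) vs" "dform (om2 c) x vs = - 3 * wedge (eta c x) (om1 c x) vs"
proof -
  note h = homogeneous_forms[OF c]
  have "dform (om1 c) x vs = 3 * wedge (eta c x) (om2 c x) vs \<and> dform (om2 c) x vs = - 3 * wedge (eta c x) (om1 c x) vs"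
  proof (cases "length vs = 3")
    case True
    then obtain X Y Z where vs: "vs = [X, Y, Z]" by (auto simp: numeral_3_eq_3 length_Suc_conv)
    obtain p where p: "su2_coframe p (eta c x) (om1 c x) (om2 c x) (om3 c x)"
      "Pp c x [X, Y, Z] = p 5 X * om2 c x [Y, Z] - p 5 Y * om2 c x [X, Z] + p 5 Z * om2 c x [X, Y]"
      using su2_coframe_at[OF c] by blast
    have e: "eta c x [X] = p 5 X" for X using p(1) by (simp add: su2_coframe_def)
    show ?thesis
      unfolding vs structure_equations(2,3)[OF c] wedge_1_2[OF h(1,3)] wedge_1_2[OF h(1,2)] p(2) e by simp
  next
    case False
    then have "dform (om1 c) x vs = 0" "dform (om2 c) x vs = 0"
      using dform_degree[OF chart_facts(1)[OF N c(1)] c(2) smooth_lform_homogeneous[OF kformD(1)[OF kform_om1 c(1)]]]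
        dform_degree[OF chart_facts(1)[OF N c(1)] c(2) smooth_lform_homogeneous[OF kformD(1)[OF kform_om2 c(1)]]]
      by simp_all
    then show ?thesis using wedge_degree[OF h(1,3)] wedge_degree[OF h(1,2)] False by simp
  qed
  then show "dform (om1 c) x vs = 3 * wedge (eta c x) (om2 c x) vs" "dform (om2 c) x vs = - 3 * wedge (eta c x) (om1 c x) vs" by auto
qed

end

section \<open>Hypo structures and the conical evolution\<close>

lemma kform_scale:
  fixes N :: "('b, 'w::euclidean_space) manifold"
  assumes \<alpha>: "kform N k \<alpha>" and N: "smooth_manifold N"
  shows "kform N k (r \<odot> \<alpha>)"
  unfolding kform_def smooth_lform_on_def
proof (intro conjI ballI allI)
  fix c x assume c: "c \<in> atlas N" "x \<in> cimg c"
  have m: "linear (\<lambda>u. r * f u)" if "linear f" for f :: "'w \<Rightarrow> real"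
    using that by (simp add: linear_iff algebra_simps)
  show "alternating k ((r \<odot> \<alpha>) c x)"
    using kformD(2)[OF \<alpha> c] unfolding alternating_def scale_form_def by (auto intro: m)
next
  fix c vs assume c: "c \<in> atlas N"
  show "smooth_on (cimg c) (\<lambda>x. (r \<odot> \<alpha>) c x vs)"
    unfolding scale_form_def
    by (rule smooth_on_mult[OF chart_facts(1)[OF N c] smooth_on_const kformD(3)[OF \<alpha> c]])
next
  fix c d p vs assume "c \<in> atlas N" "d \<in> atlas N" "p \<in> cdom c \<inter> cdom d"
  then show "(r \<odot> \<alpha>) c (cmap c p) vs = (r \<odot> \<alpha>) d (cmap d p) (map (frechet_derivative (cmap d \<circ> cinv c) (at (cmap c p))) vs)"
    using kformD(4)[OF \<alpha>, of c d p vs] by (simp add: scale_form_def trans_map_def)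
qed

lemma kform_wedge_2_2:
  assumes \<alpha>: "kform N 2 \<alpha>" and \<beta>: "kform N 2 \<beta>" and N: "smooth_manifold N"
  shows "kform N 4 (\<alpha> \<triangle> \<beta>)"
  unfolding kform_def smooth_lform_on_def wedge_form_def
proof (intro conjI ballI allI)
  fix c x assume c: "c \<in> atlas N" "x \<in> cimg c"
  show "alternating 4 (wedge (\<alpha> c x) (\<beta> c x))"
    by (rule alternating_wedge_2_2[OF kformD(2)[OF \<alpha> c] kformD(2)[OF \<beta> c]])
next
  fix c vs assume c: "c \<in> atlas N"
  show "smooth_on (cimg c) (\<lambda>x. wedge (\<alpha> c x) (\<beta> c x) vs)"
    by (rule smooth_on_wedge[OF chart_facts(1)[OF N c] kformD(3)[OF \<alpha> c] kformD(3)[OF \<beta> c]])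
next
  fix c d p vs assume c: "c \<in> atlas N" "d \<in> atlas N" and p: "p \<in> cdom c \<inter> cdom d"
  then have p': "p \<in> cdom c" "p \<in> cdom d" by auto
  show "wedge (\<alpha> c (cmap c p)) (\<beta> c (cmap c p)) vs =
      wedge (\<alpha> d (cmap d p)) (\<beta> d (cmap d p)) (map (frechet_derivative (cmap d \<circ> cinv c) (at (cmap c p))) vs)"
    unfolding wedge_map by (simp flip: kformD(4)[OF \<alpha> c p', unfolded trans_map_def] kformD(4)[OF \<beta> c p', unfolded trans_map_def])
qed

text \<open>The common 4-form v is taken to be the square of \<omega>1. Every algebraic condition is
  then settled point by point, and the coframes for different points need not be related.\<close>

lemma su2_structureI:
  assumes N: "smooth_manifold N"
    and k: "kform N 1 \<eta>" "kform N 2 \<omega>1" "kform N 2 \<omega>2" "kform N 2 \<omega>3"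
    and co: "\<And>c x. c \<in> atlas N \<Longrightarrow> x \<in> cimg c \<Longrightarrow> \<exists>p. su2_coframe p (\<eta> c x) (\<omega>1 c x) (\<omega>2 c x) (\<omega>3 c x)"
  shows "su2_structure N \<eta> \<omega>1 \<omega>2 \<omega>3"
proof -
  have h: "homogeneous 1 (\<eta> c x)" "homogeneous 2 (\<omega>1 c x)" "homogeneous 2 (\<omega>2 c x)" "homogeneous 2 (\<omega>3 c x)"
    if "c \<in> atlas N" "x \<in> cimg c" for c x
    using kformD(2)[OF k(1) that] kformD(2)[OF k(2) that] kformD(2)[OF k(3) that] kformD(2)[OF k(4) that]
    by (simp_all add: alternating_homogeneous)
  have w: "wedge (\<omega>2 c x) (\<omega>2 c x) = wedge (\<omega>1 c x) (\<omega>1 c x)" "wedge (\<omega>3 c x) (\<omega>3 c x) = wedge (\<omega>1 c x) (\<omega>1 c x)"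
    "wedge (\<omega>1 c x) (\<omega>2 c x) = (\<lambda>_. 0)" "wedge (\<omega>1 c x) (\<omega>3 c x) = (\<lambda>_. 0)" "wedge (\<omega>2 c x) (\<omega>3 c x) = (\<lambda>_. 0)"
    if cx: "c \<in> atlas N" "x \<in> cimg c" for c x
  proof -
    obtain p where "su2_coframe p (\<eta> c x) (\<omega>1 c x) (\<omega>2 c x) (\<omega>3 c x)" using co[OF cx] by blast
    from su2_coframe_wedge[OF this h(2-4)[OF cx]]
    show "wedge (\<omega>2 c x) (\<omega>2 c x) = wedge (\<omega>1 c x) (\<omega>1 c x)" "wedge (\<omega>3 c x) (\<omega>3 c x) = wedge (\<omega>1 c x) (\<omega>1 c x)"
      "wedge (\<omega>1 c x) (\<omega>2 c x) = (\<lambda>_. 0)" "wedge (\<omega>1 c x) (\<omega>3 c x) = (\<lambda>_. 0)" "wedge (\<omega>2 c x) (\<omega>3 c x) = (\<lambda>_. 0)" .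
  qed
  have nz: "nowhere_zero N ((\<omega>1 \<triangle> \<omega>1) \<triangle> \<eta>)"
    unfolding nowhere_zero_def wedge_form_def
  proof (intro ballI)
    fix c x assume cx: "c \<in> atlas N" "x \<in> cimg c"
    obtain p where "su2_coframe p (\<eta> c x) (\<omega>1 c x) (\<omega>2 c x) (\<omega>3 c x)" using co[OF cx] by blast
    then show "\<exists>vs. wedge (wedge (\<omega>1 c x) (\<omega>1 c x)) (\<eta> c x) vs \<noteq> 0"
      by (rule su2_coframe_nondegenerate[OF _ h(2,1)[OF cx]])
  qed
  have pos: "0 \<le> \<omega>3 c x [X, Y]" if cx: "c \<in> atlas N" "x \<in> cimg c" and "interior X (\<omega>1 c x) = interior Y (\<omega>2 c x)" for c x X Y
  proof -
    obtain p where "su2_coframe p (\<eta> c x) (\<omega>1 c x) (\<omega>2 c x) (\<omega>3 c x)" using co[OF cx] by blast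
    then show ?thesis using that(3) by (rule su2_coframe_positive)
  qed
  have z: "\<zero>\<^sub>f c x = (\<lambda>_. 0)" for c :: "('a, real^5) chart" and x by (simp add: fun_eq_iff zero_form_def)
  have "kform N 4 (\<omega>1 \<triangle> \<omega>1) \<and> nowhere_zero N ((\<omega>1 \<triangle> \<omega>1) \<triangle> \<eta>) \<and>
        \<omega>1 \<triangle> \<omega>1 \<approx>\<^bsub>N\<^esub> \<omega>1 \<triangle> \<omega>1 \<and> \<omega>2 \<triangle> \<omega>2 \<approx>\<^bsub>N\<^esub> \<omega>1 \<triangle> \<omega>1 \<and> \<omega>3 \<triangle> \<omega>3 \<approx>\<^bsub>N\<^esub> \<omega>1 \<triangle> \<omega>1 \<and>
        \<omega>1 \<triangle> \<omega>2 \<approx>\<^bsub>N\<^esub> \<zero>\<^sub>f \<and> \<omega>1 \<triangle> \<omega>3 \<approx>\<^bsub>N\<^esub> \<zero>\<^sub>f \<and> \<omega>2 \<triangle> \<omega>3 \<approx>\<^bsub>N\<^esub> \<zero>\<^sub>f"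
    using kform_wedge_2_2[OF k(2,2) N] nz w by (simp add: form_eq_def wedge_form_def z)
  then show ?thesis
    unfolding su2_structure_def using k pos by blast
qed

lemma smooth_family_scale:
  assumes \<alpha>: "kform N k \<alpha>" and N: "smooth_manifold N"
  shows "smooth_family N {0<..} (\<lambda>t. t ^ n \<odot> \<alpha>)"
  unfolding smooth_family_def
proof (intro ballI allI)
  fix c vs assume c: "c \<in> atlas N"
  let ?S = "{0::real<..} \<times> cimg c"
  have o: "open ?S" by (rule open_Times[OF open_greaterThan chart_facts(1)[OF N c]])
  have f: "smooth_on ?S (\<lambda>p. fst p)" and s: "smooth_on ?S (\<lambda>p. snd p)"
    by (rule smooth_on_linear[OF o _ smooth_on_ident[OF o]], rule bounded_linear_fst bounded_linear_snd)+
  have "smooth_on ?S (\<lambda>p. fst p ^ m)" for m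
    by (induction m) (simp_all add: smooth_on_mult[OF o f])
  moreover have "smooth_on ?S (\<lambda>p. \<alpha> c (snd p) vs)"
    by (rule smooth_on_compose[OF o chart_facts(1)[OF N c] _ s kformD(3)[OF \<alpha> c]]) auto
  ultimately have "smooth_on ?S (\<lambda>p. fst p ^ n * \<alpha> c (snd p) vs)" by (rule smooth_on_mult[OF o])
  then show "smooth_on ?S (\<lambda>(t, x). (t ^ n \<odot> \<alpha>) c x vs)"
    by (simp add: case_prod_unfold scale_form_def)
qed

lemma has_time_derivI:
  assumes "\<And>t c x vs. t \<in> I \<Longrightarrow> c \<in> atlas N \<Longrightarrow> x \<in> cimg c \<Longrightarrow> \<beta> t c x vs = n * t ^ (n - 1) * \<gamma> c x vs"
    and "\<And>t c x vs. \<alpha> t c x vs = t ^ n * \<gamma> c x vs"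
  shows "has_time_deriv N I \<alpha> \<beta>"
  unfolding has_time_deriv_def
proof (intro ballI allI)
  fix t c x vs assume *: "t \<in> I" "c \<in> atlas N" "x \<in> cimg c"
  have "((\<lambda>s. s ^ n * \<gamma> c x vs) has_real_derivative (n * t ^ (n - 1)) * \<gamma> c x vs) (at t)"
    by (auto intro!: derivative_eq_intros)
  then show "((\<lambda>s. \<alpha> s c x vs) has_real_derivative \<beta> t c x vs) (at t)"
    unfolding assms(2) assms(1)[OF *] .
qed

section \<open>Closedness, conical scaling and the evolution equations\<close>

context nk_hypersurface
begin

text \<open>Applying d once more to the three structure equations and dividing by -2, 3 and
  -3.\<close>

lemma dform_closed:
  assumes c: "c \<in> atlas N" "x \<in> cimg c"
  shows "dform (om3 c) x vs = 0"
    "dform (\<lambda>x. wedge (eta c x) (om2 c x)) x vs = 0" "dform (\<lambda>x. wedge (eta c x) (om1 c x)) x vs = 0"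
proof -
  note o = chart_facts(1)[OF N c(1)]
  have sw: "smooth_on (cimg c) (\<lambda>x. wedge (eta c x) (om2 c x) vs)" "smooth_on (cimg c) (\<lambda>x. wedge (eta c x) (om1 c x) vs)" for vs
    by (rule smooth_on_wedge[OF o kformD(3)[OF kform_eta c(1)]], rule kformD(3)[OF kform_om2 c(1)] kformD(3)[OF kform_om1 c(1)])+
  have "dform (\<lambda>x vs. - 2 * om3 c x vs) x vs = dform (dform (eta c)) x vs"
    by (rule fun_cong[OF dform_cong[OF o c(2)]]) (rule ext, rule dform_eta_eq[OF c(1), symmetric])
  then show "dform (om3 c) x vs = 0"
    unfolding dform_scale[OF kformD(3)[OF kform_om3 c(1)] c(2)] dform_dform_1[OF kformD(1)[OF kform_eta c(1)] o c(2)] by simp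
  have "dform (\<lambda>x vs. 3 * wedge (eta c x) (om2 c x) vs) x vs = dform (dform (om1 c)) x vs"
    by (rule fun_cong[OF dform_cong[OF o c(2)]]) (rule ext, rule dform_om_eq(1)[OF c(1), symmetric])
  then show "dform (\<lambda>x. wedge (eta c x) (om2 c x)) x vs = 0"
    unfolding dform_scale[OF sw(1) c(2)] dform_dform_2[OF kformD(1)[OF kform_om1 c(1)] o c(2)] by simp
  have "dform (\<lambda>x vs. - 3 * wedge (eta c x) (om1 c x) vs) x vs = dform (dform (om2 c)) x vs"
    by (rule fun_cong[OF dform_cong[OF o c(2)]]) (rule ext, rule dform_om_eq(2)[OF c(1), symmetric])
  then show "dform (\<lambda>x. wedge (eta c x) (om1 c x)) x vs = 0"
    unfolding dform_scale[OF sw(2) c(2)] dform_dform_2[OF kformD(1)[OF kform_om2 c(1)] o c(2)] by simp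
qed

lemma sasaki_einstein: "sasaki_einstein_hypo N eta om1 om2 om3"
proof -
  have "su2_structure N eta om1 om2 om3"
    using su2_coframe_at by (intro su2_structureI[OF N kform_eta kform_om1 kform_om2 kform_om3]) blast
  then show ?thesis
    by (simp add: sasaki_einstein_hypo_def form_eq_def ext_deriv_eq_dform scale_form_def wedge_form_def fun_eq_iff
        dform_eta_eq dform_om_eq)
qed

lemma ext_deriv_scale:
  assumes "kform N k \<alpha>" "c \<in> atlas N" "x \<in> cimg c"
  shows "ext_deriv (r \<odot> \<alpha>) c x vs = r * dform (\<alpha> c) x vs"
proof -
  have "(r \<odot> \<alpha>) c = (\<lambda>y vs. r * \<alpha> c y vs)" by (simp add: fun_eq_iff scale_form_def)
  then show ?thesis
    using dform_scale[OF kformD(3)[OF assms(1,2)] assms(3), where r = r and vs = vs] by (simp add: ext_deriv_eq_dform)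
qed

text \<open>Multiplying a coframe by t gives a coframe of the scaled forms, and the cyclic
  relabelling moves the closed form \<omega>3 to the first place. The hypo conditions are then the
  three closedness statements, multiplied by constants.\<close>

lemma hypo_scaled:
  assumes t: "t > 0"
  shows "hypo N (t \<odot> eta) (t\<^sup>2 \<odot> om3) (t\<^sup>2 \<odot> om1) (t\<^sup>2 \<odot> om2)"
proof -
  have "\<exists>p. su2_coframe p ((t \<odot> eta) c x) ((t\<^sup>2 \<odot> om3) c x) ((t\<^sup>2 \<odot> om1) c x) ((t\<^sup>2 \<odot> om2) c x)"
    if c: "c \<in> atlas N" "x \<in> cimg c" for c x
  proof -
    obtain p where "su2_coframe p (eta c x) (om1 c x) (om2 c x) (om3 c x)" using su2_coframe_at[OF c] by blast
    from su2_coframe_cycle[OF this] obtain q where "su2_coframe q (eta c x) (om3 c x) (om1 c x) (om2 c x)" by blast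
    from su2_coframe_scale[OF this, of t] t show ?thesis
      unfolding scale_form_def[abs_def] by blast
  qed
  then have su2: "su2_structure N (t \<odot> eta) (t\<^sup>2 \<odot> om3) (t\<^sup>2 \<odot> om1) (t\<^sup>2 \<odot> om2)"
    by (intro su2_structureI[OF N] kform_scale[OF _ N] kform_eta kform_om1 kform_om2 kform_om3)
  have w: "ext_deriv ((t \<odot> eta) \<triangle> (t\<^sup>2 \<odot> \<beta>)) c x vs = 0"
    if c: "c \<in> atlas N" "x \<in> cimg c" and \<beta>: "kform N 2 \<beta>" and 0: "dform (\<lambda>x. wedge (eta c x) (\<beta> c x)) x vs = 0" for \<beta> c x vs
  proof -
    have "((t \<odot> eta) \<triangle> (t\<^sup>2 \<odot> \<beta>)) c = (\<lambda>y vs. t * t\<^sup>2 * wedge (eta c y) (\<beta> c y) vs)"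
      by (simp add: fun_eq_iff wedge_form_def scale_form_def[abs_def] wedge_scale)
    moreover have "smooth_on (cimg c) (\<lambda>x. wedge (eta c x) (\<beta> c x) vs)" for vs
      by (rule smooth_on_wedge[OF chart_facts(1)[OF N c(1)] kformD(3)[OF kform_eta c(1)] kformD(3)[OF \<beta> c(1)]])
    ultimately show ?thesis
      unfolding ext_deriv_eq_dform using dform_scale[where V = "cimg c" and a = "\<lambda>y. wedge (eta c y) (\<beta> c y)" and r = "t * t\<^sup>2"] c(2) 0 by simp
  qed
  show ?thesis
    unfolding hypo_def form_eq_def
    using su2 w[OF _ _ kform_om1 dform_closed(3)] w[OF _ _ kform_om2 dform_closed(2)]
    by (simp add: fun_eq_iff zero_form_def ext_deriv_scale[OF kform_om3] dform_closed(1))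
qed

lemma scale_1: "1 \<odot> \<alpha> = \<alpha>"
  by (simp add: fun_eq_iff scale_form_def)

text \<open>The factor 2 t from differentiating \<open>t^2\<close> meets d\<eta> = -2 \<omega>3
  scaled by t; the factor 3 \<open>t^2\<close> from \<open>t^3\<close> meets the equations for
  d\<omega>1 and d\<omega>2 scaled by \<open>t^2\<close>.\<close>

lemma evolution:
  "conti_salamon_evolution N {0<..} (\<lambda>t. t \<odot> eta) (\<lambda>t. t\<^sup>2 \<odot> om3) (\<lambda>t. t\<^sup>2 \<odot> om1) (\<lambda>t. t\<^sup>2 \<odot> om2)"
  unfolding conti_salamon_evolution_def
proof (intro conjI)
  have w: "((t \<odot> eta) \<triangle> (t\<^sup>2 \<odot> \<beta>)) c x vs = t ^ 3 * wedge (eta c x) (\<beta> c x) vs" for t \<beta> c x vs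
    by (simp add: wedge_form_def scale_form_def[abs_def] wedge_scale power2_eq_square power3_eq_cube)
  have s: "(r \<odot> \<alpha>) c x vs = r * \<alpha> c x vs" for r \<alpha> c x vs by (simp add: scale_form_def)
  show "has_time_deriv N {0<..} (\<lambda>t. t\<^sup>2 \<odot> om3) (\<lambda>t. (-1) \<odot> ext_deriv (t \<odot> eta))"
    by (rule has_time_derivI[where n = 2 and \<gamma> = om3]) (simp_all add: s ext_deriv_scale[OF kform_eta] dform_eta_eq)
  show "has_time_deriv N {0<..} (\<lambda>t. (t \<odot> eta) \<triangle> (t\<^sup>2 \<odot> om2)) (\<lambda>t. ext_deriv (t\<^sup>2 \<odot> om1))"
    by (rule has_time_derivI[where n = 3 and \<gamma> = "\<lambda>c x. wedge (eta c x) (om2 c x)"])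
       (simp_all add: w ext_deriv_scale[OF kform_om1] dform_om_eq)
  show "has_time_deriv N {0<..} (\<lambda>t. (t \<odot> eta) \<triangle> (t\<^sup>2 \<odot> om1)) (\<lambda>t. (-1) \<odot> ext_deriv (t\<^sup>2 \<odot> om2))"
    by (rule has_time_derivI[where n = 3 and \<gamma> = "\<lambda>c x. wedge (eta c x) (om1 c x)"])
       (simp_all add: w s ext_deriv_scale[OF kform_om2] dform_om_eq)
qed

end

theorem theorem2p2:
  fixes M :: "('a, real^6) manifold" and N :: "('b, real^5) manifold"
    and F \<Psi>p \<Psi>m :: "('a, real^6) mform" and g :: "('a, real^6) mmetric"
    and f :: "'b \<Rightarrow> 'a" and \<mu> :: "('b, real^5) mform"
  assumes "smooth_manifold M" and "nearly_kaehler M F \<Psi>p \<Psi>m" and "su3_metric M F \<Psi>p \<Psi>m g"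
    and "smooth_manifold N" and "orientation_form N \<mu>"
    and "immersion N M f" and "totally_geodesic N M g f"
  shows "\<exists>\<eta> \<omega>1 \<omega>2 \<omega>3.
    sasaki_einstein_hypo N \<eta> \<omega>1 \<omega>2 \<omega>3 \<and>
    hypo N \<eta> \<omega>3 \<omega>1 \<omega>2 \<and>
    (\<exists>\<eta>' \<omega>1' \<omega>2' \<omega>3'.
       smooth_family N {0<..} \<eta>' \<and> smooth_family N {0<..} \<omega>1' \<and>
       smooth_family N {0<..} \<omega>2' \<and> smooth_family N {0<..} \<omega>3' \<and>
       (\<forall>t>0. hypo N (\<eta>' t) (\<omega>1' t) (\<omega>2' t) (\<omega>3' t)) \<and>
       (\<exists>t0>0. \<eta>' t0 \<approx>\<^bsub>N\<^esub> \<eta> \<and> \<omega>1' t0 \<approx>\<^bsub>N\<^esub> \<omega>3 \<and> \<omega>2' t0 \<approx>\<^bsub>N\<^esub> \<omega>1 \<and> \<omega>3' t0 \<approx>\<^bsub>N\<^esub> \<omega>2) \<and>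
       conti_salamon_evolution N {0<..} \<eta>' \<omega>1' \<omega>2' \<omega>3')"
proof -
  interpret nk_hypersurface N M f F \<Psi>p \<Psi>m g \<mu>
    by unfold_locales (fact assms)+
  have hypo1: "hypo N eta om3 om1 om2" using hypo_scaled[of 1] by (simp add: scale_1)
  have sm: "smooth_family N {0<..} (\<lambda>t. t \<odot> eta)" "smooth_family N {0<..} (\<lambda>t. t\<^sup>2 \<odot> om3)"
    "smooth_family N {0<..} (\<lambda>t. t\<^sup>2 \<odot> om1)" "smooth_family N {0<..} (\<lambda>t. t\<^sup>2 \<odot> om2)"
    using smooth_family_scale[OF kform_eta N, of 1] smooth_family_scale[OF kform_om3 N, of 2]
      smooth_family_scale[OF kform_om1 N, of 2] smooth_family_scale[OF kform_om2 N, of 2] by simp_all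
  \<comment> \<open>The link of the cone at t = 1 is the given structure.\<close>
  have t0: "\<exists>t0>0. t0 \<odot> eta \<approx>\<^bsub>N\<^esub> eta \<and> t0\<^sup>2 \<odot> om3 \<approx>\<^bsub>N\<^esub> om3 \<and> t0\<^sup>2 \<odot> om1 \<approx>\<^bsub>N\<^esub> om1 \<and> t0\<^sup>2 \<odot> om2 \<approx>\<^bsub>N\<^esub> om2"
    by (rule exI[of _ 1]) (simp add: scale_1 form_eq_def)
  have h: "\<forall>t>0. hypo N (t \<odot> eta) (t\<^sup>2 \<odot> om3) (t\<^sup>2 \<odot> om1) (t\<^sup>2 \<odot> om2)" using hypo_scaled by blast
  show ?thesis
    by (rule exI[of _ eta], rule exI[of _ om1], rule exI[of _ om2], rule exI[of _ om3], intro conjI sasaki_einstein hypo1,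
        rule exI[of _ "\<lambda>t. t \<odot> eta"], rule exI[of _ "\<lambda>t. t\<^sup>2 \<odot> om3"], rule exI[of _ "\<lambda>t. t\<^sup>2 \<odot> om1"], rule exI[of _ "\<lambda>t. t\<^sup>2 \<odot> om2"])
       (use sm t0 h evolution in simp)
qed

end
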